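(* Let $K\subset\mathbb{R}^d$ be a compact convex set whose interior contains the origin. Let $\xi_1,\xi_2,\dots$ be independent random vectors uniformly distributed in $K$, let $\Xi_n=\{\xi_1,\dots,\xi_n\}$, and let $$X_n:=K\ominus\Xi_n=\{x\in\mathbb{R}^d:\ \Xi_n+x\subseteq K\}=\bigcap_{i=1}^n (K-\xi_i).$$ Then the sequence of random convex bodies $(nX_n)_{n\in\mathbb{N}}$ converges in distribution, as $n\to\infty$, to the zero cell $Z$ of the Poisson hyperplane tessellation associated with $K$ (defined in the context). Furthermore, the random convex bodies $n^{-1}X_n^o$ converge in distribution to $Z^o$ as $n\to\infty$.
   Context: Polar set: $L^o=\{u\in\mathbb{R}^d:\ \langle u,x\rangle\le 1\ \text{for all } x\in L\}$. Convergence in distribution of random compact convex sets means weak convergence of the corresponding probability measures on the space of compact convex subsets of $\mathbb{R}^d$ equipped with the Hausdorff metric. Zero cell: let $V_d$ be Lebesgue measure on $\mathbb{R}^d$ and let $S_{d-1}(K,\cdot)$ be the surface area measure of $K$ on the unit sphere $\mathbb{S}^{d-1}$. Let $\mathcal{P}_K=\{(t_i,u_i): i\ge 1\}$ be a Poisson process on $(0,\infty)\times\mathbb{S}^{d-1}$ with intensity measure equal to the product of $V_d(K)^{-1}$ times Lebesgue measure on $(0,\infty)$ and $S_{d-1}(K,\cdot)$. For $t>0$, $u\in\mathbb{S}^{d-1}$ put $H_u^-(t)=\{x\in\mathbb{R}^d:\ \langle x,u\rangle\le t\}$. The zero cell is $Z:=\bigcap_{i\ge1}H^-_{u_i}(t_i)$;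 it is almost surely a polytope containing the origin in its interior. *)

theory Defs
  imports "HOL-Probability.Probability"
begin

section \<open>The space of convex bodies with the Hausdorff metric\<close>

definition hausdorff_dist :: "'a::metric_space set \<Rightarrow> 'a set \<Rightarrow> real" where
  "hausdorff_dist A B = max (SUP x\<in>A. infdist x B) (SUP y\<in>B. infdist y A)"

lemma hausdorff_dist_le_iff:
  fixes A B :: "'a::metric_space set"
  assumes "compact A" "A \<noteq> {}" "compact B" "B \<noteq> {}"
  shows "hausdorff_dist A B \<le> r \<longleftrightarrow> (\<forall>x\<in>A. infdist x B \<le> r) \<and> (\<forall>y\<in>B. infdist y A \<le> r)"
proof -
  have bdd: "bdd_above ((\<lambda>x. infdist x D) ` C)" if "compact C" for C D :: "'a set"
    by (intro bounded_imp_bdd_above compact_imp_bounded compact_continuous_image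
        continuous_on_infdist continuous_on_id that)
  show ?thesis
    unfolding hausdorff_dist_def
    using cSUP_le_iff[OF assms(2) bdd[OF assms(1)], of B r]
      cSUP_le_iff[OF assms(4) bdd[OF assms(3)], of A r]
    by simp
qed

text \<open>The empty set is excluded, as the Hausdorff distance to it is not finite.\<close>

typedef (overloaded) ('a::euclidean_space) convex_body =
  "{L :: 'a set. compact L \<and> convex L \<and> L \<noteq> {}}"
  morphisms body_set Abs_convex_body
  by (rule exI[of _ "{0}"]) simp

instantiation convex_body :: (euclidean_space) metric_space
begin

definition dist_convex_body :: "'a convex_body \<Rightarrow> 'a convex_body \<Rightarrow> real" where
  "dist_convex_body A B = hausdorff_dist (body_set A) (body_set B)"

definition uniformity_convex_body :: "('a convex_body \<times> 'a convex_body) filter" where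
  "uniformity_convex_body = (INF e\<in>{0<..}. principal {(A, B). dist A B < e})"

definition open_convex_body :: "'a convex_body set \<Rightarrow> bool" where
  "open_convex_body S = (\<forall>A\<in>S. \<forall>\<^sub>F (A', B) in uniformity. A' = A \<longrightarrow> B \<in> S)"

instance
proof
  fix A B C :: "'a convex_body"
  have *: "compact (body_set L)" "body_set L \<noteq> {}" for L :: "'a convex_body"
    using body_set[of L] by auto
  have le: "dist A B \<le> r \<longleftrightarrow>
      (\<forall>x\<in>body_set A. infdist x (body_set B) \<le> r) \<and> (\<forall>y\<in>body_set B. infdist y (body_set A) \<le> r)"
    for A B :: "'a convex_body" and r
    unfolding dist_convex_body_def by (intro hausdorff_dist_le_iff *)
  have nonneg: "0 \<le> dist A B" for A B :: "'a convex_body"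
    using le[of A B "dist A B"] *(2)[of A] infdist_nonneg by (meson all_not_in_conv order_refl order_trans)
  show "dist A B = 0 \<longleftrightarrow> A = B"
  proof
    assume "dist A B = 0"
    then have le0: "\<forall>x\<in>body_set A. infdist x (body_set B) \<le> 0"
      "\<forall>y\<in>body_set B. infdist y (body_set A) \<le> 0"
      using le[of A B 0] by auto
    have sub: "D \<subseteq> E" if "\<forall>x\<in>D. infdist x E \<le> 0" "compact E" "E \<noteq> {}" for D E :: "'a set"
      using that by (metis antisym compact_imp_closed in_closed_iff_infdist_zero infdist_nonneg subsetI)
    have "body_set A = body_set B"
      by (intro antisym sub le0 *)
    then show "A = B"
      by (simp add: body_set_inject)
  next
    assume "A = B"
    then have "dist A B \<le> 0"
      using le[of A B 0] by simp
    then show "dist A B = 0"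
      using nonneg[of A B] by simp
  qed
  have tri: "infdist x (body_set B') \<le> dist A' C' + dist C' B'"
    if "x \<in> body_set A'" for x and A' B' C' :: "'a convex_body"
  proof -
    obtain c where c: "c \<in> body_set C'" "infdist x (body_set C') = dist x c"
      using infdist_attains_inf[of "body_set C'" x] * compact_imp_closed by metis
    have "infdist x (body_set B') \<le> infdist c (body_set B') + dist x c"
      by (rule infdist_triangle)
    moreover have "infdist c (body_set B') \<le> dist C' B'"
      using le[of C' B' "dist C' B'"] c by auto
    moreover have "dist x c \<le> dist A' C'"
      using le[of A' C' "dist A' C'"] c that by auto
    ultimately show ?thesis by simp
  qed
  have sym: "dist A B = dist B A" for A B :: "'a convex_body"
    by (simp add: dist_convex_body_def hausdorff_dist_def max.commute)
  show "dist A B \<le> dist A C + dist B C"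
    using tri[of _ A B C] tri[of _ B A C] by (subst le) (auto simp: sym add.commute)
qed (simp_all add: uniformity_convex_body_def open_convex_body_def)

end

section \<open>Convergence in distribution of random convex bodies\<close>

definition is_convex_body :: "'a::euclidean_space set \<Rightarrow> bool" where
  "is_convex_body L \<longleftrightarrow> compact L \<and> convex L \<and> L \<noteq> {}"

text \<open>
  Random sets are given as set-valued functions that need to be convex bodies only almost
  surely; on the exceptional null set the value is replaced by the arbitrary body \<open>{0}\<close>.
\<close>

definition to_body :: "'a::euclidean_space set \<Rightarrow> 'a convex_body" where
  "to_body L = Abs_convex_body (if is_convex_body L then L else {0})"

definition random_convex_body :: "'w measure \<Rightarrow> ('w \<Rightarrow> 'a::euclidean_space set) \<Rightarrow> bool" where
  "random_convex_body M X \<longleftrightarrow>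
     (AE \<omega> in M. is_convex_body (X \<omega>)) \<and> (\<lambda>\<omega>. to_body (X \<omega>)) \<in> M \<rightarrow>\<^sub>M borel"

definition body_distr :: "'w measure \<Rightarrow> ('w \<Rightarrow> 'a::euclidean_space set) \<Rightarrow> 'a convex_body measure" where
  "body_distr M X = distr M borel (\<lambda>\<omega>. to_body (X \<omega>))"

text \<open>The library's \<^const>\<open>weak_conv_m\<close> only covers measures on the real line.\<close>

definition weakly_converges ::
    "(nat \<Rightarrow> 'b::topological_space measure) \<Rightarrow> 'b measure \<Rightarrow> bool" where
  "weakly_converges \<mu> \<nu> \<longleftrightarrow>
     (\<forall>f :: 'b \<Rightarrow> real. continuous_on UNIV f \<longrightarrow> bounded (range f) \<longrightarrow>
        (\<lambda>n. \<integral>x. f x \<partial>\<mu> n) \<longlonglongrightarrow> (\<integral>x. f x \<partial>\<nu>))"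

definition converges_in_distr ::
    "'w measure \<Rightarrow> (nat \<Rightarrow> 'w \<Rightarrow> 'a::euclidean_space set) \<Rightarrow> 'v measure \<Rightarrow> ('v \<Rightarrow> 'a set) \<Rightarrow> bool" where
  "converges_in_distr M X N Z \<longleftrightarrow>
     (\<forall>n. random_convex_body M (X n)) \<and> random_convex_body N Z \<and>
     weakly_converges (\<lambda>n. body_distr M (X n)) (body_distr N Z)"

section \<open>Polar sets and Minkowski differences\<close>

definition polar_set :: "'a::real_inner set \<Rightarrow> 'a set" where
  "polar_set L = {u. \<forall>x\<in>L. u \<bullet> x \<le> 1}"

definition minkowski_diff :: "'a::ab_group_add set \<Rightarrow> 'a set \<Rightarrow> 'a set" where
  "minkowski_diff K L = {x. (\<lambda>y. y + x) ` L \<subseteq> K}"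

section \<open>Surface area measure\<close>

text \<open>
  The local parallel set of \<open>K\<close>: the points at distance in \<open>(0, \<epsilon>]\<close> from \<open>K\<close> whose direction
  \<open>(x - p(K,x)) / d(K,x)\<close> from their metric projection \<open>p(K,x)\<close> belongs to \<open>\<omega>\<close>.
\<close>

definition local_parallel_set :: "'a::euclidean_space set \<Rightarrow> real \<Rightarrow> 'a set \<Rightarrow> 'a set" where
  "local_parallel_set K \<epsilon> \<omega> =
     {x. 0 < infdist x K \<and> infdist x K \<le> \<epsilon> \<and> (x - closest_point K x) /\<^sub>R infdist x K \<in> \<omega>}"

text \<open>
  By the local Steiner formula, for a convex body \<open>K\<close> and a Borel set \<open>\<omega>\<close> of the unit sphere,
  the volume of \<open>local_parallel_set K \<epsilon> \<omega>\<close> equals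
  \<open>(1/d) (\<Sum>m<d. (d choose m) \<epsilon>^(d - m) S_m(K, \<omega>))\<close>, which defines the area measures \<open>S_m(K, _)\<close>.
  The top one, \<open>S_{d-1}(K, \<omega>)\<close>, is the coefficient of \<open>\<epsilon>\<close>, that is, the following limit.  If \<open>K\<close> has
  interior points, it is the \<open>(d-1)\<close>-dimensional Hausdorff measure of the set of boundary points
  of \<open>K\<close> having an outer unit normal vector in \<open>\<omega>\<close>.
\<close>

definition surface_area_measure :: "'a::euclidean_space set \<Rightarrow> 'a measure" where
  "surface_area_measure K =
     measure_of (sphere 0 1) (sets (restrict_space borel (sphere 0 1)))
       (\<lambda>\<omega>. Lim (at_right 0) (\<lambda>\<epsilon>. emeasure lborel (local_parallel_set K \<epsilon> \<omega>) / ennreal \<epsilon>))"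

section \<open>Poisson processes and the zero cell\<close>

definition point_count :: "(nat \<Rightarrow> 'w \<Rightarrow> 'b) \<Rightarrow> 'b set \<Rightarrow> 'w \<Rightarrow> ennreal" where
  "point_count p A \<omega> = emeasure (count_space UNIV) {i. p i \<omega> \<in> A}"

text \<open>
  The points \<open>p 0, p 1, \<dots>\<close> enumerate a Poisson process with intensity measure \<open>\<Lambda>\<close>; as there are
  infinitely many points, \<open>\<Lambda>\<close> is necessarily infinite.  A Poisson random variable with infinite
  mean is almost surely infinite.
\<close>

definition poisson_process :: "'w measure \<Rightarrow> 'b measure \<Rightarrow> (nat \<Rightarrow> 'w \<Rightarrow> 'b) \<Rightarrow> bool" where
  "poisson_process M \<Lambda> p \<longleftrightarrow>
     prob_space M \<and>
     (\<forall>i. p i \<in> M \<rightarrow>\<^sub>M \<Lambda>) \<and>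
     (\<forall>A\<in>sets \<Lambda>. emeasure \<Lambda> A < \<infinity> \<longrightarrow>
        (\<forall>k::nat. measure M {\<omega>\<in>space M. point_count p A \<omega> = of_nat k} =
           exp (- measure \<Lambda> A) * measure \<Lambda> A ^ k / fact k)) \<and>
     (\<forall>A\<in>sets \<Lambda>. emeasure \<Lambda> A = \<infinity> \<longrightarrow> (AE \<omega> in M. point_count p A \<omega> = \<infinity>)) \<and>
     (\<forall>B :: nat \<Rightarrow> 'b set. range B \<subseteq> sets \<Lambda> \<longrightarrow> disjoint_family B \<longrightarrow>
        prob_space.indep_vars M (\<lambda>_. borel) (\<lambda>j. point_count p (B j)) UNIV)"

definition hyperplane_intensity :: "'a::euclidean_space set \<Rightarrow> (real \<times> 'a) measure" where
  "hyperplane_intensity K =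
     scale_measure (1 / emeasure lborel K) (restrict_space lborel {0<..}) \<Otimes>\<^sub>M surface_area_measure K"

definition neg_halfspace :: "real \<times> 'a::real_inner \<Rightarrow> 'a set" where
  "neg_halfspace = (\<lambda>(t, u). {x. x \<bullet> u \<le> t})"

definition zero_cell :: "(nat \<Rightarrow> 'w \<Rightarrow> real \<times> 'a::real_inner) \<Rightarrow> 'w \<Rightarrow> 'a set" where
  "zero_cell p \<omega> = (\<Inter>i. neg_halfspace (p i \<omega>))"

end

theory Submission
  imports Defs "HOL-Real_Asymp.Real_Asymp"
begin

text \<open>
  Let \<open>F\<close> be a finite set containing the origin and
  \<open>h\<^sub>F(u) = max {u \<bullet> l | l \<in> F}\<close> its support function.  The zero cell contains \<open>F\<close> exactly if no point
  \<open>(t, u)\<close> of the Poisson process satisfies \<open>t < h\<^sub>F(u)\<close>, so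
  \<open>P(F \<subseteq> Z) = exp (- (1/V(K)) \<integral> h\<^sub>F dS(K, \<cdot>))\<close>.  On the other side \<open>F \<subseteq> n X\<^sub>n\<close> means that none of the
  \<open>n\<close> independent points lies in the boundary layer of those \<open>y \<in> K\<close> for which \<open>y + F/n\<close> sticks out of
  \<open>K\<close>, so \<open>P(F \<subseteq> n X\<^sub>n) = (1 - V(layer)/V(K))\<^sup>n\<close>.  The containment probabilities therefore converge as
  soon as \<open>V(layer) / \<eta> \<longlonglongrightarrow> \<integral> h\<^sub>F dS(K, \<cdot>)\<close>, where \<open>\<eta> = 1/n\<close>; this is \<open>tendsto_content_exit_region\<close>.

  The layer lies inside \<open>K\<close> while \<open>S(K, \<cdot>)\<close> is defined by volumes outside \<open>K\<close>.  The bridge is that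
  the volume of the layer is monotone in the convex body, for every fixed \<open>\<eta>\<close>
  (\<open>content_exit_region_mono\<close>): cutting a body by a half-space removes at least as much volume from
  the body as from its erosion, because the part of the erosion that is lost can be translated into the
  part of the body that is cut off.  The parallel bodies \<open>K\<^sub>s = {x | d(x, K) \<le> s}\<close> satisfy
  \<open>K \<subseteq> K\<^sub>s \<subseteq> (1 + s/r) K\<close>, so up to a factor close to \<open>1\<close> the volume of the layer of \<open>K\<close> is the
  average of the volumes of the layers of \<open>K\<^sub>s\<close> over \<open>0 \<le> s < \<epsilon>\<close>.  By Tonelli this average is
  \<open>1/\<epsilon>\<close> times the integral of an increment of the distance function, which is differentiable outside \<open>K\<close>
  with gradient the outer normal \<open>u(x)\<close>; hence the average, divided by \<open>\<eta>\<close>, tends to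
  \<open>(1/\<epsilon>) \<integral> h\<^sub>F(u(x)) dx\<close> over the points \<open>x\<close> at distance in \<open>(0, \<epsilon>]\<close>, as \<open>\<eta>\<close> tends to \<open>0\<close>.  As \<open>\<epsilon>\<close> tends to
  \<open>0\<close>, this tends to \<open>\<integral> h\<^sub>F dS(K, \<cdot>)\<close> by the definition of the surface area measure.

  The limit that defines \<open>S(K, \<omega>)\<close> exists because shifting a parallel shell outwards along the
  normals expands distances, hence volumes; so the local parallel volume is superadditive in its width
  and \<open>V(\<epsilon>)/\<epsilon>\<close> has a limit.  Countable additivity follows by dominated convergence.

  Containment probabilities determine the weak limit.  Fix a dense sequence \<open>D\<close>.  By inclusion and
  exclusion the law of the trace \<open>n X\<^sub>n \<inter> {D 0, \<dots>, D (m - 1)}\<close> converges to that of \<open>Z\<close>.  For a bounded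
  functional \<open>\<Phi>\<close> let \<open>f\<^sub>m\<close> be the infimum of \<open>\<Phi>\<close> over all bodies with a given trace.  Then
  \<open>lim inf E \<Phi>(n X\<^sub>n) \<ge> E f\<^sub>m(Z)\<close> for each \<open>m\<close>, and \<open>f\<^sub>m(Z) \<longlonglongrightarrow> \<Phi>(Z)\<close> if \<open>\<Phi>\<close> is continuous, since a body
  with the origin in its interior is the limit of all bodies that share longer and longer traces with it
  (\<open>trace_determines_body\<close>).  The same bound for \<open>- \<Phi>\<close> gives convergence of expectations.
  Such bodies even squeeze each other between dilates close to \<open>1\<close>, a relation
  that polarity preserves, so the functional \<open>L \<mapsto> f(L\<^sup>o)\<close> is covered too, which proves the second claim.

  It remains that \<open>Z\<close> is almost surely compact with the origin in its interior: the latter since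
  \<open>S(K, \<cdot>)\<close> is finite, the former since \<open>S(K, \<cdot>)\<close> charges every open hemisphere, so that
  finitely many caps of normal directions, each of which almost surely contains the normal of some
  hyperplane of the process, bound the cell in all directions.
\<close>

section \<open>Lipschitz maps do not increase volume\<close>

lemma emeasure_ball_center: "emeasure lborel (ball (x::'a::euclidean_space) r) = emeasure lborel (ball (y::'a) r)"
proof -
  have "(\<lambda>z. 1 *\<^sub>R z + (x - y)) ` ball y r = ball x r"
    using ball_translation[of "x - y" y r] by (simp add: add.commute image_def)
  then have "emeasure lebesgue (ball x r) = emeasure lebesgue (ball y r)"
    using emeasure_lebesgue_affine[of 1 "x - y" "ball y r"] by simp
  then show ?thesis by simp
qed

text \<open>
  The factor is exactly 1 because Euclidean balls are used: by Vitali's theorem almost all of \<open>A\<close> is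
  covered by disjoint balls whose total volume exceeds that of \<open>A\<close> by at most \<open>e\<close>, and the map sends
  each of them into a ball of the same radius.
\<close>

lemma emeasure_le_Lipschitz_image:
  fixes f :: "'a::euclidean_space \<Rightarrow> 'a"
  assumes A: "A \<in> sets borel" and B: "B \<in> sets borel" "B \<subseteq> f ` A"
    and lip: "\<And>x y. x \<in> A \<Longrightarrow> y \<in> A \<Longrightarrow> dist (f x) (f y) \<le> dist x y"
  shows "emeasure lborel B \<le> emeasure lborel A"
proof (rule ennreal_le_epsilon)
  fix e :: real assume "0 < e"
  obtain T where T: "open T" "A \<subseteq> T" "(T - A) \<in> lmeasurable" "emeasure lebesgue (T - A) < ennreal e"
    using sets_lebesgue_outer_open[of A e] A \<open>0 < e\<close> by auto
  \<comment> \<open>The balls are centred in \<open>A\<close>, so the image of \<open>A \<inter> ball a r\<close> lies in the ball around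
    \<open>f a\<close> of the same radius; the part of \<open>A\<close> missed by the Vitali cover is null, and so is its image.\<close>
  define I where "I = {(a, r). a \<in> A \<and> 0 < r \<and> ball a r \<subseteq> T}"
  have "\<exists>i. i \<in> I \<and> x \<in> ball (fst i) (snd i) \<and> snd i < d" if "x \<in> A" "0 < d" for x d
  proof -
    have "x \<in> T" using T(2) that(1) by auto
    then obtain r where "r > 0" "ball x r \<subseteq> T" using T(1) open_contains_ball by metis
    then show ?thesis
      using that by (intro exI[of _ "(x, min r (d/2))"]) (auto simp: I_def)
  qed
  then obtain C where C: "countable C" "C \<subseteq> I"
     "pairwise (\<lambda>i j. disjnt (ball (fst i) (snd i)) (ball (fst j) (snd j))) C"
     "negligible (A - (\<Union>i \<in> C. ball (fst i) (snd i)))"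
    using Vitali_covering_theorem_balls[of A I fst snd] by (metis (no_types, lifting))
  define N where "N = A - (\<Union>i \<in> C. ball (fst i) (snd i))"
  have "negligible (f ` N)"
  proof (rule negligible_locally_Lipschitz_image)
    show "negligible N" using C(4) by (simp add: N_def)
    show "\<exists>T B. open T \<and> x \<in> T \<and> (\<forall>y\<in>N \<inter> T. norm (f y - f x) \<le> B * norm (y - x))" if "x \<in> N" for x
      using that lip by (intro exI[of _ UNIV] exI[of _ 1]) (auto simp: N_def dist_norm)
  qed simp
  define c where "c = from_nat_into C"
  define J where "J = to_nat_on C ` C"
  have cJ: "c n \<in> C" if "n \<in> J" for n
    using that C(1) by (auto simp: c_def J_def)
  have inj: "c n = c m \<Longrightarrow> n = m" if "n \<in> J" "m \<in> J" for n m
    using that C(1) by (auto simp: c_def J_def)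
  define Y where "Y n = (if n \<in> J then ball (f (fst (c n))) (snd (c n)) else {})" for n
  define Z where "Z n = (if n \<in> J then ball (fst (c n)) (snd (c n)) else {})" for n
  have Bsub: "B \<subseteq> (\<Union>n. Y n) \<union> f ` N"
  proof
    fix b assume "b \<in> B"
    then obtain x where x: "x \<in> A" "b = f x" using B by auto
    show "b \<in> (\<Union>n. Y n) \<union> f ` N"
    proof (cases "x \<in> N")
      case False
      then obtain i where i: "i \<in> C" "x \<in> ball (fst i) (snd i)" using x by (auto simp: N_def)
      have "f x \<in> ball (f (fst i)) (snd i)"
        using lip[of "fst i" x] i C(2) x by (auto simp: I_def dist_commute)
      moreover have "c (to_nat_on C i) = i" using i C(1) by (simp add: c_def)
      ultimately have "f x \<in> Y (to_nat_on C i)" using i by (auto simp: Y_def J_def)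
      then show ?thesis using x by auto
    qed (use x in auto)
  qed
  have disj: "disjoint_family Z"
    unfolding disjoint_family_on_def
  proof (intro ballI impI)
    fix m n :: nat assume "m \<noteq> n"
    show "Z m \<inter> Z n = {}"
    proof (cases "m \<in> J \<and> n \<in> J")
      case True
      then have "c m \<noteq> c n" "c m \<in> C" "c n \<in> C" using inj cJ \<open>m \<noteq> n\<close> by auto
      then show ?thesis using C(3) True by (simp add: pairwise_def disjnt_def Z_def)
    qed (auto simp: Z_def)
  qed
  have ZT: "(\<Union>n. Z n) \<subseteq> T"
  proof
    fix x assume "x \<in> (\<Union>n. Z n)"
    then obtain n where "n \<in> J" "x \<in> ball (fst (c n)) (snd (c n))" by (auto simp: Z_def split: if_splits)
    moreover have "c n \<in> I" using cJ C(2) \<open>n \<in> J\<close> by auto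
    ultimately show "x \<in> T" by (auto simp: I_def)
  qed
  have fN: "f ` N \<in> null_sets lebesgue"
    using \<open>negligible (f ` N)\<close> by (simp add: negligible_iff_null_sets)
  have Yb: "Y n \<in> sets borel" "Z n \<in> sets borel" for n by (auto simp: Y_def Z_def)
  have UY: "(\<Union>n. Y n) \<in> sets lebesgue" using Yb by auto
  have "emeasure lborel B = emeasure lebesgue B" using B by simp
  also have "\<dots> \<le> emeasure lebesgue ((\<Union>n. Y n) \<union> f ` N)"
    using Bsub UY fN by (intro emeasure_mono) auto
  also have "\<dots> = emeasure lebesgue (\<Union>n. Y n)"
    using UY fN by (simp add: emeasure_Un_null_set)
  also have "\<dots> = emeasure lborel (\<Union>n. Y n)" using Yb by simp
  also have "\<dots> \<le> (\<Sum>n. emeasure lborel (Y n))"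
    using Yb by (intro emeasure_subadditive_countably) auto
  also have "\<dots> = (\<Sum>n. emeasure lborel (Z n))"
    by (intro suminf_cong) (simp add: Y_def Z_def emeasure_ball_center[of "f _" _ ])
  also have "\<dots> = emeasure lborel (\<Union>n. Z n)"
    using Yb disj by (intro suminf_emeasure) auto
  also have "\<dots> \<le> emeasure lborel T"
    using ZT T by (intro emeasure_mono) auto
  also have "\<dots> = emeasure lborel A + emeasure lborel (T - A)"
    using T A by (subst plus_emeasure) (auto simp: Un_absorb1)
  also have "emeasure lborel (T - A) = emeasure lebesgue (T - A)"
    using T A by simp
  also have "\<dots> \<le> e" using T by simp
  finally show "emeasure lborel B \<le> emeasure lborel A + e" by (simp add: add_left_mono)
qed

section \<open>Outer normals and parallel shells\<close>

text \<open>
  For \<open>x \<in> K\<close> both numerator and denominator vanish, and the value is \<open>0\<close>.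
\<close>

definition outer_normal :: "'a::euclidean_space set \<Rightarrow> 'a \<Rightarrow> 'a" where
  "outer_normal K x = (x - closest_point K x) /\<^sub>R infdist x K"

definition shell :: "'a::euclidean_space set \<Rightarrow> real \<Rightarrow> real \<Rightarrow> 'a set \<Rightarrow> 'a set" where
  "shell K a b \<omega> = {x. a < infdist x K \<and> infdist x K \<le> b \<and> outer_normal K x \<in> \<omega>}"

lemma local_parallel_set_eq_shell: "local_parallel_set K \<epsilon> \<omega> = shell K 0 \<epsilon> \<omega>"
  by (simp add: local_parallel_set_def shell_def outer_normal_def)

lemma infdist_closest_point:
  "closed K \<Longrightarrow> K \<noteq> {} \<Longrightarrow> infdist x K = dist x (closest_point K x)"
  by (metis infdist_eq_setdist setdist_closest_point)

context
  fixes K :: "'a::euclidean_space set"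
  assumes K: "closed K" "convex K" "K \<noteq> {}"
begin

lemma closest_point_eqI:
  assumes "p \<in> K" "\<And>z. z \<in> K \<Longrightarrow> (x - p) \<bullet> (z - p) \<le> 0"
  shows "closest_point K x = p" "infdist x K = norm (x - p)"
proof -
  have "dist x p \<le> dist x z" if "z \<in> K" for z
  proof -
    have "(norm (x - z))\<^sup>2 = (norm (x - p))\<^sup>2 + (norm (z - p))\<^sup>2 - 2 * ((x - p) \<bullet> (z - p))"
      by (simp add: power2_norm_eq_inner algebra_simps inner_commute)
    then have "(norm (x - p))\<^sup>2 \<le> (norm (x - z))\<^sup>2" using assms(2)[OF that] zero_le_power2[of "norm (z - p)"] by linarith
    then show ?thesis by (simp add: dist_norm)
  qed
  then show "closest_point K x = p"
    using closest_point_unique[OF K(2,1) assms(1)] by metis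
  then show "infdist x K = norm (x - p)"
    by (simp add: infdist_closest_point K dist_norm)
qed

lemma outer_normal_properties:
  assumes "0 < infdist x K"
  shows "norm (outer_normal K x) = 1"
    and "x = closest_point K x + infdist x K *\<^sub>R outer_normal K x"
    and "z \<in> K \<Longrightarrow> outer_normal K x \<bullet> (z - closest_point K x) \<le> 0"
proof -
  have t: "infdist x K = norm (x - closest_point K x)"
    by (simp add: infdist_closest_point[OF K(1,3)] dist_norm)
  show "norm (outer_normal K x) = 1" "x = closest_point K x + infdist x K *\<^sub>R outer_normal K x"
    using assms by (auto simp: outer_normal_def t)
  show "outer_normal K x \<bullet> (z - closest_point K x) \<le> 0" if "z \<in> K"
    using closest_point_dot[OF K(2,1) that, of x] assms
    by (simp add: outer_normal_def divide_nonpos_pos mult_nonneg_nonpos)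
qed

text \<open>
  Moving along the outer normal keeps the metric projection: the projection is characterised by the
  variational inequality, which is invariant under scaling the normal.
\<close>

lemma infdist_shift_outer_normal:
  assumes "0 < infdist x K" "0 \<le> s"
  shows "infdist (x + s *\<^sub>R outer_normal K x) K = infdist x K + s"
    and "outer_normal K (x + s *\<^sub>R outer_normal K x) = outer_normal K x"
proof -
  let ?p = "closest_point K x" and ?u = "outer_normal K x" and ?t = "infdist x K"
  note n = outer_normal_properties[OF assms(1)]
  have p: "?p \<in> K" using K by (simp add: closest_point_in_set)
  have eq: "x + s *\<^sub>R ?u - ?p = (?t + s) *\<^sub>R ?u"
    using n(2) by (simp add: algebra_simps)
  have le: "(x + s *\<^sub>R ?u - ?p) \<bullet> (z - ?p) \<le> 0" if "z \<in> K" for z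
    unfolding eq using n(3)[OF that] assms by (simp add: mult_nonneg_nonpos)
  show i: "infdist (x + s *\<^sub>R ?u) K = ?t + s"
    using closest_point_eqI(2)[OF p le] eq n(1) assms by simp
  show "outer_normal K (x + s *\<^sub>R ?u) = ?u"
    using closest_point_eqI(1)[OF p le] eq i assms by (simp add: outer_normal_def[of K "x + _"])
qed

text \<open>
  Write \<open>x = p + (t + s) u\<close> and \<open>y = q + (r + s) v\<close> with the projections \<open>p\<close>, \<open>q\<close> and the normals \<open>u\<close>, \<open>v\<close>.
  Since normal vectors are monotone, \<open>(p - q) \<bullet> (u - v) \<ge> 0\<close>, adding \<open>s (u - v)\<close> to the difference of the
  retracted points cannot shorten it.
\<close>

lemma dist_retract_outer_normal_le:
  assumes x: "s \<le> infdist x K" "0 < infdist x K" and y: "s \<le> infdist y K" "0 < infdist y K" and "0 \<le> s"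
  shows "dist (x - s *\<^sub>R outer_normal K x) (y - s *\<^sub>R outer_normal K y) \<le> dist x y"
proof -
  define p u t where "p = closest_point K x" and "u = outer_normal K x" and "t = infdist x K - s"
  define q v r where "q = closest_point K y" and "v = outer_normal K y" and "r = infdist y K - s"
  note nx = outer_normal_properties[OF x(2), folded p_def u_def] and ny = outer_normal_properties[OF y(2), folded q_def v_def]
  have pq: "p \<in> K" "q \<in> K" using K by (simp_all add: p_def q_def closest_point_in_set)
  define z where "z = (x - s *\<^sub>R u) - (y - s *\<^sub>R v)"
  have z: "z = (p - q) + (t *\<^sub>R u - r *\<^sub>R v)"
  proof -
    have "p = x - infdist x K *\<^sub>R u" "q = y - infdist y K *\<^sub>R v"
      using nx(2) ny(2) by (metis add_diff_cancel_right')+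
    note eqs = this
    show ?thesis
      unfolding z_def t_def r_def eqs by (simp add: algebra_simps)
  qed
  have uv: "u \<bullet> v \<le> 1"
    using nx(1) ny(1) norm_cauchy_schwarz[of u v] by simp
  have "0 \<le> (p - q) \<bullet> (u - v)"
    using nx(3)[OF pq(2)] ny(3)[OF pq(1)] by (simp add: inner_commute algebra_simps)
  moreover have "(t *\<^sub>R u - r *\<^sub>R v) \<bullet> (u - v) = (t + r) * (1 - u \<bullet> v)"
    using nx(1) ny(1) by (simp add: algebra_simps inner_commute dot_square_norm)
  moreover have "0 \<le> (t + r) * (1 - u \<bullet> v)"
    using uv x y by (intro mult_nonneg_nonneg) (auto simp: t_def r_def)
  ultimately have zw: "0 \<le> z \<bullet> (u - v)" unfolding z by (simp add: inner_add_left)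
  have "x - y = z + s *\<^sub>R (u - v)" by (simp add: z_def algebra_simps)
  then have "(norm (x - y))\<^sup>2 = (norm z)\<^sup>2 + 2 * s * (z \<bullet> (u - v)) + s\<^sup>2 * (norm (u - v))\<^sup>2"
    by (simp add: power2_norm_eq_inner inner_add_left inner_add_right inner_commute power2_eq_square[of s] distrib_left)
  then have "(norm z)\<^sup>2 \<le> (norm (x - y))\<^sup>2" using zw \<open>0 \<le> s\<close> by simp
  then show ?thesis by (simp add: z_def u_def v_def dist_norm)
qed

lemma borel_measurable_outer_normal [measurable]: "outer_normal K \<in> borel_measurable borel"
proof -
  have [measurable]: "closest_point K \<in> borel_measurable borel"
    using K by (intro borel_measurable_continuous_onI continuous_on_closest_point)
  have [measurable]: "(\<lambda>x. infdist x K) \<in> borel_measurable borel"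
    by (intro borel_measurable_continuous_onI continuous_intros)
  show ?thesis unfolding outer_normal_def[abs_def] by measurable
qed

lemma sets_shell: "\<omega> \<in> sets borel \<Longrightarrow> shell K a b \<omega> \<in> sets borel"
proof -
  assume [measurable]: "\<omega> \<in> sets borel"
  have [measurable]: "(\<lambda>x. infdist x K) \<in> borel_measurable borel"
    by (intro borel_measurable_continuous_onI continuous_intros)
  have "Measurable.pred borel (\<lambda>x. a < infdist x K \<and> infdist x K \<le> b \<and> outer_normal K x \<in> \<omega>)"
    by measurable
  then show ?thesis unfolding shell_def pred_def by simp
qed

text \<open>
  The retraction by \<open>s\<close> maps the outer shell onto the inner one and does not increase distances.
\<close>

lemma emeasure_shell_shift:
  assumes "\<omega> \<in> sets borel" "0 \<le> a" "0 \<le> s"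
  shows "emeasure lborel (shell K a b \<omega>) \<le> emeasure lborel (shell K (a + s) (b + s) \<omega>)"
proof (rule emeasure_le_Lipschitz_image[where f = "\<lambda>y. y - s *\<^sub>R outer_normal K y"])
  show "shell K a b \<omega> \<subseteq> (\<lambda>y. y - s *\<^sub>R outer_normal K y) ` shell K (a + s) (b + s) \<omega>"
  proof
    fix x assume x: "x \<in> shell K a b \<omega>"
    then have "0 < infdist x K" using assms by (auto simp: shell_def)
    note sh = infdist_shift_outer_normal[OF this assms(3)]
    show "x \<in> (\<lambda>y. y - s *\<^sub>R outer_normal K y) ` shell K (a + s) (b + s) \<omega>"
      using x sh by (intro image_eqI[of _ _ "x + s *\<^sub>R outer_normal K x"]) (auto simp: shell_def)
  qed
next
  fix x y assume "x \<in> shell K (a + s) (b + s) \<omega>" "y \<in> shell K (a + s) (b + s) \<omega>"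
  then show "dist (x - s *\<^sub>R outer_normal K x) (y - s *\<^sub>R outer_normal K y) \<le> dist x y"
    using assms by (intro dist_retract_outer_normal_le) (auto simp: shell_def)
qed (use assms sets_shell in auto)

lemma emeasure_shell_multiple:
  assumes "\<omega> \<in> sets borel" "0 \<le> a"
  shows "of_nat n * emeasure lborel (shell K 0 a \<omega>) \<le> emeasure lborel (shell K 0 (of_nat n * a) \<omega>)"
proof (induction n)
  case (Suc n)
  have "0 \<le> of_nat n * a" using assms by simp
  note na = this
  have "shell K 0 (of_nat (Suc n) * a) \<omega> = shell K 0 (of_nat n * a) \<omega> \<union> shell K (of_nat n * a) (of_nat n * a + a) \<omega>"
    unfolding shell_def using assms le_less_trans[OF na] by (auto simp: distrib_right)
  moreover have "shell K 0 (of_nat n * a) \<omega> \<inter> shell K (of_nat n * a) (of_nat n * a + a) \<omega> = {}"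
    by (auto simp: shell_def)
  ultimately have "emeasure lborel (shell K 0 (of_nat (Suc n) * a) \<omega>) =
      emeasure lborel (shell K 0 (of_nat n * a) \<omega>) + emeasure lborel (shell K (of_nat n * a) (of_nat n * a + a) \<omega>)"
    using assms sets_shell by (simp add: plus_emeasure)
  moreover have "emeasure lborel (shell K 0 a \<omega>) \<le> emeasure lborel (shell K (of_nat n * a) (of_nat n * a + a) \<omega>)"
    using emeasure_shell_shift[OF assms(1), of 0 "of_nat n * a" a] assms by (simp add: add.commute)
  ultimately show ?case
    using Suc by (simp add: distrib_right) (metis add.commute add_mono)
qed simp

end

section \<open>The surface area measure as a limit of parallel volumes\<close>

context
  fixes K :: "'a::euclidean_space set"
  assumes K: "compact K" "convex K" "K \<noteq> {}"
begin

lemma bounded_shell: "bounded (shell K a b \<omega>)"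
proof -
  obtain R where R: "\<And>x. x \<in> K \<Longrightarrow> norm x \<le> R"
    using compact_imp_bounded[OF K(1)] by (auto simp: bounded_iff)
  have "norm x \<le> b + R" if "x \<in> shell K a b \<omega>" for x
  proof -
    have "norm x \<le> dist x (closest_point K x) + norm (closest_point K x)"
      by (metis dist_norm norm_triangle_sub add.commute)
    moreover have "norm (closest_point K x) \<le> R"
      using K by (intro R closest_point_in_set) (auto simp: compact_imp_closed)
    ultimately show ?thesis
      using that infdist_closest_point[of K x] K by (auto simp: shell_def compact_imp_closed)
  qed
  then show ?thesis by (auto simp: bounded_iff)
qed

lemma emeasure_shell_finite: "emeasure lborel (shell K a b \<omega>) < \<infinity>"
  using bounded_shell by (rule emeasure_bounded_finite)

lemma emeasure_shell_eq: "emeasure lborel (shell K a b \<omega>) = ennreal (measure lborel (shell K a b \<omega>))"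
  using emeasure_shell_finite[of a b \<omega>] by (intro emeasure_eq_ennreal_measure) auto

text \<open>
  By \<open>emeasure_shell_multiple\<close> the local parallel volume is superadditive along multiples of \<open>a\<close>.
  Rounding \<open>b / a\<close> down to an integer costs at most one multiple, hence \<open>b - a\<close> instead of \<open>b\<close>.
\<close>

lemma measure_shell_ratio_le:
  assumes \<omega>: "\<omega> \<in> sets borel" and "0 < a" "a < b"
  shows "measure lborel (shell K 0 a \<omega>) / a \<le> measure lborel (shell K 0 b \<omega>) / (b - a)"
proof -
  have Kc: "closed K" using K compact_imp_closed by auto
  define G where "G a = measure lborel (shell K 0 a \<omega>)" for a
  define n where "n = nat \<lfloor>b / a\<rfloor>"
  have fl: "of_int \<lfloor>b / a\<rfloor> \<le> b / a" "b / a < of_int \<lfloor>b / a\<rfloor> + 1" by linarith+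
  have "0 \<le> \<lfloor>b / a\<rfloor>" using assms by simp
  then have n: "real n = of_int \<lfloor>b / a\<rfloor>" by (simp add: n_def)
  have le: "real n * a \<le> b" "b - a < real n * a"
    using fl assms unfolding n by (simp_all only: pos_le_divide_eq pos_divide_less_eq distrib_right)
  have "of_nat n * emeasure lborel (shell K 0 a \<omega>) \<le> emeasure lborel (shell K 0 (of_nat n * a) \<omega>)"
    using emeasure_shell_multiple[OF Kc K(2,3) \<omega>] assms by simp
  also have "\<dots> \<le> emeasure lborel (shell K 0 b \<omega>)"
    using le(1) sets_shell[OF Kc K(2,3) \<omega>] by (intro emeasure_mono) (auto simp: shell_def)
  finally have "ennreal (real n * G a) \<le> ennreal (G b)"
    by (simp add: emeasure_shell_eq G_def ennreal_mult ennreal_of_nat_eq_real_of_nat)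
  then have "real n * G a \<le> G b" by (simp add: G_def)
  have "(b - a) * G a \<le> (real n * a) * G a"
    using le by (intro mult_right_mono) (auto simp: G_def)
  also have "\<dots> \<le> a * G b" using \<open>real n * G a \<le> G b\<close> assms by (simp add: mult.commute mult.left_commute)
  finally show ?thesis using assms by (simp add: G_def field_simps)
qed

text \<open>
  The limit is the infimum of \<open>G b / b\<close>: near \<open>0\<close> the ratio is at most \<open>G b / (b - a)\<close>, which tends
  to \<open>G b / b\<close> as \<open>a\<close> tends to \<open>0\<close>.
\<close>

lemma parallel_volume_ratio_converges:
  assumes \<omega>: "\<omega> \<in> sets borel"
  shows "\<exists>L\<ge>0. ((\<lambda>\<epsilon>. emeasure lborel (shell K 0 \<epsilon> \<omega>) / ennreal \<epsilon>) \<longlongrightarrow> ennreal L) (at_right 0)"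
proof -
  define G where "G a = measure lborel (shell K 0 a \<omega>)" for a
  define L where "L = (INF b\<in>{0<..}. G b / b)"
  have bdd: "bdd_below ((\<lambda>b. G b / b) ` {0<..})" by (intro bdd_belowI[of _ 0]) (auto simp: G_def)
  have Lle: "L \<le> G b / b" if "0 < b" for b
    unfolding L_def using bdd that by (intro cINF_lower) auto
  have L0: "0 \<le> L" unfolding L_def by (intro cINF_greatest) (auto simp: G_def)
  have "((\<lambda>\<epsilon>. G \<epsilon> / \<epsilon>) \<longlongrightarrow> L) (at_right 0)"
  proof (rule order_tendstoI)
    fix y assume "y < L"
    then show "\<forall>\<^sub>F \<epsilon> in at_right 0. y < G \<epsilon> / \<epsilon>"
    proof (intro eventually_mono[OF eventually_at_right_less])
      fix \<epsilon> :: real assume "0 < \<epsilon>"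
      then show "y < G \<epsilon> / \<epsilon>" using Lle[of \<epsilon>] \<open>y < L\<close> by simp
    qed
  next
    fix y assume "L < y"
    then obtain b where b: "0 < b" "G b / b < y"
      using cINF_less_iff[OF _ bdd, of y] by (auto simp: L_def)
    have "((\<lambda>a. G b / (b - a)) \<longlongrightarrow> G b / (b - 0)) (at_right 0)"
      using b by (intro tendsto_intros) auto
    then have "\<forall>\<^sub>F a in at_right 0. G b / (b - a) < y"
      using b by (auto dest: order_tendstoD)
    moreover have "\<forall>\<^sub>F a in at_right 0. a \<in> {0<..<b}" using b eventually_at_right_real by blast
    ultimately show "\<forall>\<^sub>F a in at_right 0. G a / a < y"
    proof eventually_elim
      case (elim a)
      then show ?case using measure_shell_ratio_le[OF \<omega>, of a b] by (auto simp: G_def)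
    qed
  qed
  then have "((\<lambda>\<epsilon>. ennreal (G \<epsilon> / \<epsilon>)) \<longlongrightarrow> ennreal L) (at_right 0)" by (rule tendsto_ennrealI)
  moreover have "\<forall>\<^sub>F \<epsilon> in at_right 0. ennreal (G \<epsilon> / \<epsilon>) = emeasure lborel (shell K 0 \<epsilon> \<omega>) / ennreal \<epsilon>"
    by (auto simp: eventually_at_right_field emeasure_shell_eq G_def divide_ennreal intro!: exI[of _ 1])
  ultimately have "((\<lambda>\<epsilon>. emeasure lborel (shell K 0 \<epsilon> \<omega>) / ennreal \<epsilon>) \<longlongrightarrow> ennreal L) (at_right 0)"
    by (rule Lim_transform_eventually)
  then show ?thesis using L0 by blast
qed

lemma emeasure_shell_ratio_le:
  assumes \<omega>: "\<omega> \<in> sets borel" and "0 < a" "a \<le> 1/2"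
  shows "emeasure lborel (shell K 0 a \<omega>) / ennreal a \<le> 2 * emeasure lborel (shell K 0 1 \<omega>)"
proof -
  have "measure lborel (shell K 0 a \<omega>) / a \<le> measure lborel (shell K 0 1 \<omega>) / (1 - a)"
    using assms by (intro measure_shell_ratio_le) auto
  also have "\<dots> \<le> measure lborel (shell K 0 1 \<omega>) / (1/2)"
    using assms by (intro divide_left_mono) auto
  finally have "ennreal (measure lborel (shell K 0 a \<omega>) / a) \<le> ennreal (2 * measure lborel (shell K 0 1 \<omega>))"
    by (intro ennreal_leI) simp
  then show ?thesis
    using assms by (simp add: emeasure_shell_eq divide_ennreal ennreal_mult)
qed

text \<open>
  Two things have to be checked before the formula in the definition of \<open>surface_area_measure\<close> can be
  read off: that the limit exists, and that it is countably additive in \<open>\<omega>\<close>, as \<open>measure_of\<close> turns a set function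
  that is not a measure into the null measure.  The parallel volumes are countably additive for every width, and
  dominated convergence for series carries this over to the limit.
\<close>

lemma tendsto_emeasure_surface_area_measure:
  assumes "\<omega> \<in> sets borel" "\<omega> \<subseteq> sphere 0 1"
  shows "((\<lambda>\<epsilon>. emeasure lborel (shell K 0 \<epsilon> \<omega>) / ennreal \<epsilon>) \<longlongrightarrow> emeasure (surface_area_measure K) \<omega>) (at_right 0)"
proof -
  have Kc: "closed K" using K compact_imp_closed by auto
  define \<sigma> where "\<sigma> \<omega> = Lim (at_right 0) (\<lambda>\<epsilon>. emeasure lborel (shell K 0 \<epsilon> \<omega>) / ennreal \<epsilon>)" for \<omega>
  have lim: "((\<lambda>\<epsilon>. emeasure lborel (shell K 0 \<epsilon> \<omega>) / ennreal \<epsilon>) \<longlongrightarrow> \<sigma> \<omega>) (at_right 0)"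
    if \<omega>: "\<omega> \<in> sets borel" for \<omega>
  proof -
    obtain L where "((\<lambda>\<epsilon>. emeasure lborel (shell K 0 \<epsilon> \<omega>) / ennreal \<epsilon>) \<longlongrightarrow> ennreal L) (at_right 0)"
      using parallel_volume_ratio_converges[OF \<omega>] by blast
    then show ?thesis unfolding \<sigma>_def by (simp add: tendsto_Lim)
  qed
  define e where "e n = 1 / (real n + 2)" for n
  have e: "0 < e n" "e n \<le> 1/2" for n by (auto simp: e_def field_simps)
  have "e \<longlonglongrightarrow> 0" unfolding e_def by real_asymp
  then have er: "filterlim e (at_right 0) sequentially"
    using e by (intro tendsto_imp_filterlim_at_right) auto
  have limn: "(\<lambda>n. emeasure lborel (shell K 0 (e n) \<omega>) / ennreal (e n)) \<longlonglongrightarrow> \<sigma> \<omega>"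
    if "\<omega> \<in> sets borel" for \<omega>
    using filterlim_compose[OF lim[OF that] er] .
  let ?A = "sets (restrict_space borel (sphere (0::'a) 1))"
  have A: "\<omega> \<in> sets borel" if "\<omega> \<in> ?A" for \<omega>
    using that by (auto simp: sets_restrict_space)
  have pos: "positive ?A \<sigma>"
  proof -
    have "shell K 0 \<epsilon> {} = {}" for \<epsilon> by (auto simp: shell_def)
    then have "(\<lambda>n. 0) \<longlonglongrightarrow> \<sigma> {}"
      using limn[of "{}"] by simp
    then have "\<sigma> {} = 0" using LIMSEQ_unique tendsto_const by blast
    then show ?thesis by (simp add: positive_def)
  qed
  have add: "countably_additive ?A \<sigma>"
  proof (rule countably_additiveI)
    fix A :: "nat \<Rightarrow> 'a set" assume rA: "range A \<subseteq> ?A" and disj: "disjoint_family A" and "(\<Union>i. A i) \<in> ?A"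
    have Ab: "A i \<in> sets borel" for i using rA A by auto
    have UAb: "(\<Union>i. A i) \<in> sets borel" using Ab by auto
    have sum: "(\<Sum>i. emeasure lborel (shell K 0 a (A i))) = emeasure lborel (shell K 0 a (\<Union>i. A i))" for a
    proof -
      have "shell K 0 a (\<Union>i. A i) = (\<Union>i. shell K 0 a (A i))" by (auto simp: shell_def)
      moreover have "disjoint_family (\<lambda>i. shell K 0 a (A i))"
        using disj by (auto simp: disjoint_family_on_def shell_def)
      moreover have "range (\<lambda>i. shell K 0 a (A i)) \<subseteq> sets lborel"
        using sets_shell[OF Kc K(2,3) Ab] by auto
      ultimately show ?thesis by (simp add: suminf_emeasure)
    qed
    have "(\<lambda>n. \<integral>\<^sup>+i. emeasure lborel (shell K 0 (e n) (A i)) / ennreal (e n) \<partial>count_space UNIV)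
        \<longlonglongrightarrow> (\<integral>\<^sup>+i. \<sigma> (A i) \<partial>count_space UNIV)"
    proof (rule nn_integral_dominated_convergence[where w = "\<lambda>i. 2 * emeasure lborel (shell K 0 1 (A i))"])
      have "(\<integral>\<^sup>+i. 2 * emeasure lborel (shell K 0 1 (A i)) \<partial>count_space UNIV)
          = 2 * emeasure lborel (shell K 0 1 (\<Union>i. A i))"
        by (simp add: nn_integral_cmult nn_integral_count_space_nat sum)
      also have "\<dots> < \<infinity>" using emeasure_shell_finite by (simp add: ennreal_mult_less_top)
      finally show "(\<integral>\<^sup>+i. 2 * emeasure lborel (shell K 0 1 (A i)) \<partial>count_space UNIV) < \<infinity>" .
    qed (use Ab e in \<open>auto intro!: emeasure_shell_ratio_le limn\<close>)
    then have "(\<lambda>n. emeasure lborel (shell K 0 (e n) (\<Union>i. A i)) / ennreal (e n)) \<longlonglongrightarrow> (\<Sum>i. \<sigma> (A i))"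
      by (simp add: nn_integral_divide nn_integral_count_space_nat sum)
    then show "(\<Sum>i. \<sigma> (A i)) = \<sigma> (\<Union>i. A i)"
      using limn[OF UAb] LIMSEQ_unique by blast
  qed
  have "sigma_algebra (sphere 0 1) ?A"
    using sets.sigma_algebra_axioms[of "restrict_space borel (sphere (0::'a) 1)"] by (simp add: space_restrict_space)
  moreover have "\<omega> \<in> ?A" using assms by (auto simp: sets_restrict_space)
  ultimately have "emeasure (surface_area_measure K) \<omega> = \<sigma> \<omega>"
    unfolding surface_area_measure_def local_parallel_set_eq_shell \<sigma>_def[symmetric, abs_def]
    using pos add by (intro emeasure_measure_of_sigma)
  then show ?thesis using lim[OF assms(1)] by simp
qed

lemma emeasure_surface_area_measure_finite:
  "emeasure (surface_area_measure K) (sphere 0 1) < \<infinity>"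
proof -
  obtain L where "((\<lambda>\<epsilon>. emeasure lborel (shell K 0 \<epsilon> (sphere 0 1)) / ennreal \<epsilon>) \<longlongrightarrow> ennreal L) (at_right 0)"
    using parallel_volume_ratio_converges[of "sphere 0 1"] by auto
  then have "emeasure (surface_area_measure K) (sphere 0 1) = ennreal L"
    using tendsto_emeasure_surface_area_measure[of "sphere 0 1"]
    by (intro tendsto_unique[OF trivial_limit_at_right_real]) auto
  then show ?thesis by simp
qed

end

lemma sets_surface_area_measure:
  "sets (surface_area_measure K) = sets (restrict_space borel (sphere 0 1))"
  unfolding surface_area_measure_def
  using sets.sigma_sets_eq[of "restrict_space borel (sphere (0::'a::euclidean_space) 1)"] sets.space_closed[of "restrict_space borel (sphere (0::'a) 1)"]
  by (simp add: space_restrict_space)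

lemma space_surface_area_measure: "space (surface_area_measure K) = sphere 0 1"
  unfolding surface_area_measure_def
  using sets.space_closed[of "restrict_space borel (sphere (0::'a::euclidean_space) 1)"]
  by (simp add: space_restrict_space)

section \<open>The boundary layer of a convex body and its monotonicity\<close>

lemma dense_sequence_exists:
  obtains D :: "nat \<Rightarrow> 'a::euclidean_space" where "\<And>U. open U \<Longrightarrow> U \<noteq> {} \<Longrightarrow> \<exists>i. D i \<in> U"
proof -
  obtain E :: "'a set" where E: "countable E" "\<And>X. open X \<Longrightarrow> X \<noteq> {} \<Longrightarrow> \<exists>d\<in>E. d \<in> X"
    using countable_dense_setE by blast
  have ne: "E \<noteq> {}" using E(2)[of UNIV] by auto
  have "\<exists>i. from_nat_into E i \<in> U" if U: "open U" "U \<noteq> {}" for U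
  proof -
    obtain d where "d \<in> E" "d \<in> U" using E(2)[OF U] by auto
    then show ?thesis using from_nat_into_surj[OF E(1), of d] by auto
  qed
  then show ?thesis using that by blast
qed

definition erosion :: "'a::real_vector set \<Rightarrow> real \<Rightarrow> 'a set \<Rightarrow> 'a set" where
  "erosion K \<eta> F = {x. \<forall>l\<in>F. x + \<eta> *\<^sub>R l \<in> K}"

text \<open>
  The boundary layer of the points of \<open>K\<close> that leave \<open>K\<close> under some translation from \<open>\<eta> F\<close>.
\<close>

definition exit_region :: "'a::real_vector set \<Rightarrow> real \<Rightarrow> 'a set \<Rightarrow> 'a set" where
  "exit_region K \<eta> F = {x \<in> K. \<exists>l\<in>F. x + \<eta> *\<^sub>R l \<notin> K}"

lemma exit_region_eq: "exit_region K \<eta> F = K - erosion K \<eta> F"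
  by (auto simp: exit_region_def erosion_def)

lemma erosion_subset: "0 \<in> F \<Longrightarrow> erosion K \<eta> F \<subseteq> K"
  by (force simp: erosion_def)

lemma closed_erosion:
  fixes K :: "'a::euclidean_space set"
  assumes "closed K"
  shows "closed (erosion K \<eta> F)"
proof -
  have eq: "erosion K \<eta> F = (\<Inter>l\<in>F. (\<lambda>x. x + \<eta> *\<^sub>R l) -` K)" by (auto simp: erosion_def)
  show ?thesis unfolding eq using assms
    by (intro closed_INT ballI closed_vimage) (auto intro!: continuous_intros)
qed

lemma emeasure_bounded_neq_infinity: "bounded (S :: 'a::euclidean_space set) \<Longrightarrow> emeasure lborel S \<noteq> \<top>"
  using emeasure_bounded_finite[of S] by auto

lemma content_translation:
  fixes S :: "'a::euclidean_space set"
  assumes "S \<in> sets borel"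
  shows "measure lborel ((\<lambda>x. x + a) ` S) = measure lborel S" "(\<lambda>x. x + a) ` S \<in> sets borel"
proof -
  have eq: "(\<lambda>x. x + a) ` S = (\<lambda>x. x - a) -` S"
    by (auto intro: image_eqI[of _ _ "_ - a"])
  show b: "(\<lambda>x. x + a) ` S \<in> sets borel"
    unfolding eq using measurable_sets[of "\<lambda>x. x - a" borel borel S] assms by simp
  have "measure lebesgue ((+) a ` S) = measure lebesgue S" by (rule measure_translation)
  moreover have "(+) a ` S = (\<lambda>x. x + a) ` S" by (auto simp: add.commute)
  ultimately show "measure lborel ((\<lambda>x. x + a) ` S) = measure lborel S" using b assms by simp
qed

lemma content_exit_region:
  fixes K :: "'a::euclidean_space set"
  assumes "compact K" "0 \<in> F"
  shows "measure lborel (exit_region K \<eta> F) = measure lborel K - measure lborel (erosion K \<eta> F)"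
  unfolding exit_region_eq using assms erosion_subset[OF assms(2), of K \<eta>] closed_erosion[of K \<eta> F]
  by (intro measure_Diff) (auto simp: emeasure_bounded_neq_infinity compact_imp_bounded compact_imp_closed)

text \<open>
  With \<open>H\<close> the half-space and \<open>\<ominus>\<close> the erosion by \<open>\<eta> F\<close>, the claim reads
  \<open>V(K\<ominus>) - V(K\<ominus> \<inter> H\<ominus>) \<le> V(K) - V(K \<inter> H)\<close>.  Here \<open>H\<ominus>\<close> is the translate of \<open>H\<close> by \<open>- \<eta> m\<close>, where \<open>m \<in> F\<close>
  maximises the inner product with the normal; so translation by \<open>\<eta> m\<close> maps \<open>K\<ominus> - H\<ominus>\<close> into \<open>K - H\<close>.
\<close>

lemma content_exit_region_halfspace_le:
  fixes K :: "'a::euclidean_space set"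
  assumes K: "compact K" and F: "finite F" "0 \<in> F" and "0 \<le> \<eta>"
  shows "measure lborel (exit_region (K \<inter> {x. x \<bullet> v \<le> t}) \<eta> F) \<le> measure lborel (exit_region K \<eta> F)"
proof -
  define H where "H = {x. x \<bullet> v \<le> t}"
  have H: "closed H" unfolding H_def by (intro closed_Collect_le continuous_intros)
  have Kc: "closed K" "bounded K" using K compact_imp_closed compact_imp_bounded by auto
  have "finite ((\<lambda>l. l \<bullet> v) ` F)" "(\<lambda>l. l \<bullet> v) ` F \<noteq> {}" using F by auto
  from Max_in[OF this] obtain m where m: "m \<in> F" "m \<bullet> v = Max ((\<lambda>l. l \<bullet> v) ` F)" by auto
  have mmax: "l \<bullet> v \<le> m \<bullet> v" if "l \<in> F" for l using m that F by simp
  define A where "A = erosion K \<eta> F - erosion H \<eta> F"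
  note er = closed_erosion[OF H, of \<eta> F] closed_erosion[OF Kc(1), of \<eta> F] erosion_subset[OF F(2), of K \<eta>]
  have A: "A \<in> sets borel" unfolding A_def using er by auto
  have sub: "(\<lambda>x. x + \<eta> *\<^sub>R m) ` A \<subseteq> K - H"
  proof
    fix y assume "y \<in> (\<lambda>x. x + \<eta> *\<^sub>R m) ` A"
    then obtain x where x: "x \<in> A" "y = x + \<eta> *\<^sub>R m" by auto
    then obtain l where l: "l \<in> F" "x + \<eta> *\<^sub>R l \<notin> H" and "y \<in> K"
      using m by (auto simp: A_def erosion_def)
    have "t < x \<bullet> v + \<eta> * (l \<bullet> v)" using l by (simp add: H_def inner_add_left)
    also have "\<dots> \<le> y \<bullet> v" using mmax[OF l(1)] assms(4) by (simp add: x inner_add_left mult_left_mono)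
    finally show "y \<in> K - H" using \<open>y \<in> K\<close> by (simp add: H_def)
  qed
  have "measure lborel A = measure lborel ((\<lambda>x. x + \<eta> *\<^sub>R m) ` A)"
    using content_translation[OF A] by simp
  also have "\<dots> \<le> measure lborel (K - H)"
    using sub content_translation[OF A] Kc H emeasure_bounded_finite[of "K - H"]
    by (intro measure_mono_fmeasurable) (auto simp: fmeasurable_def intro: bounded_subset)
  finally have le: "measure lborel A \<le> measure lborel (K - H)" .
  have b: "bounded (erosion K \<eta> F)" "bounded (K - H)" "bounded A" using er Kc by (auto intro: bounded_subset simp: A_def)
  have 1: "measure lborel A = measure lborel (erosion K \<eta> F) - measure lborel (erosion K \<eta> F \<inter> erosion H \<eta> F)"
  proof -
    have eq: "A = erosion K \<eta> F - erosion K \<eta> F \<inter> erosion H \<eta> F" by (auto simp: A_def)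
    show ?thesis unfolding eq
      by (rule measure_Diff) (use er b in \<open>auto simp: emeasure_bounded_neq_infinity\<close>)
  qed
  have 2: "measure lborel (K - H) = measure lborel K - measure lborel (K \<inter> H)"
  proof -
    have eq: "K - H = K - K \<inter> H" by auto
    show ?thesis unfolding eq
      by (rule measure_Diff) (use H Kc in \<open>auto simp: emeasure_bounded_neq_infinity\<close>)
  qed
  have "erosion (K \<inter> H) \<eta> F = erosion K \<eta> F \<inter> erosion H \<eta> F" by (auto simp: erosion_def)
  then have "measure lborel (exit_region (K \<inter> H) \<eta> F)
      = measure lborel (K \<inter> H) - measure lborel (erosion K \<eta> F \<inter> erosion H \<eta> F)"
    using K H F by (simp add: content_exit_region compact_Int_closed)
  moreover have "measure lborel (exit_region K \<eta> F) = measure lborel K - measure lborel (erosion K \<eta> F)"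
    using K F by (simp add: content_exit_region)
  ultimately show ?thesis using le 1 2 by (simp add: H_def)
qed

text \<open>
  The supporting half-spaces at the projections of a dense sequence suffice: a point \<open>x\<close> outside
  \<open>K\<close> is cut off by the half-space belonging to any point within half the distance of \<open>x\<close> to \<open>K\<close>.
\<close>

lemma closed_convex_eq_countable_halfspaces:
  fixes K :: "'a::euclidean_space set"
  assumes K: "closed K" "convex K" "K \<noteq> {}"
  obtains v :: "nat \<Rightarrow> 'a" and t :: "nat \<Rightarrow> real" where "K = (\<Inter>i. {x. x \<bullet> v i \<le> t i})"
proof -
  obtain D :: "nat \<Rightarrow> 'a" where D: "\<And>U. open U \<Longrightarrow> U \<noteq> {} \<Longrightarrow> \<exists>i. D i \<in> U"
    using dense_sequence_exists by blast
  \<comment> \<open>The normal \<open>0\<close> gives the whole space, for members of the sequence that lie in \<open>K\<close>.\<close>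
  define v where "v i = (if D i \<in> K then 0 else outer_normal K (D i))" for i
  define t where "t i = (if D i \<in> K then 0 else closest_point K (D i) \<bullet> v i)" for i
  have pos: "0 < infdist x K" if "x \<notin> K" for x
    using that K by (metis in_closed_iff_infdist_zero infdist_nonneg order_less_le)
  have "K = (\<Inter>i. {x. x \<bullet> v i \<le> t i})"
  proof (intro equalityI subsetI)
    fix x assume x: "x \<in> K"
    have "x \<bullet> v i \<le> t i" for i
      using outer_normal_properties(3)[OF K pos x, of "D i"]
      by (auto simp: v_def t_def inner_diff_right inner_commute)
    then show "x \<in> (\<Inter>i. {x. x \<bullet> v i \<le> t i})" by auto
  next
    fix x assume x: "x \<in> (\<Inter>i. {x. x \<bullet> v i \<le> t i})"
    show "x \<in> K"
    proof (rule ccontr)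
      assume "x \<notin> K"
      note p = pos[OF this]
      obtain i where i: "D i \<in> ball x (infdist x K / 2)" using D[of "ball x (infdist x K / 2)"] p by auto
      have q: "infdist x K - dist x (D i) \<le> infdist (D i) K"
        using infdist_triangle[of x K "D i"] by (simp add: dist_commute)
      then have qp: "0 < infdist (D i) K" using i p by simp
      then have nK: "D i \<notin> K" by auto
      note n = outer_normal_properties[OF K qp]
      have "(D i - closest_point K (D i)) \<bullet> outer_normal K (D i) = infdist (D i) K"
        using n(1,2) by (metis add_diff_cancel_left' inner_scaleR_left mult.right_neutral norm_eq_1)
      moreover have "(D i - x) \<bullet> outer_normal K (D i) \<le> dist x (D i)"
        using norm_cauchy_schwarz[of "D i - x" "outer_normal K (D i)"] n(1)
        by (simp add: dist_norm norm_minus_commute)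
      moreover have "x \<bullet> outer_normal K (D i) \<le> closest_point K (D i) \<bullet> outer_normal K (D i)"
        using x nK by (auto simp: v_def t_def dest: spec[of _ i])
      ultimately show False using q i by (simp add: inner_diff_left)
    qed
  qed
  then show ?thesis using that by blast
qed

text \<open>
  A closed convex set inside \<open>K'\<close> arises from \<open>K'\<close> by countably many cuts with half-spaces.  Each cut
  shrinks the layer, and erosion commutes with decreasing intersections, so continuity from above applies
  to both volumes whose difference is the volume of the layer.
\<close>

lemma content_exit_region_mono:
  fixes K K' :: "'a::euclidean_space set"
  assumes K: "compact K" "convex K" "K \<noteq> {}" and K': "compact K'" "K \<subseteq> K'"
    and F: "finite F" "0 \<in> F" and "0 \<le> \<eta>"
  shows "measure lborel (exit_region K \<eta> F) \<le> measure lborel (exit_region K' \<eta> F)"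
proof -
  obtain v :: "nat \<Rightarrow> 'a" and t :: "nat \<Rightarrow> real" where vt: "K = (\<Inter>i. {x. x \<bullet> v i \<le> t i})"
    by (rule closed_convex_eq_countable_halfspaces[OF compact_imp_closed[OF K(1)] K(2,3)])
  define C where "C m = K' \<inter> (\<Inter>i<m. {x. x \<bullet> v i \<le> t i})" for m :: nat
  have C_Suc: "C (Suc m) = C m \<inter> {x. x \<bullet> v m \<le> t m}" for m
    by (auto simp: C_def lessThan_Suc)
  have cH: "closed {x. x \<bullet> v m \<le> t m}" for m by (intro closed_Collect_le continuous_intros)
  have comp: "compact (C m)" for m
  proof (induction m)
    case (Suc m)
    then show ?case by (simp add: C_Suc compact_Int_closed cH)
  qed (simp add: C_def K')
  have CK: "(\<Inter>m. C m) = K" unfolding vt C_def using K'(2) vt by auto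
  have le: "measure lborel (exit_region (C m) \<eta> F) \<le> measure lborel (exit_region K' \<eta> F)" for m
  proof (induction m)
    case (Suc m)
    then show ?case
      using content_exit_region_halfspace_le[OF comp F assms(8), of m "v m" "t m"] by (simp add: C_Suc)
  qed (simp add: C_def)
  have b: "closed (C m)" "emeasure lborel (C m) \<noteq> \<infinity>" for m
    using comp[of m] by (auto simp: compact_imp_closed emeasure_bounded_neq_infinity compact_imp_bounded)
  have b2: "emeasure lborel (erosion (C m) \<eta> F) \<noteq> \<infinity>" for m
    using bounded_subset[OF compact_imp_bounded[OF comp] erosion_subset[OF F(2)]]
    by (simp add: emeasure_bounded_neq_infinity)
  have "decseq C" by (auto simp: decseq_def C_def)
  then have "(\<lambda>m. measure lborel (C m)) \<longlonglongrightarrow> measure lborel (\<Inter>m. C m)"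
    using b by (intro Lim_measure_decseq) auto
  moreover have "(\<lambda>m. measure lborel (erosion (C m) \<eta> F)) \<longlonglongrightarrow> measure lborel (\<Inter>m. erosion (C m) \<eta> F)"
    using closed_erosion[OF b(1), of _ \<eta> F] b2 by (intro Lim_measure_decseq) (auto simp: decseq_def C_def erosion_def)
  moreover have "(\<Inter>m. erosion (C m) \<eta> F) = erosion K \<eta> F"
    unfolding CK[symmetric] by (auto simp: erosion_def)
  ultimately have "(\<lambda>m. measure lborel (C m) - measure lborel (erosion (C m) \<eta> F))
      \<longlonglongrightarrow> measure lborel K - measure lborel (erosion K \<eta> F)"
    by (auto intro: tendsto_diff simp: CK)
  then have "(\<lambda>m. measure lborel (exit_region (C m) \<eta> F)) \<longlonglongrightarrow> measure lborel (exit_region K \<eta> F)"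
    using K F comp by (simp add: content_exit_region)
  then show ?thesis using le by (intro LIMSEQ_le_const2) auto
qed

lemma mem_scaleR_image_iff: "c \<noteq> 0 \<Longrightarrow> y \<in> (\<lambda>x. c *\<^sub>R x) ` S \<longleftrightarrow> y /\<^sub>R c \<in> S" for y :: "'a::real_vector"
  by (auto intro: image_eqI[of _ _ "y /\<^sub>R c"])

lemma content_scaling:
  fixes S :: "'a::euclidean_space set"
  assumes "0 < c" "S \<in> sets borel"
  shows "measure lborel ((\<lambda>x. c *\<^sub>R x) ` S) = c ^ DIM('a) * measure lborel S" "(\<lambda>x. c *\<^sub>R x) ` S \<in> sets borel"
proof -
  have eq: "(\<lambda>x. c *\<^sub>R x) ` S = (\<lambda>x. x /\<^sub>R c) -` S" using assms by (auto simp: mem_scaleR_image_iff)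
  show b: "(\<lambda>x. c *\<^sub>R x) ` S \<in> sets borel"
    unfolding eq using measurable_sets[of "\<lambda>x. x /\<^sub>R c" borel borel S] assms by simp
  show "measure lborel ((\<lambda>x. c *\<^sub>R x) ` S) = c ^ DIM('a) * measure lborel S"
    using measure_lebesgue_affine[of c 0 S] assms b by simp
qed

text \<open>
  If \<open>x\<close> and \<open>x + \<eta> l\<close> belong to \<open>K\<close>, so does the whole segment between them.
\<close>

lemma exit_region_mono_step:
  assumes "convex K" "0 \<le> \<eta>'" "\<eta>' \<le> \<eta>"
  shows "exit_region K \<eta>' F \<subseteq> exit_region K \<eta> F"
proof
  fix x assume "x \<in> exit_region K \<eta>' F"
  then obtain l where l: "x \<in> K" "l \<in> F" "x + \<eta>' *\<^sub>R l \<notin> K" by (auto simp: exit_region_def)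
  have "x + \<eta> *\<^sub>R l \<notin> K"
  proof
    assume y: "x + \<eta> *\<^sub>R l \<in> K"
    have "\<eta> \<noteq> 0" using l assms by auto
    then have "x + \<eta>' *\<^sub>R l = (1 - \<eta>'/\<eta>) *\<^sub>R x + (\<eta>'/\<eta>) *\<^sub>R (x + \<eta> *\<^sub>R l)"
      by (simp add: algebra_simps)
    also have "\<dots> \<in> K" using assms l(1) y \<open>\<eta> \<noteq> 0\<close> by (intro convexD) auto
    finally show False using l by simp
  qed
  then show "x \<in> exit_region K \<eta> F" using l by (auto simp: exit_region_def)
qed

lemma exit_region_scaling:
  assumes "0 < c"
  shows "exit_region ((\<lambda>x. c *\<^sub>R x) ` K) \<eta> F = (\<lambda>x. c *\<^sub>R x) ` exit_region K (\<eta> / c) F"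
  using assms
  by (intro set_eqI) (simp add: mem_scaleR_image_iff exit_region_def scaleR_add_right divide_inverse mult.commute)

definition parallel_body :: "'a::metric_space set \<Rightarrow> real \<Rightarrow> 'a set" where
  "parallel_body K s = {x. infdist x K \<le> s}"

lemma sets_exit_region: "closed K \<Longrightarrow> exit_region (K::'a::euclidean_space set) \<eta> F \<in> sets borel"
  unfolding exit_region_eq using closed_erosion[of K \<eta> F] by auto

lemma convex_parallel_body:
  fixes K :: "'a::euclidean_space set"
  assumes K: "compact K" "convex K" and ne: "K \<noteq> {}"
  shows "convex (parallel_body K s)"
proof -
  have "parallel_body K s = (\<Union>x\<in>K. \<Union>y\<in>cball 0 s. {x + y})"
  proof (intro equalityI subsetI)
    fix x assume x: "x \<in> parallel_body K s"
    have "closest_point K x \<in> K" using K ne by (simp add: closest_point_in_set compact_imp_closed)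
    moreover have "x - closest_point K x \<in> cball 0 s"
      using x ne K by (simp add: parallel_body_def infdist_closest_point compact_imp_closed dist_norm norm_minus_commute)
    moreover have "x = closest_point K x + (x - closest_point K x)" by simp
    ultimately show "x \<in> (\<Union>x\<in>K. \<Union>y\<in>cball 0 s. {x + y})" by blast
  next
    fix x assume "x \<in> (\<Union>x\<in>K. \<Union>y\<in>cball 0 s. {x + y})"
    then obtain k y where "k \<in> K" "norm y \<le> s" "x = k + y" by auto
    then have "infdist x K \<le> dist x k" "dist x k \<le> s" using infdist_le[of k K x] by (simp_all add: dist_norm)
    then show "x \<in> parallel_body K s" by (simp add: parallel_body_def)
  qed
  then show ?thesis using convex_sums[OF K(2) convex_cball[of 0 s]] by simp
qed

text \<open>
  Since \<open>K\<close> contains the ball of radius \<open>r\<close>, the parallel body \<open>K + s B\<close> is contained in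
  \<open>K + (s/r) K = (1 + s/r) K\<close>.  Monotonicity and homogeneity then compare the layers of \<open>K\<close> and of its
  parallel bodies.
\<close>

lemma content_exit_region_parallel_body:
  fixes K :: "'a::euclidean_space set"
  assumes K: "compact K" "convex K" "cball 0 r \<subseteq> K" "0 < r" and "0 \<le> s"
    and F: "finite F" "0 \<in> F" and "0 \<le> \<eta>"
  shows "compact (parallel_body K s)"
    and "measure lborel (exit_region K \<eta> F) \<le> measure lborel (exit_region (parallel_body K s) \<eta> F)"
    and "measure lborel (exit_region (parallel_body K s) \<eta> F) \<le> (1 + s / r) ^ DIM('a) * measure lborel (exit_region K \<eta> F)"
proof -
  have ne: "K \<noteq> {}" using K by auto
  define c where "c = 1 + s / r"
  have c: "1 \<le> c" using assms by (simp add: c_def)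
  have sub: "parallel_body K s \<subseteq> (\<lambda>x. c *\<^sub>R x) ` K"
  proof
    fix x assume x: "x \<in> parallel_body K s"
    define p where "p = closest_point K x"
    have p: "p \<in> K" using K ne by (simp add: p_def closest_point_in_set compact_imp_closed)
    have d: "dist x p \<le> s" using x ne K by (simp add: p_def parallel_body_def infdist_closest_point compact_imp_closed)
    show "x \<in> (\<lambda>x. c *\<^sub>R x) ` K"
    proof (cases "s = 0")
      case True
      then show ?thesis using p d by (simp add: c_def)
    next
      case False
      define b where "b = (r / s) *\<^sub>R (x - p)"
      have "norm b = r / s * dist x p" using assms by (simp add: b_def dist_norm)
      also have "\<dots> \<le> r / s * s" using d assms by (intro mult_left_mono) auto
      finally have "b \<in> cball 0 r" using False by simp
      then have b: "b \<in> K" using K by auto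
      have "(1 / c) *\<^sub>R p + (1 - 1 / c) *\<^sub>R b \<in> K"
        using c p b K by (intro convexD) auto
      moreover have "x = p + (s / r) *\<^sub>R b" using False K by (simp add: b_def)
      moreover have "c * (1 - 1 / c) = s / r" using c by (simp add: right_diff_distrib) (simp add: c_def)
      ultimately show ?thesis
        using c by (intro image_eqI[of _ _ "(1 / c) *\<^sub>R p + (1 - 1 / c) *\<^sub>R b"]) (auto simp: scaleR_add_right)
    qed
  qed
  have ccK: "compact ((\<lambda>x. c *\<^sub>R x) ` K)" using K by (intro compact_scaling)
  have cl: "closed (parallel_body K s)" unfolding parallel_body_def
    by (intro closed_Collect_le continuous_intros)
  show comp: "compact (parallel_body K s)"
    using sub cl ccK by (meson bounded_subset compact_eq_bounded_closed)
  have KK: "K \<subseteq> parallel_body K s" using assms by (auto simp: parallel_body_def)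
  show "measure lborel (exit_region K \<eta> F) \<le> measure lborel (exit_region (parallel_body K s) \<eta> F)"
    using K ne comp KK F assms by (intro content_exit_region_mono)
  have conv: "convex (parallel_body K s)" using K ne by (intro convex_parallel_body)
  have "measure lborel (exit_region (parallel_body K s) \<eta> F) \<le> measure lborel (exit_region ((\<lambda>x. c *\<^sub>R x) ` K) \<eta> F)"
    using KK ne comp conv ccK sub F assms by (intro content_exit_region_mono) auto
  also have "\<dots> = c ^ DIM('a) * measure lborel (exit_region K (\<eta> / c) F)"
    using c K by (simp add: exit_region_scaling content_scaling sets_exit_region compact_imp_closed)
  also have "\<dots> \<le> c ^ DIM('a) * measure lborel (exit_region K \<eta> F)"
  proof (intro mult_left_mono measure_mono_fmeasurable)
    show "exit_region K (\<eta> / c) F \<subseteq> exit_region K \<eta> F"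
      using c assms mult_left_mono[of 1 c \<eta>] by (intro exit_region_mono_step) (auto simp: field_simps)
    have "bounded (exit_region K \<eta> F)" using K compact_imp_bounded by (auto simp: exit_region_def intro: bounded_subset)
    then show "exit_region K \<eta> F \<in> fmeasurable lborel"
      using K by (intro fmeasurableI emeasure_bounded_finite) (auto simp: sets_exit_region compact_imp_closed)
  qed (use c K in \<open>auto simp: sets_exit_region compact_imp_closed\<close>)
  finally show "measure lborel (exit_region (parallel_body K s) \<eta> F) \<le> (1 + s / r) ^ DIM('a) * measure lborel (exit_region K \<eta> F)"
    by (simp add: c_def)
qed

section \<open>The volume of the boundary layer to first order\<close>

definition support :: "'a::real_inner set \<Rightarrow> 'a \<Rightarrow> real" where
  "support F u = Max ((\<lambda>l. u \<bullet> l) ` F)"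

lemma
  assumes "finite F" "0 \<in> F"
  shows support_ge: "l \<in> F \<Longrightarrow> u \<bullet> l \<le> support F u"
    and support_nonneg: "0 \<le> support F u"
    and support_attained: "\<exists>l\<in>F. support F u = u \<bullet> l"
    and less_support_iff: "t < support F u \<longleftrightarrow> (\<exists>l\<in>F. t < u \<bullet> l)"
proof -
  have F: "finite ((\<lambda>l. u \<bullet> l) ` F)" "(\<lambda>l. u \<bullet> l) ` F \<noteq> {}" using assms by auto
  show "u \<bullet> l \<le> support F u" if "l \<in> F" for l using that F by (simp add: support_def)
  from this[of 0] show "0 \<le> support F u" using assms by simp
  show "\<exists>l\<in>F. support F u = u \<bullet> l" using Max_in[OF F] by (auto simp: support_def)
  show "t < support F u \<longleftrightarrow> (\<exists>l\<in>F. t < u \<bullet> l)" using F by (simp add: support_def Max_gr_iff)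
qed

lemma borel_measurable_support [measurable]:
  "finite F \<Longrightarrow> support F \<in> borel_measurable (borel :: 'a::euclidean_space measure)"
  unfolding support_def[abs_def] by (intro borel_measurable_Max) auto

text \<open>
  The largest distance to \<open>K\<close> reached from \<open>x\<close> by a translation from \<open>\<eta> F\<close>: the point \<open>x\<close> lies in the layer
  of the parallel body of radius \<open>s\<close> exactly if \<open>d(x, K) \<le> s < max_distance K \<eta> F x\<close>.
\<close>

definition max_distance :: "'a::euclidean_space set \<Rightarrow> real \<Rightarrow> 'a set \<Rightarrow> 'a \<Rightarrow> real" where
  "max_distance K \<eta> F x = Max ((\<lambda>l. infdist (x + \<eta> *\<^sub>R l) K) ` F)"

lemma
  assumes "finite F" "0 \<in> F"
  shows max_distance_ge: "l \<in> F \<Longrightarrow> infdist (x + \<eta> *\<^sub>R l) K \<le> max_distance K \<eta> F x"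
    and infdist_le_max_distance: "infdist x K \<le> max_distance K \<eta> F x"
    and max_distance_attained: "\<exists>l\<in>F. max_distance K \<eta> F x = infdist (x + \<eta> *\<^sub>R l) K"
    and less_max_distance_iff: "t < max_distance K \<eta> F x \<longleftrightarrow> (\<exists>l\<in>F. t < infdist (x + \<eta> *\<^sub>R l) K)"
proof -
  have F: "finite ((\<lambda>l. infdist (x + \<eta> *\<^sub>R l) K) ` F)" "(\<lambda>l. infdist (x + \<eta> *\<^sub>R l) K) ` F \<noteq> {}" using assms by auto
  show "infdist (x + \<eta> *\<^sub>R l) K \<le> max_distance K \<eta> F x" if "l \<in> F" for l using that F by (simp add: max_distance_def)
  from this[of 0] show "infdist x K \<le> max_distance K \<eta> F x" using assms by simp
  show "\<exists>l\<in>F. max_distance K \<eta> F x = infdist (x + \<eta> *\<^sub>R l) K" using Max_in[OF F] by (auto simp: max_distance_def)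
  show "t < max_distance K \<eta> F x \<longleftrightarrow> (\<exists>l\<in>F. t < infdist (x + \<eta> *\<^sub>R l) K)" using F by (simp add: max_distance_def Max_gr_iff)
qed

lemma borel_measurable_infdist [measurable]: "(\<lambda>x. infdist x K) \<in> borel_measurable borel"
  by (intro borel_measurable_continuous_onI continuous_intros)

lemma borel_measurable_max_distance [measurable]:
  "finite F \<Longrightarrow> max_distance K \<eta> F \<in> borel_measurable borel"
  unfolding max_distance_def[abs_def] by (intro borel_measurable_Max) measurable

text \<open>
  Tonelli: for fixed \<open>x\<close>, the radii \<open>s\<close> for which \<open>x\<close> lies in the layer of the parallel body form an interval
  from \<open>d(x, K)\<close> to \<open>max_distance K \<eta> F x\<close>, cut off at \<open>\<epsilon>\<close>.
\<close>

lemma nn_integral_exit_region_parallel_body: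
  fixes K :: "'a::euclidean_space set"
  assumes F: "finite F" "0 \<in> F"
  shows "(\<integral>\<^sup>+s. emeasure lborel (exit_region (parallel_body K s) \<eta> F) * indicator {0..<\<epsilon>} s \<partial>lborel)
    = (\<integral>\<^sup>+x. ennreal (min (max_distance K \<eta> F x) \<epsilon> - min (infdist x K) \<epsilon>) \<partial>lborel)"
proof -
  define S where "S = {p :: real \<times> 'a. 0 \<le> fst p \<and> fst p < \<epsilon> \<and> infdist (snd p) K \<le> fst p \<and> fst p < max_distance K \<eta> F (snd p)}"
  note [measurable] = borel_measurable_max_distance[OF F(1), of K \<eta>]
  have S: "S \<in> sets (borel \<Otimes>\<^sub>M borel)"
  proof -
    have "Measurable.pred (borel \<Otimes>\<^sub>M borel) (\<lambda>p :: real \<times> 'a. 0 \<le> fst p \<and> fst p < \<epsilon> \<and> infdist (snd p) K \<le> fst p \<and> fst p < max_distance K \<eta> F (snd p))"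
      by measurable
    then show ?thesis by (simp add: S_def pred_def space_pair_measure)
  qed
  have meas: "case_prod (\<lambda>s x. indicator S (s, x) :: ennreal) \<in> borel_measurable (lborel \<Otimes>\<^sub>M lborel)"
    using S by (simp add: case_prod_eta sets_pair_measure_cong[OF sets_lborel sets_lborel] cong: measurable_cong_sets)
  have cl: "closed (parallel_body K s)" for s unfolding parallel_body_def
    by (intro closed_Collect_le continuous_intros)
  have 1: "emeasure lborel (exit_region (parallel_body K s) \<eta> F) * indicator {0..<\<epsilon>} s = (\<integral>\<^sup>+x. indicator S (s, x) \<partial>lborel)" for s
  proof -
    have "(\<integral>\<^sup>+x. indicator S (s, x) \<partial>lborel) = (\<integral>\<^sup>+x. indicator (exit_region (parallel_body K s) \<eta> F) x * indicator {0..<\<epsilon>} s \<partial>lborel)"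
      using F by (intro nn_integral_cong)
        (auto simp: S_def exit_region_def parallel_body_def less_max_distance_iff not_le split: split_indicator)
    also have "\<dots> = emeasure lborel (exit_region (parallel_body K s) \<eta> F) * indicator {0..<\<epsilon>} s"
      using sets_exit_region[OF cl] by (simp add: nn_integral_multc)
    finally show ?thesis by simp
  qed
  have 2: "(\<integral>\<^sup>+s. indicator S (s, x) \<partial>lborel) = ennreal (min (max_distance K \<eta> F x) \<epsilon> - min (infdist x K) \<epsilon>)" for x
  proof -
    have "(\<integral>\<^sup>+s. indicator S (s, x) \<partial>lborel) = (\<integral>\<^sup>+s. indicator {infdist x K..<min (max_distance K \<eta> F x) \<epsilon>} s \<partial>lborel)"
      using infdist_nonneg[of x K]
      by (intro nn_integral_cong) (auto simp: S_def split: split_indicator)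
    also have "\<dots> = emeasure lborel {infdist x K..<min (max_distance K \<eta> F x) \<epsilon>}"
      by simp
    also have "\<dots> = ennreal (min (max_distance K \<eta> F x) \<epsilon> - min (infdist x K) \<epsilon>)"
    proof (cases "infdist x K < \<epsilon>")
      case True
      then show ?thesis using infdist_le_max_distance[OF F, of x K \<eta>] by simp
    next
      case False
      then have "{infdist x K..<min (max_distance K \<eta> F x) \<epsilon>} = {}" by auto
      then show ?thesis using False infdist_le_max_distance[OF F, of x K \<eta>] by simp
    qed
    finally show ?thesis .
  qed
  show ?thesis unfolding 1 2[symmetric] by (rule lborel_pair.Fubini'[OF meas, symmetric])
qed

text \<open>
  The distance function is differentiable outside \<open>K\<close> with gradient the outer normal.  The lower bound
  is the distance to the supporting half-space, the upper one the distance to the projection of \<open>x\<close>.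
\<close>

lemma infdist_directional_bounds:
  fixes K :: "'a::euclidean_space set"
  assumes K: "closed K" "convex K" "K \<noteq> {}" and q: "0 < infdist x K"
  shows "infdist x K + outer_normal K x \<bullet> v \<le> infdist (x + v) K"
    and "infdist (x + v) K \<le> infdist x K + outer_normal K x \<bullet> v + (norm v)\<^sup>2 / (2 * infdist x K)"
proof -
  define p u t y where "p = closest_point K x" and "u = outer_normal K x" and "t = infdist x K" and "y = closest_point K (x + v)"
  note n = outer_normal_properties[OF K q, folded p_def u_def t_def]
  have py: "p \<in> K" "y \<in> K" using K by (simp_all add: p_def y_def closest_point_in_set)
  have xp: "x = p + t *\<^sub>R u" using n(2) .
  have "t + u \<bullet> v = u \<bullet> (x + v - y) + u \<bullet> (y - p)"
    using n(1) by (subst xp) (simp add: inner_add_right inner_diff_right dot_square_norm)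
  also have "\<dots> \<le> u \<bullet> (x + v - y)" using n(3)[OF py(2)] by simp
  also have "\<dots> \<le> norm (x + v - y)" using norm_cauchy_schwarz[of u "x + v - y"] n(1) by simp
  also have "\<dots> = infdist (x + v) K" using K by (simp add: y_def infdist_closest_point dist_norm)
  finally show "infdist x K + outer_normal K x \<bullet> v \<le> infdist (x + v) K" by (simp add: t_def u_def)
  have "infdist (x + v) K \<le> dist (x + v) p" using py by (intro infdist_le)
  also have "dist (x + v) p = norm (t *\<^sub>R u + v)" by (subst xp) (simp add: dist_norm)
  finally have 1: "infdist (x + v) K \<le> norm (t *\<^sub>R u + v)" .
  \<comment> \<open>The inequality \<open>2 a t \<le> a\<^sup>2 + t\<^sup>2\<close> linearises the norm of \<open>t u + v\<close> at \<open>t u\<close>.\<close>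
  have "0 \<le> (norm (t *\<^sub>R u + v) - t)\<^sup>2" by simp
  also have "\<dots> = (norm (t *\<^sub>R u + v))\<^sup>2 - 2 * t * norm (t *\<^sub>R u + v) + t\<^sup>2"
    by (simp add: power2_diff)
  also have "(norm (t *\<^sub>R u + v))\<^sup>2 = t\<^sup>2 + 2 * t * (u \<bullet> v) + (norm v)\<^sup>2"
    using n(1) dot_norm[of "t *\<^sub>R u" v] by (simp add: power_mult_distrib)
  finally have "2 * t * norm (t *\<^sub>R u + v) \<le> 2 * t * (t + u \<bullet> v + (norm v)\<^sup>2 / (2 * t))"
    using q by (simp add: t_def distrib_left power2_eq_square)
  then have "norm (t *\<^sub>R u + v) \<le> t + u \<bullet> v + (norm v)\<^sup>2 / (2 * t)"
    using q by (simp add: t_def)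
  then show "infdist (x + v) K \<le> infdist x K + outer_normal K x \<bullet> v + (norm v)\<^sup>2 / (2 * infdist x K)"
    using 1 by (simp add: t_def u_def)
qed

lemma tendsto_max_distance_quotient:
  fixes K :: "'a::euclidean_space set"
  assumes K: "closed K" "convex K" "K \<noteq> {}" and q: "0 < infdist x K" and F: "finite F" "0 \<in> F"
    and e: "\<And>n. 0 < e n" "e \<longlonglongrightarrow> 0"
  shows "(\<lambda>n. (max_distance K (e n) F x - infdist x K) / e n) \<longlonglongrightarrow> support F (outer_normal K x)"
proof (rule real_tendsto_sandwich)
  define B where "B = Max (norm ` F)"
  have B: "norm l \<le> B" if "l \<in> F" for l using that F by (simp add: B_def)
  have lower: "support F (outer_normal K x) \<le> (max_distance K (e n) F x - infdist x K) / e n" for n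
  proof -
    obtain l where l: "l \<in> F" "support F (outer_normal K x) = outer_normal K x \<bullet> l"
      using support_attained[OF F] by blast
    show ?thesis
      using infdist_directional_bounds(1)[OF K q, of "e n *\<^sub>R l"] max_distance_ge[OF F l(1), of x "e n" K] e(1)[of n]
      by (simp add: l(2) field_simps)
  qed
  have upper: "(max_distance K (e n) F x - infdist x K) / e n \<le> support F (outer_normal K x) + e n * (B\<^sup>2 / (2 * infdist x K))" for n
  proof -
    obtain l where l: "l \<in> F" "max_distance K (e n) F x = infdist (x + e n *\<^sub>R l) K"
      using max_distance_attained[OF F] by blast
    have "infdist (x + e n *\<^sub>R l) K \<le> infdist x K + e n * (outer_normal K x \<bullet> l) + (e n * norm l)\<^sup>2 / (2 * infdist x K)"
      using infdist_directional_bounds(2)[OF K q, of "e n *\<^sub>R l"] e(1)[of n] by simp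
    also have "\<dots> \<le> infdist x K + e n * support F (outer_normal K x) + (e n * B)\<^sup>2 / (2 * infdist x K)"
      using support_ge[OF F l(1)] B[OF l(1)] q e(1)[of n]
      by (intro add_mono mult_left_mono divide_right_mono power_mono order_refl) auto
    also have "\<dots> = infdist x K + e n * (support F (outer_normal K x) + e n * (B\<^sup>2 / (2 * infdist x K)))"
      by (simp add: distrib_left power_mult_distrib power2_eq_square)
    finally show ?thesis using e(1)[of n] by (simp add: l(2) pos_divide_le_eq mult.commute)
  qed
  show "\<forall>\<^sub>F n in sequentially. support F (outer_normal K x) \<le> (max_distance K (e n) F x - infdist x K) / e n"
    using lower by simp
  show "\<forall>\<^sub>F n in sequentially. (max_distance K (e n) F x - infdist x K) / e n \<le> support F (outer_normal K x) + e n * (B\<^sup>2 / (2 * infdist x K))"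
    using upper by simp
  have "(\<lambda>n. support F (outer_normal K x) + e n * (B\<^sup>2 / (2 * infdist x K))) \<longlonglongrightarrow> support F (outer_normal K x) + 0 * (B\<^sup>2 / (2 * infdist x K))"
    using e(2) by (intro tendsto_intros)
  then show "(\<lambda>n. support F (outer_normal K x) + e n * (B\<^sup>2 / (2 * infdist x K))) \<longlonglongrightarrow> support F (outer_normal K x)"
    by simp
qed simp

text \<open>
  The quotient is bounded by the largest norm in \<open>F\<close>, because the distance function is 1-Lipschitz, and it
  vanishes outside the parallel body.  It converges at every point outside the two null sets
  \<open>frontier K\<close> and \<open>frontier (parallel_body K \<epsilon>)\<close>: to \<open>0\<close> in the interior of \<open>K\<close> and beyond distance \<open>\<epsilon>\<close>, and to the
  support function of \<open>F\<close> at the outer normal in between.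
\<close>

lemma tendsto_nn_integral_max_distance_quotient:
  fixes K :: "'a::euclidean_space set"
  assumes K: "compact K" "convex K" "K \<noteq> {}" and F: "finite F" "0 \<in> F" and "0 < \<epsilon>"
    and e: "\<And>n. 0 < e n" "e \<longlonglongrightarrow> 0" and conv: "convex (parallel_body K \<epsilon>)" "compact (parallel_body K \<epsilon>)"
  shows "(\<lambda>n. \<integral>\<^sup>+x. ennreal ((min (max_distance K (e n) F x) \<epsilon> - min (infdist x K) \<epsilon>) / e n) \<partial>lborel)
    \<longlonglongrightarrow> (\<integral>\<^sup>+x. ennreal (support F (outer_normal K x)) * indicator (shell K 0 \<epsilon> (sphere 0 1)) x \<partial>lborel)"
    and "(\<integral>\<^sup>+x. ennreal ((min (max_distance K (e n) F x) \<epsilon> - min (infdist x K) \<epsilon>) / e n) \<partial>lborel) < \<infinity>"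
    and "(\<integral>\<^sup>+x. ennreal (support F (outer_normal K x)) * indicator (shell K 0 \<epsilon> (sphere 0 1)) x \<partial>lborel) < \<infinity>"
proof -
  have Kc: "closed K" using K compact_imp_closed by auto
  define B where "B = Max (norm ` F)"
  have B: "norm l \<le> B" if "l \<in> F" for l using that F by (simp add: B_def)
  have B0: "0 \<le> B" using B[OF F(2)] by simp
  note [measurable] = borel_measurable_max_distance[OF F(1), of K] borel_measurable_support[OF F(1)]
    borel_measurable_outer_normal[OF Kc K(2,3)] sets_shell[OF Kc K(2,3), of "sphere 0 1" 0 \<epsilon>]
  let ?f = "\<lambda>n x. ennreal ((min (max_distance K (e n) F x) \<epsilon> - min (infdist x K) \<epsilon>) / e n)"
  let ?w = "\<lambda>x. ennreal B * indicator (parallel_body K \<epsilon>) x"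
  have w: "(\<integral>\<^sup>+x. ?w x \<partial>lborel) < \<infinity>"
    using conv(2) emeasure_bounded_finite[OF compact_imp_bounded[OF conv(2)]]
    by (simp add: nn_integral_cmult compact_imp_closed ennreal_mult_less_top)
  have le: "?f n x \<le> ?w x" for n x
  proof (cases "infdist x K \<le> \<epsilon>")
    case True
    obtain l where l: "l \<in> F" "max_distance K (e n) F x = infdist (x + e n *\<^sub>R l) K"
      using max_distance_attained[OF F] by blast
    have "infdist (x + e n *\<^sub>R l) K \<le> infdist x K + dist (x + e n *\<^sub>R l) x"
      by (rule infdist_triangle)
    also have "\<dots> \<le> infdist x K + e n * B" using e(1)[of n] B[OF l(1)] by (simp add: dist_norm)
    finally have "(min (max_distance K (e n) F x) \<epsilon> - min (infdist x K) \<epsilon>) / e n \<le> B"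
      using True e(1)[of n] by (simp add: l(2) field_simps)
    then show ?thesis using True by (simp add: parallel_body_def ennreal_leI)
  next
    case False
    then show ?thesis using infdist_le_max_distance[OF F, of x K "e n"] by simp
  qed
  have lim: "(\<lambda>n. ?f n x) \<longlonglongrightarrow> ennreal (support F (outer_normal K x)) * indicator (shell K 0 \<epsilon> (sphere 0 1)) x"
    if x: "x \<notin> frontier K" "x \<notin> frontier (parallel_body K \<epsilon>)" for x
  proof -
    have q: "infdist x K \<le> max_distance K (e n) F x" for n by (rule infdist_le_max_distance[OF F])
    \<comment> \<open>A point at distance exactly \<open>\<epsilon>\<close> is on the frontier of the parallel body, since moving along
      the outer normal increases the distance.\<close>
    consider "x \<in> interior K" | "0 < infdist x K" "infdist x K < \<epsilon>" | "\<epsilon> < infdist x K"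
    proof (cases "x \<in> K")
      case True
      then show ?thesis using x(1) that(1) Kc by (simp add: frontier_def)
    next
      case False
      then have q0: "0 < infdist x K" by (metis Kc K(3) in_closed_iff_infdist_zero infdist_nonneg order_less_le)
      have "infdist x K \<noteq> \<epsilon>"
      proof
        assume eq: "infdist x K = \<epsilon>"
        have "x \<notin> interior (parallel_body K \<epsilon>)"
        proof
          assume "x \<in> interior (parallel_body K \<epsilon>)"
          then obtain d where d: "0 < d" "ball x d \<subseteq> parallel_body K \<epsilon>" by (auto simp: mem_interior)
          have "x + (d/2) *\<^sub>R outer_normal K x \<in> ball x d"
            using d outer_normal_properties(1)[OF Kc K(2,3) q0] by (simp add: dist_norm)
          then have "infdist (x + (d/2) *\<^sub>R outer_normal K x) K \<le> \<epsilon>" using d by (auto simp: parallel_body_def)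
          then show False using infdist_shift_outer_normal(1)[OF Kc K(2,3) q0, of "d/2"] d eq by simp
        qed
        then show False using x(2) eq conv(2) by (simp add: frontier_def compact_imp_closed parallel_body_def)
      qed
      then show ?thesis using q0 that(2,3) by (cases "infdist x K < \<epsilon>") auto
    qed
    then show ?thesis
    proof cases
      case 1
      then obtain d where d: "0 < d" "ball x d \<subseteq> K" by (auto simp: mem_interior)
      have xK: "infdist x K = 0" using 1 interior_subset by (auto intro: infdist_zero)
      have "(\<lambda>n. e n * B) \<longlonglongrightarrow> 0 * B" using e(2) by (intro tendsto_intros)
      then have "\<forall>\<^sub>F n in sequentially. e n * B < d" using d by (auto dest: order_tendstoD)
      then have "\<forall>\<^sub>F n in sequentially. ?f n x = 0"
      proof eventually_elim
        case (elim n)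
        obtain l where l: "l \<in> F" "max_distance K (e n) F x = infdist (x + e n *\<^sub>R l) K"
          using max_distance_attained[OF F] by blast
        have "e n * norm l \<le> e n * B" using B[OF l(1)] e(1)[of n] by simp
        then have "e n * norm l < d" using elim by linarith
        then have "x + e n *\<^sub>R l \<in> ball x d" using e(1)[of n] by (simp add: dist_norm)
        then show ?case using d l(2) xK \<open>0 < \<epsilon>\<close> by (auto intro!: infdist_zero)
      qed
      then have "(\<lambda>n. ?f n x) \<longlonglongrightarrow> 0" by (rule tendsto_eventually)
      then show ?thesis using xK by (simp add: shell_def)
    next
      case 2
      have lim: "(\<lambda>n. (max_distance K (e n) F x - infdist x K) / e n) \<longlonglongrightarrow> support F (outer_normal K x)"
        using tendsto_max_distance_quotient[OF Kc K(2,3) 2(1) F] e by blast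
      have "(\<lambda>n. (max_distance K (e n) F x - infdist x K) / e n * e n) \<longlonglongrightarrow> support F (outer_normal K x) * 0"
        using lim e(2) by (intro tendsto_mult)
      moreover have "(max_distance K (e n) F x - infdist x K) / e n * e n = max_distance K (e n) F x - infdist x K" for n
        using e(1)[of n] by simp
      ultimately have "(\<lambda>n. max_distance K (e n) F x - infdist x K) \<longlonglongrightarrow> 0" by simp
      then have "\<forall>\<^sub>F n in sequentially. max_distance K (e n) F x - infdist x K < \<epsilon> - infdist x K"
        using 2(2) by (intro order_tendstoD(2)[where y = 0]) simp_all
      then have "\<forall>\<^sub>F n in sequentially. ennreal ((max_distance K (e n) F x - infdist x K) / e n) = ?f n x"
        by eventually_elim (use 2 in simp)
      then have "(\<lambda>n. ?f n x) \<longlonglongrightarrow> ennreal (support F (outer_normal K x))"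
        by (rule Lim_transform_eventually[OF tendsto_ennrealI[OF lim]])
      moreover have "x \<in> shell K 0 \<epsilon> (sphere 0 1)"
        using 2 outer_normal_properties(1)[OF Kc K(2,3) 2(1)] by (simp add: shell_def)
      ultimately show ?thesis by simp
    next
      case 3
      have z: "?f n x = 0" for n using q[of n] 3 by simp
      show ?thesis unfolding z using 3 by (simp add: shell_def)
    qed
  qed
  have "frontier K \<in> null_sets lebesgue" "frontier (parallel_body K \<epsilon>) \<in> null_sets lebesgue"
    using negligible_convex_frontier[OF K(2)] negligible_convex_frontier[OF conv(1)]
    by (simp_all add: negligible_iff_null_sets)
  then have "frontier K \<in> null_sets lborel" "frontier (parallel_body K \<epsilon>) \<in> null_sets lborel"
    by (simp_all add: null_sets_completion_iff)
  then have AE: "AE x in lborel. x \<notin> frontier K" "AE x in lborel. x \<notin> frontier (parallel_body K \<epsilon>)"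
    by (auto intro: AE_not_in)
  show lm: "(\<lambda>n. \<integral>\<^sup>+x. ?f n x \<partial>lborel)
    \<longlonglongrightarrow> (\<integral>\<^sup>+x. ennreal (support F (outer_normal K x)) * indicator (shell K 0 \<epsilon> (sphere 0 1)) x \<partial>lborel)"
  proof (rule nn_integral_dominated_convergence[where w = ?w])
    show "AE x in lborel. (\<lambda>n. ?f n x) \<longlonglongrightarrow> ennreal (support F (outer_normal K x)) * indicator (shell K 0 \<epsilon> (sphere 0 1)) x"
      using AE by eventually_elim (rule lim)
    show "?w \<in> borel_measurable lborel" using conv(2) by (simp add: compact_imp_closed)
  qed (use le w in auto)
  have lew: "(\<integral>\<^sup>+x. ?f n x \<partial>lborel) \<le> (\<integral>\<^sup>+x. ?w x \<partial>lborel)" for n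
    by (intro nn_integral_mono le)
  then show "(\<integral>\<^sup>+x. ?f n x \<partial>lborel) < \<infinity>" using w by (rule le_less_trans)
  have "(\<integral>\<^sup>+x. ennreal (support F (outer_normal K x)) * indicator (shell K 0 \<epsilon> (sphere 0 1)) x \<partial>lborel) \<le> (\<integral>\<^sup>+x. ?w x \<partial>lborel)"
    using lm lew by (intro LIMSEQ_le_const2) auto
  then show "(\<integral>\<^sup>+x. ennreal (support F (outer_normal K x)) * indicator (shell K 0 \<epsilon> (sphere 0 1)) x \<partial>lborel) < \<infinity>"
    using w by (rule le_less_trans)
qed

lemma nn_integral_support_layer_cake:
  fixes K :: "'a::euclidean_space set"
  assumes K: "closed K" "convex K" "K \<noteq> {}" and F: "finite F" "0 \<in> F"
  shows "(\<integral>\<^sup>+x. ennreal (support F (outer_normal K x)) * indicator (shell K 0 \<epsilon> (sphere 0 1)) x \<partial>lborel)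
    = (\<integral>\<^sup>+t. emeasure lborel (shell K 0 \<epsilon> {u \<in> sphere 0 1. t < support F u}) * indicator {0<..} t \<partial>lborel)"
proof -
  define S where "S = {p :: real \<times> 'a. 0 < fst p \<and> fst p < support F (outer_normal K (snd p)) \<and> snd p \<in> shell K 0 \<epsilon> (sphere 0 1)}"
  note [measurable] = borel_measurable_support[OF F(1)]
    borel_measurable_outer_normal[OF K] sets_shell[OF K, of "sphere 0 1" 0 \<epsilon>]
  have S: "S \<in> sets (borel \<Otimes>\<^sub>M borel)"
  proof -
    have "Measurable.pred (borel \<Otimes>\<^sub>M borel) (\<lambda>p :: real \<times> 'a. 0 < fst p \<and> fst p < support F (outer_normal K (snd p)) \<and> snd p \<in> shell K 0 \<epsilon> (sphere 0 1))"
      by measurable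
    then show ?thesis by (simp add: S_def pred_def space_pair_measure)
  qed
  have meas: "case_prod (\<lambda>s x. indicator S (s, x) :: ennreal) \<in> borel_measurable (lborel \<Otimes>\<^sub>M lborel)"
    using S by (simp add: case_prod_eta sets_pair_measure_cong[OF sets_lborel sets_lborel] cong: measurable_cong_sets)
  have 1: "ennreal (support F (outer_normal K x)) * indicator (shell K 0 \<epsilon> (sphere 0 1)) x = (\<integral>\<^sup>+t. indicator S (t, x) \<partial>lborel)" for x
  proof -
    have "(\<integral>\<^sup>+t. indicator S (t, x) \<partial>lborel)
        = (\<integral>\<^sup>+t. indicator {0<..<support F (outer_normal K x)} t * indicator (shell K 0 \<epsilon> (sphere 0 1)) x \<partial>lborel)"
      by (intro nn_integral_cong) (auto simp: S_def split: split_indicator)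
    also have "\<dots> = emeasure lborel {0<..<support F (outer_normal K x)} * indicator (shell K 0 \<epsilon> (sphere 0 1)) x"
      by (simp add: nn_integral_multc)
    finally show ?thesis using support_nonneg[OF F] by simp
  qed
  have 2: "(\<integral>\<^sup>+x. indicator S (t, x) \<partial>lborel) = emeasure lborel (shell K 0 \<epsilon> {u \<in> sphere 0 1. t < support F u}) * indicator {0<..} t" for t
  proof -
    have "{u \<in> sphere 0 1. t < support F u} \<in> sets borel" by measurable
    note m = sets_shell[OF K this, of 0 \<epsilon>]
    have "(\<integral>\<^sup>+x. indicator S (t, x) \<partial>lborel)
        = (\<integral>\<^sup>+x. indicator (shell K 0 \<epsilon> {u \<in> sphere 0 1. t < support F u}) x * indicator {0<..} t \<partial>lborel)"
      by (intro nn_integral_cong) (auto simp: S_def shell_def split: split_indicator)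
    also have "\<dots> = emeasure lborel (shell K 0 \<epsilon> {u \<in> sphere 0 1. t < support F u}) * indicator {0<..} t"
      by (subst nn_integral_multc) (use m in auto)
    finally show ?thesis .
  qed
  show ?thesis unfolding 1 2[symmetric] by (rule lborel_pair.Fubini'[OF meas])
qed

text \<open>
  The integral of the positive part of the support function of \<open>F\<close> with respect to the surface area
  measure, in layer-cake form.  In this form it is literally the mass that the product measure
  \<open>dt \<otimes> S(K, du)\<close> on \<open>t > 0\<close> gives to the set \<open>t < support F u\<close>, and the setwise limits that
  define the surface area measure can be inserted directly.
\<close>

definition support_integral :: "'a::euclidean_space set \<Rightarrow> 'a set \<Rightarrow> ennreal" where
  "support_integral K F = (\<integral>\<^sup>+t. emeasure (surface_area_measure K) {u \<in> sphere 0 1. t < support F u} * indicator {0<..} t \<partial>lborel)"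

text \<open>
  Layer cake and dominated convergence in \<open>t\<close>: the level sets are empty for \<open>t\<close> above the
  largest norm in \<open>F\<close>, and the ratios of parallel volumes to widths are bounded uniformly for widths up to \<open>1/2\<close>.
\<close>

lemma tendsto_support_integral:
  fixes K :: "'a::euclidean_space set"
  assumes K: "compact K" "convex K" "K \<noteq> {}" and F: "finite F" "0 \<in> F"
    and e: "\<And>n. 0 < e n" "\<And>n. e n \<le> 1/2" "e \<longlonglongrightarrow> 0"
  shows "(\<lambda>k. (\<integral>\<^sup>+x. ennreal (support F (outer_normal K x)) * indicator (shell K 0 (e k) (sphere 0 1)) x \<partial>lborel) / ennreal (e k))
    \<longlonglongrightarrow> support_integral K F"
    and "support_integral K F < \<infinity>"
proof -
  have Kc: "closed K" using K compact_imp_closed by auto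
  define B where "B = Max (norm ` F)"
  have B: "norm l \<le> B" if "l \<in> F" for l using that F by (simp add: B_def)
  have [measurable]: "support F \<in> borel_measurable borel" using F by (intro borel_measurable_support)
  define W where "W t = {u :: 'a. u \<in> sphere 0 1 \<and> t < support F u}" for t
  have W: "W t \<in> sets borel" "W t \<subseteq> sphere 0 1" for t
    by (auto simp: W_def) measurable
  have W0: "W t = {}" if "B < t" for t
  proof -
    have "support F u \<le> B" if "norm u = 1" for u
    proof -
      obtain l where "l \<in> F" "support F u = u \<bullet> l" using support_attained[OF F] by blast
      then show ?thesis using B[of l] norm_cauchy_schwarz[of u l] that by simp
    qed
    then show ?thesis using that by (force simp: W_def)
  qed
  have er: "filterlim e (at_right 0) sequentially"
    using e by (intro tendsto_imp_filterlim_at_right) auto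
  let ?w = "\<lambda>t. 2 * emeasure lborel (shell K 0 1 (sphere 0 1)) * indicator {0..B} t"
  have sh1: "emeasure lborel (shell K 0 1 (sphere 0 1)) < \<infinity>" by (rule emeasure_shell_finite[OF K])
  have w: "(\<integral>\<^sup>+t. ?w t \<partial>lborel) < \<infinity>"
    using sh1 by (simp add: nn_integral_cmult ennreal_mult_less_top emeasure_lborel_Icc_eq)
  let ?g = "\<lambda>k t. emeasure lborel (shell K 0 (e k) (W t)) * indicator {0<..} t / ennreal (e k)"
  let ?h = "\<lambda>t. emeasure (surface_area_measure K) (W t) * indicator {0<..} t"
  have le: "?g k t \<le> ?w t" for k t
  proof (cases "0 < t \<and> t \<le> B")
    case True
    have "emeasure lborel (shell K 0 (e k) (W t)) / ennreal (e k) \<le> 2 * emeasure lborel (shell K 0 1 (W t))"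
      by (rule emeasure_shell_ratio_le[OF K W(1) e(1,2)])
    also have "\<dots> \<le> 2 * emeasure lborel (shell K 0 1 (sphere 0 1))"
    proof (intro mult_left_mono emeasure_mono)
      show "shell K 0 1 (W t) \<subseteq> shell K 0 1 (sphere 0 1)" using W(2)[of t] unfolding shell_def by blast
      show "shell K 0 1 (sphere 0 1) \<in> sets lborel" using sets_shell[OF Kc K(2,3), of "sphere 0 1"] by simp
    qed simp
    finally show ?thesis using True by simp
  next
    case False
    then show ?thesis using W0[of t] by (auto simp: shell_def split: split_indicator)
  qed
  have lim: "(\<lambda>k. ?g k t) \<longlonglongrightarrow> ?h t" for t
    using filterlim_compose[OF tendsto_emeasure_surface_area_measure[OF K W] er, of t]
    by (auto split: split_indicator)
  have g_meas: "?g k \<in> borel_measurable lborel" for k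
  proof -
    note [measurable] = borel_measurable_outer_normal[OF Kc K(2,3)] borel_measurable_support[OF F(1)]
    have [measurable]: "sphere (0::'a) 1 \<in> sets borel" by simp
    have "(\<lambda>t. emeasure lborel (shell K 0 (e k) (W t))) \<in> borel_measurable lborel"
    proof -
      have eq: "shell K 0 (e k) (W t) = Pair t -` {p. 0 < infdist (snd p) K \<and> infdist (snd p) K \<le> e k \<and> outer_normal K (snd p) \<in> sphere 0 1 \<and> fst p < support F (outer_normal K (snd p))}" for t
        by (auto simp: shell_def W_def)
      have "Measurable.pred (borel \<Otimes>\<^sub>M borel) (\<lambda>p. 0 < infdist (snd p) K \<and> infdist (snd p) K \<le> e k \<and> outer_normal K (snd p) \<in> sphere 0 1 \<and> fst p < support F (outer_normal K (snd p)))"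
        by measurable
      then have "{p. 0 < infdist (snd p) K \<and> infdist (snd p) K \<le> e k \<and> outer_normal K (snd p) \<in> sphere 0 1 \<and> fst p < support F (outer_normal K (snd p))} \<in> sets (borel \<Otimes>\<^sub>M borel)"
        by (simp add: pred_def space_pair_measure)
      then show ?thesis unfolding eq
        by (intro sigma_finite_measure.measurable_emeasure_Pair lborel.sigma_finite_measure_axioms)
          (simp add: sets_pair_measure_cong[OF sets_lborel sets_lborel])
    qed
    then show ?thesis by measurable
  qed
  have h_meas: "?h \<in> borel_measurable lborel"
    by (rule borel_measurable_LIMSEQ_order[OF lim g_meas])
  have "(\<lambda>k. \<integral>\<^sup>+t. ?g k t \<partial>lborel) \<longlonglongrightarrow> (\<integral>\<^sup>+t. ?h t \<partial>lborel)"
    by (rule nn_integral_dominated_convergence[where w = ?w]) (use g_meas h_meas le lim w in auto)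
  moreover have "(\<integral>\<^sup>+t. ?g k t \<partial>lborel) = (\<integral>\<^sup>+x. ennreal (support F (outer_normal K x)) * indicator (shell K 0 (e k) (sphere 0 1)) x \<partial>lborel) / ennreal (e k)" for k
  proof -
    have m: "(\<lambda>t. emeasure lborel (shell K 0 (e k) (W t)) * indicator {0<..} t) \<in> borel_measurable lborel"
    proof -
      have "(\<lambda>t. ?g k t * ennreal (e k)) \<in> borel_measurable lborel" using g_meas[of k] by measurable
      then show ?thesis using e(1)[of k] by (simp add: ennreal_divide_times ennreal_times_divide mult_divide_eq_ennreal)
    qed
    show ?thesis
      unfolding nn_integral_support_layer_cake[OF Kc K(2,3) F] using m by (simp add: nn_integral_divide W_def)
  qed
  ultimately show "(\<lambda>k. (\<integral>\<^sup>+x. ennreal (support F (outer_normal K x)) * indicator (shell K 0 (e k) (sphere 0 1)) x \<partial>lborel) / ennreal (e k))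
    \<longlonglongrightarrow> support_integral K F" by (simp add: support_integral_def W_def)
  have "?h t \<le> ?w t" for t
    by (rule LIMSEQ_le_const2[OF lim]) (use le in blast)
  then have "(\<integral>\<^sup>+t. ?h t \<partial>lborel) \<le> (\<integral>\<^sup>+t. ?w t \<partial>lborel)" by (intro nn_integral_mono)
  then show "support_integral K F < \<infinity>"
    using w le_less_trans by (simp add: support_integral_def W_def) 
qed

text \<open>
  Both the limit superior of \<open>a\<close> is at most \<open>s k\<close> and the limit inferior at least \<open>s k / c k\<close>, for every \<open>k\<close>.
\<close>

lemma tendsto_squeeze_family:
  fixes a :: "nat \<Rightarrow> real"
  assumes b: "\<And>k. (\<lambda>n. b k n) \<longlonglongrightarrow> s k" and s: "s \<longlonglongrightarrow> T" and c: "c \<longlonglongrightarrow> (1::real)"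
    and ab: "\<And>k n. a n \<le> b k n" "\<And>k n. b k n \<le> c k * a n"
  shows "a \<longlonglongrightarrow> T"
proof (rule order_tendstoI)
  fix y assume "T < y"
  then have "\<forall>\<^sub>F k in sequentially. s k < y" using s by (auto dest: order_tendstoD)
  then obtain k where "s k < y" using eventually_happens'[OF sequentially_bot] by blast
  then have "\<forall>\<^sub>F n in sequentially. b k n < y" using b by (auto dest: order_tendstoD)
  then show "\<forall>\<^sub>F n in sequentially. a n < y" by eventually_elim (use ab in \<open>force intro: le_less_trans\<close>)
next
  fix y assume y: "y < T"
  have "(\<lambda>k. s k / c k) \<longlonglongrightarrow> T / 1" using s c by (intro tendsto_intros) auto
  then have "\<forall>\<^sub>F k in sequentially. y < s k / c k" using y by (auto dest: order_tendstoD)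
  moreover have "\<forall>\<^sub>F k in sequentially. 0 < c k" using order_tendstoD(1)[OF c, of 0] by simp
  ultimately have "\<forall>\<^sub>F k in sequentially. y * c k < s k \<and> 0 < c k"
    by eventually_elim (simp add: field_simps)
  then obtain k where k: "y * c k < s k" "0 < c k" using eventually_happens'[OF sequentially_bot] by blast
  then have "\<forall>\<^sub>F n in sequentially. y * c k < b k n" using b by (auto dest: order_tendstoD)
  then show "\<forall>\<^sub>F n in sequentially. y < a n"
  proof eventually_elim
    case (elim n)
    then have "c k * y < c k * a n" using ab(2)[of k n] by (simp add: mult.commute)
    then show ?case using k by simp
  qed
qed

text \<open>
  For a fixed width \<open>e k\<close>, the average \<open>I k n / e k\<close> of the layer volumes of the parallel bodies over
  radii in \<open>[0, e k)\<close>, divided by \<open>\<eta> n\<close>, lies between \<open>a n\<close> and \<open>c k\<close> times \<open>a n\<close>; it converges as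
  \<open>\<eta>\<close> tends to \<open>0\<close>.  Afterwards the width tends to \<open>0\<close>, which makes \<open>c k\<close> tend to \<open>1\<close> and the averages to
  the integral against the surface area measure.
\<close>

lemma tendsto_content_exit_region:
  fixes K :: "'a::euclidean_space set"
  assumes K: "compact K" "convex K" "0 \<in> interior K" and F: "finite F" "0 \<in> F"
    and \<eta>: "\<And>n. 0 < \<eta> n" "\<eta> \<longlonglongrightarrow> 0"
  shows "(\<lambda>n. measure lborel (exit_region K (\<eta> n) F) / \<eta> n) \<longlonglongrightarrow> enn2real (support_integral K F)"
proof -
  obtain r where r: "0 < r" "cball 0 r \<subseteq> K" using K(3) by (auto simp: mem_interior_cball)
  have ne: "K \<noteq> {}" using K(3) interior_subset by auto
  define e where "e k = 1 / (real k + 2)" for k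
  have e: "0 < e n" "e n \<le> 1/2" for n by (auto simp: e_def field_simps)
  have e0: "e \<longlonglongrightarrow> 0" unfolding e_def by real_asymp
  define c where "c k = (1 + e k / r) ^ DIM('a)" for k
  have "c \<longlonglongrightarrow> (1 + 0 / r) ^ DIM('a)" unfolding c_def using e0 r by (intro tendsto_intros) auto
  then have c: "c \<longlonglongrightarrow> 1" by simp
  define a where "a n = measure lborel (exit_region K (\<eta> n) F) / \<eta> n" for n
  define I where "I k n = (\<integral>\<^sup>+x. ennreal ((min (max_distance K (\<eta> n) F x) (e k) - min (infdist x K) (e k)) / \<eta> n) \<partial>lborel)" for k n
  define S where "S k = (\<integral>\<^sup>+x. ennreal (support F (outer_normal K x)) * indicator (shell K 0 (e k) (sphere 0 1)) x \<partial>lborel)" for k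
  have conv: "convex (parallel_body K (e k))" "compact (parallel_body K (e k))" for k
    using e(1)[of k] convex_parallel_body[OF K(1,2) ne] content_exit_region_parallel_body(1)[OF K(1,2) r(2,1) _ F, of "e k" 0]
    by auto
  note lim = tendsto_nn_integral_max_distance_quotient[OF K(1,2) ne F e(1) \<eta>(1,2) conv, folded I_def S_def]
  have I_eq: "ennreal (\<eta> n) * I k n = (\<integral>\<^sup>+s. emeasure lborel (exit_region (parallel_body K s) (\<eta> n) F) * indicator {0..<e k} s \<partial>lborel)" for k n
  proof -
    note [measurable] = borel_measurable_max_distance[OF F(1), of K]
    have "ennreal (\<eta> n) * I k n = (\<integral>\<^sup>+x. ennreal (\<eta> n) * ennreal ((min (max_distance K (\<eta> n) F x) (e k) - min (infdist x K) (e k)) / \<eta> n) \<partial>lborel)"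
      unfolding I_def by (subst nn_integral_cmult) auto
    also have "\<dots> = (\<integral>\<^sup>+x. ennreal (min (max_distance K (\<eta> n) F x) (e k) - min (infdist x K) (e k)) \<partial>lborel)"
      using \<eta>(1)[of n] infdist_le_max_distance[OF F, of _ K "\<eta> n"]
      by (intro nn_integral_cong) (simp add: ennreal_mult[symmetric] min.coboundedI1)
    finally show ?thesis by (simp add: nn_integral_exit_region_parallel_body[OF F])
  qed
  have lim1: "I k \<longlonglongrightarrow> S k" for k by (rule lim(1))
  have fin: "I k n < \<infinity>" "S k < \<infinity>" for k n using lim(2,3) by auto
  have em: "emeasure lborel (exit_region (parallel_body K s) (\<eta> n) F) = ennreal (measure lborel (exit_region (parallel_body K s) (\<eta> n) F))" if "0 \<le> s" for s n
  proof -
    have "compact (parallel_body K s)" using content_exit_region_parallel_body(1)[OF K(1,2) r(2,1) that F, of 0] by simp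
    then have "bounded (exit_region (parallel_body K s) (\<eta> n) F)"
      by (intro bounded_subset[OF compact_imp_bounded]) (auto simp: exit_region_def)
    then show ?thesis by (intro emeasure_eq_ennreal_measure emeasure_bounded_neq_infinity)
  qed
  have const: "(\<integral>\<^sup>+s. ennreal x * indicator {0..<e k} s \<partial>lborel) = ennreal (x * e k)" if "0 \<le> x" for x k
    using e(1)[of k] that by (simp add: nn_integral_cmult ennreal_mult)
  have "ennreal (\<eta> n * (a n * e k)) \<le> ennreal (\<eta> n) * I k n" for n k
  proof -
    have "ennreal (\<eta> n * (a n * e k)) = (\<integral>\<^sup>+s. ennreal (measure lborel (exit_region K (\<eta> n) F)) * indicator {0..<e k} s \<partial>lborel)"
      using \<eta>(1)[of n] by (simp add: const a_def)
    also have "\<dots> \<le> ennreal (\<eta> n) * I k n"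
      unfolding I_eq using content_exit_region_parallel_body(2)[OF K(1,2) r(2,1) _ F, of _ "\<eta> n"] \<eta>(1)[of n]
      by (intro nn_integral_mono) (auto simp: em intro!: ennreal_leI split: split_indicator)
    finally show ?thesis .
  qed
  moreover have "ennreal (\<eta> n) * I k n \<le> ennreal (\<eta> n * (c k * a n * e k))" for n k
  proof -
    have "measure lborel (exit_region (parallel_body K s) (\<eta> n) F) \<le> c k * measure lborel (exit_region K (\<eta> n) F)" if "0 \<le> s" "s < e k" for s
    proof -
      have "measure lborel (exit_region (parallel_body K s) (\<eta> n) F) \<le> (1 + s / r) ^ DIM('a) * measure lborel (exit_region K (\<eta> n) F)"
        using content_exit_region_parallel_body(3)[OF K(1,2) r(2,1) that(1) F, of "\<eta> n"] \<eta>(1)[of n] by simp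
      also have "\<dots> \<le> c k * measure lborel (exit_region K (\<eta> n) F)"
        unfolding c_def using that r by (intro mult_right_mono power_mono add_left_mono divide_right_mono) auto
      finally show ?thesis .
    qed
    then have "ennreal (\<eta> n) * I k n \<le> (\<integral>\<^sup>+s. ennreal (c k * measure lborel (exit_region K (\<eta> n) F)) * indicator {0..<e k} s \<partial>lborel)"
      unfolding I_eq by (intro nn_integral_mono) (auto simp: em intro!: ennreal_leI split: split_indicator)
    also have "\<dots> = ennreal (\<eta> n * (c k * a n * e k))"
      using \<eta>(1)[of n] e(1)[of k] r by (subst const) (auto simp: a_def c_def intro!: mult_nonneg_nonneg)
    finally show ?thesis .
  qed
  moreover have "ennreal (\<eta> n) * I k n = ennreal (\<eta> n * enn2real (I k n))" for n k
    using fin(1)[of k n] \<eta>(1)[of n] by (simp add: ennreal_mult)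
  moreover have "0 \<le> c k" "0 \<le> a n" for k n
    using e(1)[of k] r \<eta>(1)[of n] by (auto simp: c_def a_def)
  ultimately have le: "ennreal (\<eta> n * (a n * e k)) \<le> ennreal (\<eta> n * enn2real (I k n))"
      "ennreal (\<eta> n * enn2real (I k n)) \<le> ennreal (\<eta> n * (c k * a n * e k))"
      and nonneg: "0 \<le> c k" "0 \<le> a n" for n k
    by metis+
  have "\<eta> n * (a n * e k) \<le> \<eta> n * enn2real (I k n)" "\<eta> n * enn2real (I k n) \<le> \<eta> n * (c k * a n * e k)" for n k
    using le[of n k] nonneg(1)[of k] nonneg(2)[of n] \<eta>(1)[of n] e(1)[of k] by (simp_all add: ennreal_le_iff)
  note le2 = this
  have ab: "a n \<le> enn2real (I k n) / e k" "enn2real (I k n) / e k \<le> c k * a n" for n k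
    using le2[of n k] \<eta>(1)[of n] e(1)[of k] by (simp_all add: field_simps)
  have bs: "(\<lambda>n. enn2real (I k n) / e k) \<longlonglongrightarrow> enn2real (S k) / e k" for k
    using fin(2)[of k] e(1)[of k] lim1 by (intro tendsto_intros tendsto_enn2real) auto
  have sT: "(\<lambda>k. enn2real (S k) / e k) \<longlonglongrightarrow> enn2real (support_integral K F)"
  proof -
    note T = tendsto_support_integral[OF K(1,2) ne F e e0, folded S_def]
    have "(\<lambda>k. enn2real (S k / ennreal (e k))) \<longlonglongrightarrow> enn2real (support_integral K F)"
      using T by (intro tendsto_enn2real) auto
    moreover have "enn2real (S k / ennreal (e k)) = enn2real (S k) / e k" for k
      using fin(2)[of k] e(1)[of k] by (cases "S k") (auto simp: divide_ennreal)
    ultimately show ?thesis by simp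
  qed
  have "a \<longlonglongrightarrow> enn2real (support_integral K F)"
    by (rule tendsto_squeeze_family[OF bs sT c ab])
  then show ?thesis by (simp add: a_def[abs_def])
qed

section \<open>Convex bodies are determined by their traces on a dense sequence\<close>

definition origin_body :: "'a::euclidean_space set \<Rightarrow> bool" where
  "origin_body L \<longleftrightarrow> is_convex_body L \<and> 0 \<in> interior L"

text \<open>
  Closeness between dilates.  For bodies with the origin in the interior it is the form of convergence that
  implies Hausdorff convergence and passes to polar sets.
\<close>

definition sandwiched :: "real \<Rightarrow> 'a::real_vector set \<Rightarrow> 'a set \<Rightarrow> bool" where
  "sandwiched \<delta> L L' \<longleftrightarrow> (\<forall>x\<in>L. (1 - \<delta>) *\<^sub>R x \<in> L') \<and> (\<forall>y\<in>L'. \<exists>x\<in>L. y = (1 + \<delta>) *\<^sub>R x)"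

lemma origin_bodyD:
  assumes "origin_body L"
  shows "compact L" "convex L" "0 \<in> interior L" "0 \<in> L" "closed L" "bounded L" "is_convex_body L"
  using assms interior_subset by (auto simp: origin_body_def is_convex_body_def compact_imp_closed compact_imp_bounded)

lemma shrink_subset_interior:
  fixes L :: "'a::euclidean_space set"
  assumes "convex L" "0 \<in> interior L" "0 \<le> c" "c < 1"
  shows "(\<lambda>x. c *\<^sub>R x) ` L \<subseteq> interior L"
proof
  fix y assume "y \<in> (\<lambda>x. c *\<^sub>R x) ` L"
  then obtain x where x: "x \<in> L" "y = c *\<^sub>R x" by auto
  have "x - (1 - c) *\<^sub>R (x - 0) \<in> interior L"
    by (rule mem_interior_convex_shrink) (use assms x in auto)
  then show "y \<in> interior L" by (simp add: x(2) algebra_simps)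
qed

lemma mem_convex_hull_chain:
  fixes A :: "nat \<Rightarrow> 'a::real_vector set"
  assumes "incseq A" "x \<in> convex hull (\<Union>m. A m)"
  shows "\<exists>m. x \<in> convex hull (A m)"
proof -
  have inc: "convex hull (A m) \<subseteq> convex hull (A n)" if "m \<le> n" for m n
    using assms(1) that by (intro hull_mono) (auto dest: incseqD)
  have "convex (\<Union>m. convex hull (A m))"
  proof (rule convexI)
    fix x y :: 'a and u v :: real
    assume xy: "x \<in> (\<Union>m. convex hull (A m))" "y \<in> (\<Union>m. convex hull (A m))" and uv: "0 \<le> u" "0 \<le> v" "u + v = 1"
    obtain m n where "x \<in> convex hull (A m)" "y \<in> convex hull (A n)" using xy by auto
    then have "x \<in> convex hull (A (max m n))" "y \<in> convex hull (A (max m n))"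
      using inc[of m "max m n"] inc[of n "max m n"] by auto
    then have "u *\<^sub>R x + v *\<^sub>R y \<in> convex hull (A (max m n))"
      using uv by (intro convexD[OF convex_convex_hull])
    then show "u *\<^sub>R x + v *\<^sub>R y \<in> (\<Union>m. convex hull (A m))" by blast
  qed
  moreover have "(\<Union>m. A m) \<subseteq> (\<Union>m. convex hull (A m))" using hull_subset[of _ convex] by fastforce
  ultimately have "convex hull (\<Union>m. A m) \<subseteq> (\<Union>m. convex hull (A m))" by (simp add: hull_minimal)
  then show ?thesis using assms(2) by auto
qed

context
  fixes D :: "nat \<Rightarrow> 'a::euclidean_space"
  assumes D: "\<And>U. open U \<Longrightarrow> U \<noteq> {} \<Longrightarrow> \<exists>i. D i \<in> U"
begin

text \<open>
  The hull of the dense points in \<open>L\<close> is a convex set whose closure covers the interior of \<open>L\<close>, so it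
  contains that interior.  A small cube around \<open>x\<close> has finitely many vertices, which all belong to the hull
  of one finite part.
\<close>

lemma interior_subset_dense_hulls:
  assumes "convex L" "x \<in> interior L"
  shows "\<exists>m. x \<in> interior (convex hull (D ` {..<m} \<inter> L))"
proof -
  define A where "A m = D ` {..<m} \<inter> L" for m
  have A: "incseq A" by (auto simp: incseq_def A_def)
  define W where "W = convex hull (\<Union>m. A m)"
  have WL: "interior L \<subseteq> closure W"
  proof
    fix y assume y: "y \<in> interior L"
    show "y \<in> closure W"
      unfolding closure_approachable
    proof (intro allI impI)
      fix e :: real assume "0 < e"
      then have "y \<in> ball y e \<inter> interior L" using y by simp
      then have "ball y e \<inter> interior L \<noteq> {}" by blast
      then obtain i where i: "D i \<in> ball y e \<inter> interior L"
        using D[OF open_Int[OF open_ball open_interior]] by blast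
      then have "D i \<in> A (Suc i)" using interior_subset by (auto simp: A_def)
      then have "D i \<in> W" unfolding W_def by (auto intro: hull_inc)
      then show "\<exists>w\<in>W. dist w y < e" using i by (auto simp: dist_commute)
    qed
  qed
  then have "interior L \<subseteq> interior W"
    using interior_maximal[OF WL open_interior] convex_interior_closure[of W] by (simp add: W_def)
  then have LW: "interior L \<subseteq> W" using interior_subset by blast
  obtain e where e: "0 < e" "ball x e \<subseteq> interior L" using assms(2) by (metis open_contains_ball open_interior)
  obtain d where d: "0 < d" "cbox (x - (\<Sum>i\<in>Basis. d *\<^sub>R i)) (x + (\<Sum>i\<in>Basis. d *\<^sub>R i)) \<subseteq> ball x e"
  proof
    define d where "d = e / (2 * real DIM('a))"
    show "0 < d" using e by (simp add: d_def)
    show "cbox (x - (\<Sum>i\<in>Basis. d *\<^sub>R i)) (x + (\<Sum>i\<in>Basis. d *\<^sub>R i)) \<subseteq> ball x e"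
    proof
      fix y assume "y \<in> cbox (x - (\<Sum>i\<in>Basis. d *\<^sub>R i)) (x + (\<Sum>i\<in>Basis. d *\<^sub>R i))"
      then have "\<bar>(y - x) \<bullet> i\<bar> \<le> d" if "i \<in> Basis" for i
        using that by (auto simp: mem_box inner_diff_left inner_add_left inner_sum_left inner_Basis if_distrib cong: if_cong)
      then have "(\<Sum>i\<in>Basis. \<bar>(y - x) \<bullet> i\<bar>) \<le> real DIM('a) * d"
        using sum_bounded_above[of Basis "\<lambda>i. \<bar>(y - x) \<bullet> i\<bar>" d] by simp
      then have "norm (y - x) \<le> real DIM('a) * d" using norm_le_l1[of "y - x"] by linarith
      also have "\<dots> < e" using e by (simp add: d_def)
      finally show "y \<in> ball x e" by (simp add: dist_norm norm_minus_commute)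
    qed
  qed
  obtain S where S: "finite S" "cbox (x - (\<Sum>i\<in>Basis. d *\<^sub>R i)) (x + (\<Sum>i\<in>Basis. d *\<^sub>R i)) = convex hull S"
    using cube_convex_hull[OF d(1)] by blast
  have "\<exists>m. s \<in> convex hull (A m)" if "s \<in> S" for s
  proof -
    have "s \<in> convex hull S" using that by (simp add: hull_inc)
    then have "s \<in> W" using S(2) d(2) e(2) LW by auto
    then show ?thesis using mem_convex_hull_chain[OF A] by (simp add: W_def)
  qed
  then obtain f where f: "\<And>s. s \<in> S \<Longrightarrow> s \<in> convex hull (A (f s))" by metis
  define m where "m = Max (insert 0 (f ` S))"
  have "s \<in> convex hull (A m)" if "s \<in> S" for s
  proof -
    have "f s \<le> m" using S(1) that by (simp add: m_def)
    then have "convex hull (A (f s)) \<subseteq> convex hull (A m)" using A by (intro hull_mono) (auto dest: incseqD)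
    then show ?thesis using f[OF that] by auto
  qed
  then have "convex hull S \<subseteq> convex hull (A m)" by (intro hull_minimal) auto
  then have "box (x - (\<Sum>i\<in>Basis. d *\<^sub>R i)) (x + (\<Sum>i\<in>Basis. d *\<^sub>R i)) \<subseteq> interior (convex hull (A m))"
    unfolding S(2)[symmetric] by (intro interior_maximal order_trans[OF box_subset_cbox]) auto
  moreover have "x \<in> box (x - (\<Sum>i\<in>Basis. d *\<^sub>R i)) (x + (\<Sum>i\<in>Basis. d *\<^sub>R i))"
    using d(1) by (auto simp: mem_box inner_diff_left inner_add_left inner_sum_left inner_Basis if_distrib cong: if_cong)
  ultimately show ?thesis by (auto simp: A_def)
qed

text \<open>
  A smaller dilate is a compact subset of the interior, so finitely many of the open sets from
  \<open>interior_subset_dense_hulls\<close> cover it.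
\<close>

lemma trace_determines_inner:
  assumes L: "origin_body L" and "0 < \<delta>" "\<delta> \<le> 1"
  shows "\<exists>m0. \<forall>m\<ge>m0. \<forall>L'. convex L' \<longrightarrow> D ` {..<m} \<inter> L' = D ` {..<m} \<inter> L \<longrightarrow> (\<lambda>x. (1 - \<delta>) *\<^sub>R x) ` L \<subseteq> L'"
proof -
  note Lb = origin_bodyD[OF L]
  define C where "C = (\<lambda>x. (1 - \<delta>) *\<^sub>R x) ` L"
  have C: "compact C" "C \<subseteq> interior L"
    using Lb assms shrink_subset_interior[of L "1 - \<delta>"] by (auto simp: C_def compact_scaling)
  define I where "I m = interior (convex hull (D ` {..<m} \<inter> L))" for m
  have Imono: "I m \<subseteq> I n" if "m \<le> n" for m n
    unfolding I_def using that by (intro interior_mono hull_mono) auto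
  have "C \<subseteq> (\<Union>m\<in>UNIV. I m)"
    using C(2) interior_subset_dense_hulls[OF Lb(2)] by (auto simp: I_def)
  then obtain T where T: "finite T" "C \<subseteq> (\<Union>m\<in>T. I m)"
    using compactE_image[OF C(1), of UNIV I] by (auto simp: I_def)
  have "C \<subseteq> L'" if "Max (insert 0 T) \<le> m" "convex L'" "D ` {..<m} \<inter> L' = D ` {..<m} \<inter> L" for m L'
  proof -
    have "I k \<subseteq> I m" if "k \<in> T" for k
      using T(1) that \<open>Max (insert 0 T) \<le> m\<close> by (intro Imono) auto
    then have "C \<subseteq> I m" using T(2) by fast
    also have "\<dots> \<subseteq> convex hull (D ` {..<m} \<inter> L')" unfolding I_def that(3) by (rule interior_subset)
    also have "\<dots> \<subseteq> L'" using that by (intro hull_minimal) auto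
    finally show ?thesis .
  qed
  then show ?thesis unfolding C_def by (intro exI[of _ "Max (insert 0 T)"] allI impI)
qed

text \<open>
  Suppose \<open>L'\<close> contains a point \<open>y\<close> on the frontier of the dilate \<open>M\<close>.  As \<open>L'\<close> also contains a fixed ball
  around the origin, it contains a ball around \<open>(1 - \<tau>) y\<close>, a point that is still outside \<open>L\<close>.  That
  ball contains a member of the dense sequence outside \<open>L\<close>, and by compactness of the frontier finitely
  many of them do for all \<open>y\<close>; so \<open>L'\<close> and \<open>L\<close> have different traces.
\<close>

lemma trace_determines_outer:
  assumes L: "origin_body L" and "0 < \<delta>"
  shows "\<exists>m0. \<forall>m\<ge>m0. \<forall>L'. convex L' \<longrightarrow> D ` {..<m} \<inter> L' = D ` {..<m} \<inter> L \<longrightarrow> L' \<subseteq> (\<lambda>x. (1 + \<delta>) *\<^sub>R x) ` L"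
proof -
  note Lb = origin_bodyD[OF L]
  define M where "M = (\<lambda>x. (1 + \<delta>) *\<^sub>R x) ` L"
  have M: "compact M" "convex M" using Lb by (auto simp: M_def compact_scaling convex_scaling)
  have LM: "L \<subseteq> M"
  proof
    fix x assume "x \<in> L"
    then have "(1 - 1 / (1 + \<delta>)) *\<^sub>R 0 + (1 / (1 + \<delta>)) *\<^sub>R x \<in> L"
      using Lb assms by (intro convexD) auto
    then have "(1 / (1 + \<delta>)) *\<^sub>R x \<in> L" by simp
    moreover have "x = (1 + \<delta>) *\<^sub>R (1 / (1 + \<delta>)) *\<^sub>R x" using assms by simp
    ultimately show "x \<in> M" unfolding M_def by (rule image_eqI[rotated])
  qed
  have M0: "0 \<in> interior M" using interior_mono[OF LM] Lb by auto
  \<comment> \<open>Chosen so that shrinking by \<open>1 - \<tau>\<close> takes the dilation factor \<open>1 + \<delta>\<close> only down to \<open>1 + \<delta>/2\<close>.\<close>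
  define \<tau> where "\<tau> = \<delta> / (2 * (1 + \<delta>))"
  have \<tau>: "0 < \<tau>" "\<tau> < 1" "(1 - \<tau>) * (1 + \<delta>) = 1 + \<delta> / 2"
    using assms by (auto simp: \<tau>_def field_simps)
  obtain \<rho> where \<rho>: "0 < \<rho>" "ball 0 \<rho> \<subseteq> L" using Lb(3) by (auto simp: mem_interior)
  define r where "r = \<rho> / 2"
  have r: "0 < r" using \<rho> by (simp add: r_def)
  define Y where "Y = frontier M"
  have Y: "compact Y" using M by (simp add: Y_def compact_frontier)
  have YL: "(1 - \<tau>) *\<^sub>R y \<notin> L" if "y \<in> Y" for y
  proof
    assume "(1 - \<tau>) *\<^sub>R y \<in> L"
    then have w: "(1 + \<delta>) *\<^sub>R (1 - \<tau>) *\<^sub>R y \<in> M" unfolding M_def by (rule imageI)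
    have "1 / (1 + \<delta> / 2) < 1" "0 \<le> 1 / (1 + \<delta> / 2)" using assms by auto
    from shrink_subset_interior[OF M(2) M0 this(2,1)]
    have "(1 / (1 + \<delta> / 2)) *\<^sub>R (1 + \<delta>) *\<^sub>R (1 - \<tau>) *\<^sub>R y \<in> interior M" using w by blast
    moreover have "(1 / (1 + \<delta> / 2)) *\<^sub>R (1 + \<delta>) *\<^sub>R (1 - \<tau>) *\<^sub>R y = y"
    proof -
      have "(1 / (1 + \<delta> / 2)) * ((1 - \<tau>) * (1 + \<delta>)) = 1" unfolding \<tau>(3) using assms by simp
      then show ?thesis by (simp only: scaleR_scaleR mult.assoc[symmetric] mult.commute mult.left_commute scaleR_one)
    qed
    ultimately show False using that by (simp add: Y_def frontier_def)
  qed
  define U where "U i = {y. dist (D i) ((1 - \<tau>) *\<^sub>R y) < \<tau> * r}" for i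
  have U: "open (U i)" for i unfolding U_def by (intro open_Collect_less continuous_intros)
  have "Y \<subseteq> (\<Union>i\<in>{i. D i \<notin> L}. U i)"
  proof
    fix y assume y: "y \<in> Y"
    have "open (ball ((1 - \<tau>) *\<^sub>R y) (\<tau> * r) - L)" "(1 - \<tau>) *\<^sub>R y \<in> ball ((1 - \<tau>) *\<^sub>R y) (\<tau> * r) - L"
      using Lb YL[OF y] \<tau> r by (auto intro: open_Diff)
    then obtain i where "D i \<in> ball ((1 - \<tau>) *\<^sub>R y) (\<tau> * r) - L" using D by (metis empty_iff)
    then show "y \<in> (\<Union>i\<in>{i. D i \<notin> L}. U i)" by (auto simp: U_def dist_commute)
  qed
  then obtain T where T: "T \<subseteq> {i. D i \<notin> L}" "finite T" "Y \<subseteq> (\<Union>i\<in>T. U i)"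
    using compactE_image[OF Y, of "{i. D i \<notin> L}" U] U by metis
  have "0 < (1/2::real)" "(1/2::real) \<le> 1" by auto
  from trace_determines_inner[OF L this] obtain m1 where m1: "\<forall>m\<ge>m1. \<forall>L'. convex L' \<longrightarrow> D ` {..<m} \<inter> L' = D ` {..<m} \<inter> L \<longrightarrow> (\<lambda>x. (1 - 1/2) *\<^sub>R x) ` L \<subseteq> L'"
    by blast
  have "L' \<subseteq> M" if m: "max m1 (Suc (Max (insert 0 T))) \<le> m" and L': "convex L'" and tr: "D ` {..<m} \<inter> L' = D ` {..<m} \<inter> L" for m L'
  proof -
    have half: "(\<lambda>x. (1 - 1/2) *\<^sub>R x) ` L \<subseteq> L'" using m1[rule_format, OF _ L' tr] m by simp
    have ball: "x \<in> L'" if "norm x < r" for x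
    proof -
      have "norm (2 *\<^sub>R x) < \<rho>" using that by (simp add: r_def)
      then have "2 *\<^sub>R x \<in> L" using \<rho> by auto
      then have "(1 - 1/2) *\<^sub>R 2 *\<^sub>R x \<in> L'" using half by blast
      then show ?thesis by simp
    qed
    have disj: "L' \<inter> Y = {}"
    proof (rule ccontr)
      assume "L' \<inter> Y \<noteq> {}"
      then obtain y where y: "y \<in> L'" "y \<in> Y" by auto
      then obtain i where i: "i \<in> T" "dist (D i) ((1 - \<tau>) *\<^sub>R y) < \<tau> * r" using T(3) by (auto simp: U_def)
      define b where "b = (1 / \<tau>) *\<^sub>R (D i - (1 - \<tau>) *\<^sub>R y)"
      have "norm b = dist (D i) ((1 - \<tau>) *\<^sub>R y) / \<tau>" using \<tau>(1) by (simp add: b_def dist_norm)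
      then have "norm b < r" using i(2) \<tau>(1) by (simp add: pos_divide_less_eq mult.commute)
      then have "(1 - \<tau>) *\<^sub>R y + \<tau> *\<^sub>R b \<in> L'" using ball y \<tau> by (intro convexD[OF L']) auto
      moreover have "(1 - \<tau>) *\<^sub>R y + \<tau> *\<^sub>R b = D i" using \<tau> by (simp add: b_def)
      moreover have "i < m"
      proof -
        have "i \<le> Max (insert 0 T)" using T(2) i(1) by simp
        then show ?thesis using m by simp
      qed
      ultimately have "D i \<in> D ` {..<m} \<inter> L'" by auto
      then show False unfolding tr using T(1) i(1) by auto
    qed
    have "0 \<in> L' \<inter> M" using ball[of 0] r M0 interior_subset by auto
    then show ?thesis
      using connected_Int_frontier[OF convex_connected[OF L'], of M] disj by (auto simp: Y_def)
  qed
  then show ?thesis unfolding M_def by (intro exI[of _ "max m1 (Suc (Max (insert 0 T)))"] allI impI)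
qed

lemma trace_determines_body:
  assumes L: "origin_body L" and "0 < \<delta>" "\<delta> \<le> 1"
  shows "\<exists>m0. \<forall>m\<ge>m0. \<forall>L'. convex L' \<longrightarrow> D ` {..<m} \<inter> L' = D ` {..<m} \<inter> L \<longrightarrow> sandwiched \<delta> L L'"
proof -
  obtain m1 where m1: "\<forall>m\<ge>m1. \<forall>L'. convex L' \<longrightarrow> D ` {..<m} \<inter> L' = D ` {..<m} \<inter> L \<longrightarrow> (\<lambda>x. (1 - \<delta>) *\<^sub>R x) ` L \<subseteq> L'"
    using trace_determines_inner[OF assms] by blast
  obtain m2 where m2: "\<forall>m\<ge>m2. \<forall>L'. convex L' \<longrightarrow> D ` {..<m} \<inter> L' = D ` {..<m} \<inter> L \<longrightarrow> L' \<subseteq> (\<lambda>x. (1 + \<delta>) *\<^sub>R x) ` L"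
    using trace_determines_outer[OF assms(1,2)] by blast
  show ?thesis
  proof (intro exI[of _ "max m1 m2"] allI impI)
    fix m L' assume m: "max m1 m2 \<le> m" and L': "convex L'" "D ` {..<m} \<inter> L' = D ` {..<m} \<inter> L"
    have "(\<lambda>x. (1 - \<delta>) *\<^sub>R x) ` L \<subseteq> L'" using m by (intro m1[rule_format, OF _ L']) simp
    moreover have "L' \<subseteq> (\<lambda>x. (1 + \<delta>) *\<^sub>R x) ` L" using m by (intro m2[rule_format, OF _ L']) simp
    ultimately
    show "sandwiched \<delta> L L'" unfolding sandwiched_def by blast
  qed
qed

end

section \<open>Hausdorff convergence and polar sets\<close>

lemma body_set_to_body: "is_convex_body L \<Longrightarrow> body_set (to_body L) = L"
  by (simp add: to_body_def is_convex_body_def Abs_convex_body_inverse)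

lemma dist_to_body_le:
  assumes "is_convex_body L" "is_convex_body L'" "sandwiched \<delta> L L'" "0 \<le> \<delta>" "\<And>x. x \<in> L \<Longrightarrow> norm x \<le> R"
  shows "dist (to_body L') (to_body L) \<le> \<delta> * R"
proof -
  have c: "compact L" "L \<noteq> {}" "compact L'" "L' \<noteq> {}" using assms by (auto simp: is_convex_body_def)
  show ?thesis
    unfolding dist_convex_body_def body_set_to_body[OF assms(1)] body_set_to_body[OF assms(2)]
      hausdorff_dist_le_iff[OF c(3,4,1,2)]
  proof safe
    fix x assume x: "x \<in> L'"
    obtain l where l: "l \<in> L" "x = (1 + \<delta>) *\<^sub>R l" using assms(3) x unfolding sandwiched_def by blast
    have "infdist x L \<le> dist x l" using l by (intro infdist_le)
    also have "\<dots> = \<delta> * norm l" using assms(4) by (simp add: l(2) dist_norm algebra_simps)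
    also have "\<dots> \<le> \<delta> * R" using assms l by (intro mult_left_mono) auto
    finally show "infdist x L \<le> \<delta> * R" .
  next
    fix l assume l: "l \<in> L"
    then have "(1 - \<delta>) *\<^sub>R l \<in> L'" using assms(3) by (auto simp: sandwiched_def)
    then have "infdist l L' \<le> dist l ((1 - \<delta>) *\<^sub>R l)" by (intro infdist_le)
    also have "\<dots> = \<delta> * norm l" using assms(4) by (simp add: dist_norm algebra_simps)
    also have "\<dots> \<le> \<delta> * R" using assms l by (intro mult_left_mono) auto
    finally show "infdist l L' \<le> \<delta> * R" .
  qed
qed

text \<open>
  Polarity reverses inclusions and inverts factors; for \<open>\<delta> \<le> 1/2\<close> one has \<open>1 - 2 \<delta> \<le> 1 / (1 + \<delta>)\<close> and
  \<open>1 / (1 - \<delta>) \<le> 1 + 2 \<delta>\<close>.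
\<close>

lemma sandwiched_polar:
  fixes L L' :: "'a::real_inner set"
  assumes "sandwiched \<delta> L L'" "0 \<le> \<delta>" "\<delta> \<le> 1/2"
  shows "sandwiched (2 * \<delta>) (polar_set L) (polar_set L')"
  unfolding sandwiched_def
proof (intro conjI ballI)
  fix u assume u0: "u \<in> polar_set L"
  define v where "v = (1 - 2 * \<delta>) *\<^sub>R u"
  note u = u0 v_def
  have "v \<bullet> x \<le> 1" if x: "x \<in> L'" for x
  proof -
    obtain l where l: "l \<in> L" "x = (1 + \<delta>) *\<^sub>R l" using assms(1) x by (auto simp: sandwiched_def)
    have k: "0 \<le> (1 - 2 * \<delta>) * (1 + \<delta>)" using assms by simp
    have "(1 - 2 * \<delta>) * (1 + \<delta>) = 1 - \<delta> - 2 * (\<delta> * \<delta>)" by (simp add: algebra_simps)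
    then have k1: "(1 - 2 * \<delta>) * (1 + \<delta>) \<le> 1" using assms mult_nonneg_nonneg[of \<delta> \<delta>] by linarith
    have "v \<bullet> x = ((1 - 2 * \<delta>) * (1 + \<delta>)) * (u \<bullet> l)" by (simp add: u(2) l(2))
    also have "\<dots> \<le> ((1 - 2 * \<delta>) * (1 + \<delta>)) * 1" using u l k by (intro mult_left_mono) (auto simp: polar_set_def)
    finally show ?thesis using k1 by simp
  qed
  then show "(1 - 2 * \<delta>) *\<^sub>R u \<in> polar_set L'" by (simp add: polar_set_def v_def)
next
  fix u assume u: "u \<in> polar_set L'"
  define v where "v = (1 / (1 + 2 * \<delta>)) *\<^sub>R u"
  have "u \<bullet> l \<le> 1 + 2 * \<delta>" if "l \<in> L" for l
  proof -
    have "(1 - \<delta>) *\<^sub>R l \<in> L'" using assms(1) that by (auto simp: sandwiched_def)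
    then have 1: "(1 - \<delta>) * (u \<bullet> l) \<le> 1" using u by (auto simp: polar_set_def)
    have "\<delta> * \<delta> \<le> \<delta> * (1/2)" using assms by (intro mult_left_mono) auto
    moreover have "(1 - \<delta>) * (1 + 2 * \<delta>) = 1 + \<delta> - 2 * (\<delta> * \<delta>)" by (simp add: algebra_simps)
    ultimately have "1 \<le> (1 - \<delta>) * (1 + 2 * \<delta>)" by linarith
    then have "(1 - \<delta>) * (u \<bullet> l) \<le> (1 - \<delta>) * (1 + 2 * \<delta>)" using 1 by linarith
    then show ?thesis using assms by simp
  qed
  then have "v \<in> polar_set L" using assms by (auto simp: polar_set_def v_def)
  moreover have "u = (1 + 2 * \<delta>) *\<^sub>R v" using assms by (simp add: v_def)
  ultimately show "\<exists>x\<in>polar_set L. u = (1 + 2 * \<delta>) *\<^sub>R x" by blast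
qed

lemma closed_polar_set: "closed (polar_set (L :: 'a::real_inner set))"
proof -
  have "polar_set L = (\<Inter>x\<in>L. {u. u \<bullet> x \<le> 1})" by (auto simp: polar_set_def)
  then show ?thesis by (auto intro!: closed_INT closed_Collect_le continuous_intros)
qed

lemma convex_polar_set: "convex (polar_set L)"
  unfolding convex_alt polar_set_def
proof safe
  fix x y :: 'a and u :: real and z
  assume xy: "\<forall>z\<in>L. x \<bullet> z \<le> 1" "\<forall>z\<in>L. y \<bullet> z \<le> 1" and u: "0 \<le> u" "u \<le> 1" and z: "z \<in> L"
  have "(1 - u) * (x \<bullet> z) + u * (y \<bullet> z) \<le> (1 - u) * 1 + u * 1"
    using xy u z by (intro add_mono mult_left_mono) auto
  then show "((1 - u) *\<^sub>R x + u *\<^sub>R y) \<bullet> z \<le> 1" by (simp add: inner_add_left)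
qed

lemma bounded_polar_set:
  fixes L :: "'a::euclidean_space set"
  assumes "0 \<in> interior L"
  shows "bounded (polar_set L)"
proof -
  obtain r where r: "0 < r" "cball 0 r \<subseteq> L" using assms by (auto simp: mem_interior_cball)
  have "norm u \<le> 1 / r" if "u \<in> polar_set L" for u
  proof (cases "u = 0")
    case False
    have "(r / norm u) *\<^sub>R u \<in> L" using r False by auto
    then have "u \<bullet> ((r / norm u) *\<^sub>R u) \<le> 1" using that by (auto simp: polar_set_def)
    then show ?thesis using r False by (simp add: dot_square_norm power2_eq_square field_simps)
  qed (use r in simp)
  then show ?thesis by (auto simp: bounded_iff)
qed

lemma origin_body_polar:
  assumes "origin_body L"
  shows "origin_body (polar_set L)"
proof -
  note Lb = origin_bodyD[OF assms]
  obtain R where R: "0 < R" "\<And>x. x \<in> L \<Longrightarrow> norm x \<le> R" using Lb(6) by (auto simp: bounded_pos)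
  have "cball 0 (1 / R) \<subseteq> polar_set L"
  proof
    fix u :: 'a assume "u \<in> cball 0 (1 / R)"
    then have u: "norm u \<le> 1 / R" by simp
    have "u \<bullet> x \<le> 1" if "x \<in> L" for x
    proof -
      have "u \<bullet> x \<le> norm u * norm x" by (rule norm_cauchy_schwarz)
      also have "\<dots> \<le> 1 / R * R" using u R that by (intro mult_mono) auto
      finally show ?thesis using R by simp
    qed
    then show "u \<in> polar_set L" by (simp add: polar_set_def)
  qed
  then have "0 \<in> interior (polar_set L)" using R(1) unfolding mem_interior_cball by (intro exI[of _ "1 / R"]) simp
  moreover have "compact (polar_set L)" using bounded_polar_set[OF Lb(3)] closed_polar_set by (simp add: compact_eq_bounded_closed)
  moreover have "0 \<in> polar_set L" by (simp add: polar_set_def)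
  ultimately show ?thesis by (auto simp: origin_body_def is_convex_body_def convex_polar_set)
qed

lemma tendsto_to_body:
  assumes "is_convex_body L" "\<And>m. is_convex_body (Ls m)"
    and sw: "\<And>\<delta>. 0 < \<delta> \<Longrightarrow> \<delta> \<le> 1 \<Longrightarrow> \<forall>\<^sub>F m in sequentially. sandwiched \<delta> L (Ls m)"
  shows "(\<lambda>m. to_body (Ls m)) \<longlonglongrightarrow> to_body L"
proof (rule tendstoI)
  fix e :: real assume e: "0 < e"
  have "bounded L" using assms(1) by (simp add: is_convex_body_def compact_imp_bounded)
  then obtain R where R: "0 < R" "\<And>x. x \<in> L \<Longrightarrow> norm x \<le> R" by (auto simp: bounded_pos)
  define \<delta> where "\<delta> = min 1 (e / (2 * R))"
  have \<delta>: "0 < \<delta>" "\<delta> \<le> 1" using e R by (auto simp: \<delta>_def)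
  have "\<delta> * R \<le> e / (2 * R) * R" using R by (intro mult_right_mono) (auto simp: \<delta>_def)
  also have "\<dots> < e" using e R by simp
  finally have "\<delta> * R < e" .
  note dR = this
  show "\<forall>\<^sub>F m in sequentially. dist (to_body (Ls m)) (to_body L) < e"
    using sw[OF \<delta>]
  proof eventually_elim
    case (elim m)
    have "dist (to_body (Ls m)) (to_body L) \<le> \<delta> * R"
      using \<delta> R by (intro dist_to_body_le[OF assms(1,2) elim]) auto
    then show ?case using dR by simp
  qed
qed

lemma tendsto_to_body_of_trace:
  fixes D :: "nat \<Rightarrow> 'a::euclidean_space"
  assumes D: "\<And>U. open U \<Longrightarrow> U \<noteq> {} \<Longrightarrow> \<exists>i. D i \<in> U"
    and L: "origin_body L" and Ls: "\<And>m. origin_body (Ls m)"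
    and tr: "\<And>m. D ` {..<m} \<inter> Ls m = D ` {..<m} \<inter> L"
  shows "(\<lambda>m. to_body (Ls m)) \<longlonglongrightarrow> to_body L"
    and "(\<lambda>m. to_body (polar_set (Ls m))) \<longlonglongrightarrow> to_body (polar_set L)"
proof -
  have sw: "\<forall>\<^sub>F m in sequentially. sandwiched \<delta> L (Ls m)" if \<delta>: "0 < \<delta>" "\<delta> \<le> 1" for \<delta>
  proof -
    obtain m0 where m0: "\<forall>m\<ge>m0. \<forall>L'. convex L' \<longrightarrow> D ` {..<m} \<inter> L' = D ` {..<m} \<inter> L \<longrightarrow> sandwiched \<delta> L L'"
      using trace_determines_body[OF D L \<delta>] by metis
    show ?thesis unfolding eventually_sequentially
      using m0[rule_format, OF _ origin_bodyD(2)[OF Ls] tr] by blast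
  qed
  then show "(\<lambda>m. to_body (Ls m)) \<longlonglongrightarrow> to_body L"
    using L Ls by (intro tendsto_to_body) (auto simp: origin_body_def)
  have "\<forall>\<^sub>F m in sequentially. sandwiched \<delta> (polar_set L) (polar_set (Ls m))" if "0 < \<delta>" "\<delta> \<le> 1" for \<delta>
    using sw[of "\<delta> / 2"] that by (auto elim!: eventually_mono dest: sandwiched_polar)
  then show "(\<lambda>m. to_body (polar_set (Ls m))) \<longlonglongrightarrow> to_body (polar_set L)"
    using origin_body_polar L Ls by (intro tendsto_to_body) (auto simp: origin_body_def)
qed

section \<open>Measurability of random closed convex sets\<close>

text \<open>
  A countable dense subset \<open>T\<close> of \<open>C\<close> does not detect the points of \<open>C\<close> satisfying all constraints, but it detects
  points satisfying finitely many of them up to a small error; compactness of \<open>C\<close> turns approximate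
  solutions of longer and longer systems into an exact one.  This covers sets without interior points,
  on which a dense sequence of the space says nothing.
\<close>

lemma sets_hits_compact:
  fixes g :: "nat \<Rightarrow> 'w \<Rightarrow> 'a::euclidean_space \<Rightarrow> real"
  assumes cont: "\<And>i \<omega>. \<omega> \<in> space M \<Longrightarrow> continuous_on UNIV (g i \<omega>)"
    and meas: "\<And>i x. (\<lambda>\<omega>. g i \<omega> x) \<in> borel_measurable M" and C: "compact C"
  shows "{\<omega>\<in>space M. \<exists>x\<in>C. \<forall>i. g i \<omega> x \<le> 0} \<in> sets M"
proof -
  obtain T where T: "countable T" "T \<subseteq> C" "C \<subseteq> closure T" using separable[of C] by metis
  have "{\<omega>\<in>space M. \<exists>x\<in>C. \<forall>i. g i \<omega> x \<le> 0}
      = {\<omega>\<in>space M. \<forall>n::nat. \<exists>x\<in>T. \<forall>i\<in>{..<n}. g i \<omega> x < 1 / (real n + 1)}"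
  proof (rule Collect_cong, rule conj_cong[OF refl])
    fix \<omega> assume w: "\<omega> \<in> space M"
    note c = cont[OF w]
    show "(\<exists>x\<in>C. \<forall>i. g i \<omega> x \<le> 0) \<longleftrightarrow> (\<forall>n::nat. \<exists>x\<in>T. \<forall>i\<in>{..<n}. g i \<omega> x < 1 / (real n + 1))"
    proof
      assume "\<exists>x\<in>C. \<forall>i. g i \<omega> x \<le> 0"
      then obtain x where x: "x \<in> C" "\<And>i. g i \<omega> x \<le> 0" by auto
      show "\<forall>n::nat. \<exists>x\<in>T. \<forall>i\<in>{..<n}. g i \<omega> x < 1 / (real n + 1)"
      proof
        fix n :: nat
        define U where "U = (\<Inter>i\<in>{..<n}. {y. g i \<omega> y < 1 / (real n + 1)})"
        have "open U" unfolding U_def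
          by (intro open_INT ballI open_Collect_less c continuous_on_const) auto
        moreover have "g i \<omega> x < 1 / (real n + 1)" for i by (rule le_less_trans[OF x(2)]) simp
        then have "x \<in> U" unfolding U_def by auto
        moreover have "x \<in> closure T" using x(1) T(3) by auto
        ultimately obtain t where "t \<in> T" "t \<in> U" by (metis closure_iff_nhds_not_empty disjoint_iff subset_refl)
        then show "\<exists>x\<in>T. \<forall>i\<in>{..<n}. g i \<omega> x < 1 / (real n + 1)" by (auto simp: U_def)
      qed
    next
      assume "\<forall>n::nat. \<exists>x\<in>T. \<forall>i\<in>{..<n}. g i \<omega> x < 1 / (real n + 1)"
      then obtain y where y: "\<And>n. y n \<in> T" "\<And>n i. i < n \<Longrightarrow> g i \<omega> (y n) < 1 / (real n + 1)"
        by (metis lessThan_iff)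
      have "\<forall>n. y n \<in> C" using y(1) T(2) by auto
      then obtain x r where xr: "x \<in> C" "strict_mono r" "(y \<circ> r) \<longlonglongrightarrow> x"
        using C unfolding compact_def by metis
      have "g i \<omega> x \<le> 0" for i
      proof (rule LIMSEQ_le)
        show "(\<lambda>k. g i \<omega> ((y \<circ> r) k)) \<longlonglongrightarrow> g i \<omega> x"
          using continuous_on_tendsto_compose[OF c xr(3)] by auto
        have "(\<lambda>k. 1 / (real k + 1)) \<longlonglongrightarrow> 0" by real_asymp
        then show "(\<lambda>k. 1 / (real (r k) + 1)) \<longlonglongrightarrow> 0"
          using LIMSEQ_subseq_LIMSEQ[OF _ xr(2)] by (auto simp: o_def)
        have "g i \<omega> ((y \<circ> r) k) \<le> 1 / (real (r k) + 1)" if "Suc i \<le> k" for k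
        proof -
          have "i < r k" using seq_suble[OF xr(2), of k] that by simp
          then show ?thesis using y(2) by (simp add: less_imp_le)
        qed
        then show "\<exists>N. \<forall>k\<ge>N. g i \<omega> ((y \<circ> r) k) \<le> 1 / (real (r k) + 1)" by blast
      qed
      then show "\<exists>x\<in>C. \<forall>i. g i \<omega> x \<le> 0" using xr(1) by blast
    qed
  qed
  also have "\<dots> \<in> sets M"
    using T(1) meas
    by (intro sets.sets_Collect_countable_All sets.sets_Collect_countable_Ex' sets.sets_Collect_finite_All) auto
  finally show ?thesis .
qed

lemma measurable_finite_trace:
  assumes "finite G" "\<And>g. g \<in> G \<Longrightarrow> {\<omega>\<in>space M. R g \<omega>} \<in> sets M"
  shows "(\<lambda>\<omega>. {g\<in>G. R g \<omega>}) \<in> M \<rightarrow>\<^sub>M count_space (Pow G)"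
proof (subst measurable_count_space_eq2)
  have "(\<lambda>\<omega>. {g \<in> G. R g \<omega>}) -` {A} \<inter> space M \<in> sets M" if "A \<subseteq> G" for A
  proof -
    have "(\<lambda>\<omega>. {g \<in> G. R g \<omega>}) -` {A} \<inter> space M = {\<omega>\<in>space M. \<forall>g\<in>G. R g \<omega> \<longleftrightarrow> g \<in> A}"
      using that by auto
    also have "\<dots> = {\<omega>\<in>space M. \<forall>g\<in>G. if g \<in> A then R g \<omega> else \<not> R g \<omega>}"
      by (auto split: if_splits)
    also have "\<dots> \<in> sets M"
    proof (rule sets.sets_Collect_finite_All[OF _ assms(1)])
      fix g assume "g \<in> G"
      then show "{\<omega> \<in> space M. if g \<in> A then R g \<omega> else \<not> R g \<omega>} \<in> sets M"
        using assms(2)[of g] sets.sets_Collect_neg[of M "R g"] by auto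
    qed
    finally show ?thesis .
  qed
  then show "(\<lambda>\<omega>. {g \<in> G. R g \<omega>}) \<in> space M \<rightarrow> Pow G \<and> (\<forall>a\<in>Pow G. (\<lambda>\<omega>. {g \<in> G. R g \<omega>}) -` {a} \<inter> space M \<in> sets M)"
    by auto
qed (use assms in auto)

text \<open>
  A nonempty connected set that avoids a sphere around the origin and meets its inside stays inside.
\<close>

lemma is_convex_body_iff_hits:
  fixes X :: "'a::euclidean_space set"
  assumes "closed X" "convex X"
  shows "is_convex_body X \<longleftrightarrow> (\<exists>R::nat. X \<inter> cball 0 (real R) \<noteq> {}) \<and> (\<exists>R::nat. \<forall>r\<in>{R..}. X \<inter> sphere 0 (real r) = {})"
proof
  assume "is_convex_body X"
  then have X: "X \<noteq> {}" "bounded X" by (auto simp: is_convex_body_def compact_imp_bounded)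
  then obtain R where R: "\<And>x. x \<in> X \<Longrightarrow> norm x \<le> R" by (auto simp: bounded_iff)
  obtain m :: nat where m: "R < real m" using reals_Archimedean2 by blast
  show "(\<exists>R::nat. X \<inter> cball 0 (real R) \<noteq> {}) \<and> (\<exists>R::nat. \<forall>r\<in>{R..}. X \<inter> sphere 0 (real r) = {})"
    using X(1) R m by (intro conjI exI[of _ m]) force+
next
  assume *: "(\<exists>R::nat. X \<inter> cball 0 (real R) \<noteq> {}) \<and> (\<exists>R::nat. \<forall>r\<in>{R..}. X \<inter> sphere 0 (real r) = {})"
  then obtain R0 :: nat and x where x: "x \<in> X" "norm x \<le> real R0" by auto
  from * obtain R1 :: nat where "\<forall>r\<in>{R1..}. X \<inter> sphere 0 (real r) = {}" by blast
  then have R1: "X \<inter> sphere 0 (real r) = {}" if "R1 \<le> r" for r using that by blast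
  define R where "R = max (Suc R0) R1"
  have "X \<subseteq> ball 0 (real R)"
  proof (rule ccontr)
    assume n: "\<not> X \<subseteq> ball 0 (real R)"
    have "x \<in> X \<inter> ball 0 (real R)" using x by (auto simp: R_def)
    then have "X \<inter> frontier (ball 0 (real R)) \<noteq> {}"
      using n by (intro connected_Int_frontier convex_connected assms) auto
    moreover have "0 < real R" by (simp add: R_def)
    ultimately show False using R1[of R] by (simp add: frontier_ball R_def)
  qed
  then have "bounded X" using bounded_ball bounded_subset by blast
  then show "is_convex_body X" using assms x by (auto simp: is_convex_body_def compact_eq_bounded_closed)
qed

lemma dist_to_body_net_hull_le:
  fixes X :: "'a::euclidean_space set"
  assumes X: "is_convex_body X" and G: "finite G" "X \<subseteq> (\<Union>g\<in>G. ball g \<rho>)" and "0 < \<rho>"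
  shows "dist (to_body (convex hull {g\<in>G. X \<inter> cball g \<rho> \<noteq> {}})) (to_body X) \<le> \<rho>"
proof -
  define S where "S = {g\<in>G. X \<inter> cball g \<rho> \<noteq> {}}"
  have Xc: "compact X" "convex X" "X \<noteq> {}" using X by (auto simp: is_convex_body_def)
  have near: "\<exists>g\<in>S. dist x g \<le> \<rho>" if "x \<in> X" for x
  proof -
    obtain g where "g \<in> G" "dist g x < \<rho>" using G(2) \<open>x \<in> X\<close> by auto
    then show ?thesis using \<open>x \<in> X\<close> by (intro bexI[of _ g]) (auto simp: S_def dist_commute)
  qed
  have "S \<noteq> {}" using near Xc(3) by blast
  then have H: "is_convex_body (convex hull S)" using G(1)
    by (auto simp: is_convex_body_def S_def finite_imp_compact_convex_hull)
  have Hc: "compact (convex hull S)" "convex hull S \<noteq> {}" using H by (auto simp: is_convex_body_def)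
  have "dist (to_body (convex hull S)) (to_body X) \<le> \<rho>"
    unfolding dist_convex_body_def body_set_to_body[OF X] body_set_to_body[OF H]
      hausdorff_dist_le_iff[OF Hc Xc(1,3)]
  proof safe
    fix x assume x: "x \<in> convex hull S"
    have "S \<subseteq> parallel_body X \<rho>"
    proof
      fix g assume "g \<in> S"
      then obtain y where y: "y \<in> X" "dist g y \<le> \<rho>" by (auto simp: S_def)
      then show "g \<in> parallel_body X \<rho>" using infdist_le[OF y(1), of g] by (simp add: parallel_body_def)
    qed
    then have "convex hull S \<subseteq> parallel_body X \<rho>"
      using convex_parallel_body[OF Xc] by (intro hull_minimal) auto
    then show "infdist x X \<le> \<rho>" using x by (auto simp: parallel_body_def)
  next
    fix x assume "x \<in> X"
    then obtain g where g: "g \<in> S" "dist x g \<le> \<rho>" using near by blast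
    then have "g \<in> convex hull S" by (simp add: hull_inc)
    then show "infdist x (convex hull S) \<le> \<rho>" using infdist_le[of g _ x] g by force
  qed
  then show ?thesis by (simp add: S_def)
qed

text \<open>
  The random body is a pointwise limit of random bodies with finitely many values: the hulls of those
  points of a finite net that are near the body.
\<close>

lemma measurable_to_body:
  fixes X :: "'w \<Rightarrow> 'a::euclidean_space set"
  assumes X: "\<And>\<omega>. \<omega> \<in> space M \<Longrightarrow> closed (X \<omega>)" "\<And>\<omega>. \<omega> \<in> space M \<Longrightarrow> convex (X \<omega>)"
    and hits: "\<And>C. compact C \<Longrightarrow> {\<omega>\<in>space M. X \<omega> \<inter> C \<noteq> {}} \<in> sets M"
  shows "(\<lambda>\<omega>. to_body (X \<omega>)) \<in> M \<rightarrow>\<^sub>M borel"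
proof -
  have A: "{\<omega>\<in>space M. is_convex_body (X \<omega>)} \<in> sets M"
  proof -
    have miss: "{\<omega>\<in>space M. X \<omega> \<inter> C = {}} \<in> sets M" if "compact C" for C
      using sets.sets_Collect_neg[OF hits[OF that]] by simp
    have "{\<omega>\<in>space M. is_convex_body (X \<omega>)} = {\<omega>\<in>space M. (\<exists>R::nat. X \<omega> \<inter> cball 0 (real R) \<noteq> {}) \<and> (\<exists>R::nat. \<forall>r\<in>{R..}. X \<omega> \<inter> sphere 0 (real r) = {})}"
      using is_convex_body_iff_hits X by (intro Collect_cong conj_cong refl) auto
    also have "\<dots> \<in> sets M"
      by (intro sets.sets_Collect_conj sets.sets_Collect_countable_Ex sets.sets_Collect_countable_Ball hits miss) auto
    finally show ?thesis .
  qed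
  have "\<forall>k::nat. \<exists>G. finite G \<and> cball (0::'a) (real k) \<subseteq> (\<Union>g\<in>G. ball g (1 / (real k + 1)))"
  proof
    fix k :: nat
    have "0 < 1 / (real k + 1)" by simp
    then show "\<exists>G. finite G \<and> cball (0::'a) (real k) \<subseteq> (\<Union>g\<in>G. ball g (1 / (real k + 1)))"
      using compact_cball[of "0::'a" "real k"] unfolding compact_eq_totally_bounded by blast
  qed
  then obtain G where G: "\<And>k::nat. finite (G k)" "\<And>k. cball (0::'a) (real k) \<subseteq> (\<Union>g\<in>G k. ball g (1 / (real k + 1)))"
    by metis
  define S where "S k \<omega> = {g \<in> G k. X \<omega> \<inter> cball g (1 / (real k + 1)) \<noteq> {}}" for k \<omega>
  define B where "B k \<omega> = (if is_convex_body (X \<omega>) then to_body (convex hull S k \<omega>) else to_body {0})" for k \<omega>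
  have Bm: "B k \<in> M \<rightarrow>\<^sub>M borel" for k
  proof -
    have "S k \<in> M \<rightarrow>\<^sub>M count_space (Pow (G k))"
      unfolding S_def[abs_def] by (intro measurable_finite_trace G hits) auto
    then have "(\<lambda>\<omega>. to_body (convex hull S k \<omega>)) \<in> M \<rightarrow>\<^sub>M borel"
      by (rule measurable_compose) simp
    then show ?thesis unfolding B_def[abs_def] by (intro measurable_If A) auto
  qed
  have "(\<lambda>k. B k \<omega>) \<longlonglongrightarrow> to_body (X \<omega>)" if w: "\<omega> \<in> space M" for \<omega>
  proof (cases "is_convex_body (X \<omega>)")
    case True
    then have "bounded (X \<omega>)" by (simp add: is_convex_body_def compact_imp_bounded)
    then obtain R where R: "\<And>x. x \<in> X \<omega> \<Longrightarrow> norm x \<le> R" by (auto simp: bounded_iff)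
    have "\<forall>\<^sub>F k in sequentially. R \<le> real k" by real_asymp
    then have "\<forall>\<^sub>F k in sequentially. dist (B k \<omega>) (to_body (X \<omega>)) \<le> 1 / (real k + 1)"
    proof eventually_elim
      case (elim k)
      have "X \<omega> \<subseteq> cball 0 (real k)" using R elim by force
      then have "X \<omega> \<subseteq> (\<Union>g\<in>G k. ball g (1 / (real k + 1)))" using G(2)[of k] by (rule order_trans)
      from dist_to_body_net_hull_le[OF True G(1) this] show ?case
        using True by (simp add: B_def S_def)
    qed
    moreover have "(\<lambda>k. 1 / (real k + 1)) \<longlonglongrightarrow> 0" by real_asymp
    ultimately have "(\<lambda>k. dist (B k \<omega>) (to_body (X \<omega>))) \<longlonglongrightarrow> 0"
      using Lim_null_comparison[of "\<lambda>k. dist (B k \<omega>) (to_body (X \<omega>))" "\<lambda>k. 1 / (real k + 1)" sequentially] by simp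
    then show ?thesis by (rule iffD2[OF tendsto_dist_iff])
  next
    case False
    have "is_convex_body {0::'a}" by (simp add: is_convex_body_def)
    then have "B k \<omega> = to_body (X \<omega>)" for k using False by (simp add: B_def to_body_def)
    then show ?thesis by simp
  qed
  from borel_measurable_LIMSEQ_metric[OF Bm this] show ?thesis .
qed

section \<open>Convergence in distribution from containment probabilities\<close>

text \<open>
  Inclusion and exclusion, one excluded point at a time.
\<close>

lemma tendsto_prob_trace:
  fixes Y :: "nat \<Rightarrow> 'w \<Rightarrow> 'a set" and Z :: "'v \<Rightarrow> 'a set"
  assumes M: "prob_space M" and N: "prob_space N"
    and mY: "\<And>n x. {\<omega>\<in>space M. x \<in> Y n \<omega>} \<in> sets M" and mZ: "\<And>x. {\<omega>\<in>space N. x \<in> Z \<omega>} \<in> sets N"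
    and conv: "\<And>F. finite F \<Longrightarrow> (\<lambda>n. measure M {\<omega>\<in>space M. F \<subseteq> Y n \<omega>}) \<longlonglongrightarrow> measure N {\<omega>\<in>space N. F \<subseteq> Z \<omega>}"
    and "finite B" "finite A"
  shows "(\<lambda>n. measure M {\<omega>\<in>space M. A \<subseteq> Y n \<omega> \<and> B \<inter> Y n \<omega> = {}}) \<longlonglongrightarrow> measure N {\<omega>\<in>space N. A \<subseteq> Z \<omega> \<and> B \<inter> Z \<omega> = {}}"
  using assms(6,7)
proof (induction B arbitrary: A rule: finite_induct)
  case empty
  then show ?case using conv[of A] by simp
next
  case (insert b B)
  interpret M: prob_space M by fact
  interpret N: prob_space N by fact
  have sM: "{\<omega>\<in>space M. A \<subseteq> Y n \<omega> \<and> B \<inter> Y n \<omega> = {}} \<in> sets M" if "finite A" for A n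
  proof -
    have "{\<omega>\<in>space M. A \<subseteq> Y n \<omega> \<and> B \<inter> Y n \<omega> = {}} = {\<omega>\<in>space M. (\<forall>x\<in>A. x \<in> Y n \<omega>) \<and> (\<forall>x\<in>B. x \<notin> Y n \<omega>)}"
      by auto
    also have "\<dots> \<in> sets M"
      using that insert(1) mY sets.sets_Collect_neg[OF mY]
      by (intro sets.sets_Collect_conj sets.sets_Collect_finite_All) auto
    finally show ?thesis .
  qed
  have sN: "{\<omega>\<in>space N. A \<subseteq> Z \<omega> \<and> B \<inter> Z \<omega> = {}} \<in> sets N" if "finite A" for A
  proof -
    have "{\<omega>\<in>space N. A \<subseteq> Z \<omega> \<and> B \<inter> Z \<omega> = {}} = {\<omega>\<in>space N. (\<forall>x\<in>A. x \<in> Z \<omega>) \<and> (\<forall>x\<in>B. x \<notin> Z \<omega>)}"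
      by auto
    also have "\<dots> \<in> sets N"
      using that insert(1) mZ sets.sets_Collect_neg[OF mZ]
      by (intro sets.sets_Collect_conj sets.sets_Collect_finite_All) auto
    finally show ?thesis .
  qed
  have 1: "measure M {\<omega>\<in>space M. A \<subseteq> Y n \<omega> \<and> insert b B \<inter> Y n \<omega> = {}}
      = measure M {\<omega>\<in>space M. A \<subseteq> Y n \<omega> \<and> B \<inter> Y n \<omega> = {}} - measure M {\<omega>\<in>space M. insert b A \<subseteq> Y n \<omega> \<and> B \<inter> Y n \<omega> = {}}" for n
  proof -
    have "{\<omega>\<in>space M. A \<subseteq> Y n \<omega> \<and> insert b B \<inter> Y n \<omega> = {}}
      = {\<omega>\<in>space M. A \<subseteq> Y n \<omega> \<and> B \<inter> Y n \<omega> = {}} - {\<omega>\<in>space M. insert b A \<subseteq> Y n \<omega> \<and> B \<inter> Y n \<omega> = {}}"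
      by auto
    then show ?thesis
      using sM[of A n] sM[of "insert b A" n] insert.prems by (simp only:) (rule M.finite_measure_Diff, auto)
  qed
  have 2: "measure N {\<omega>\<in>space N. A \<subseteq> Z \<omega> \<and> insert b B \<inter> Z \<omega> = {}}
      = measure N {\<omega>\<in>space N. A \<subseteq> Z \<omega> \<and> B \<inter> Z \<omega> = {}} - measure N {\<omega>\<in>space N. insert b A \<subseteq> Z \<omega> \<and> B \<inter> Z \<omega> = {}}"
  proof -
    have "{\<omega>\<in>space N. A \<subseteq> Z \<omega> \<and> insert b B \<inter> Z \<omega> = {}}
      = {\<omega>\<in>space N. A \<subseteq> Z \<omega> \<and> B \<inter> Z \<omega> = {}} - {\<omega>\<in>space N. insert b A \<subseteq> Z \<omega> \<and> B \<inter> Z \<omega> = {}}"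
      by auto
    then show ?thesis
      using sN[of A] sN[of "insert b A"] insert.prems by (simp only:) (rule N.finite_measure_Diff, auto)
  qed
  show ?case unfolding 1 2 using insert.IH[of A] insert.IH[of "insert b A"] insert.prems
    by (intro tendsto_diff) auto
qed

lemma integral_function_of_trace:
  fixes \<phi> :: "'a set \<Rightarrow> real"
  assumes M: "prob_space M" and mY: "\<And>x. {\<omega>\<in>space M. x \<in> Y \<omega>} \<in> sets M" and G: "finite G"
  shows "(\<lambda>\<omega>. \<phi> (G \<inter> Y \<omega>)) \<in> borel_measurable M"
    and "(\<integral>\<omega>. \<phi> (G \<inter> Y \<omega>) \<partial>M) = (\<Sum>A\<in>Pow G. \<phi> A * measure M {\<omega>\<in>space M. A \<subseteq> Y \<omega> \<and> (G - A) \<inter> Y \<omega> = {}})"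
proof -
  interpret prob_space M by fact
  have eq: "G \<inter> Y \<omega> = {x\<in>G. x \<in> Y \<omega>}" for \<omega> by auto
  have m: "(\<lambda>\<omega>. G \<inter> Y \<omega>) \<in> M \<rightarrow>\<^sub>M count_space (Pow G)"
    unfolding eq by (intro measurable_finite_trace G mY)
  then show "(\<lambda>\<omega>. \<phi> (G \<inter> Y \<omega>)) \<in> borel_measurable M" by (rule measurable_compose) simp
  let ?E = "\<lambda>A. {\<omega>\<in>space M. A \<subseteq> Y \<omega> \<and> (G - A) \<inter> Y \<omega> = {}}"
  have E: "?E A = (\<lambda>\<omega>. G \<inter> Y \<omega>) -` {A} \<inter> space M" if "A \<in> Pow G" for A using that by auto
  have Es: "?E A \<in> sets M" if "A \<in> Pow G" for A
    unfolding E[OF that] using that by (intro measurable_sets[OF m]) auto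
  have "(\<integral>\<omega>. \<phi> (G \<inter> Y \<omega>) \<partial>M) = (\<integral>\<omega>. (\<Sum>A\<in>Pow G. \<phi> A * indicator (?E A) \<omega>) \<partial>M)"
  proof (rule Bochner_Integration.integral_cong[OF refl])
    fix \<omega> assume "\<omega> \<in> space M"
    then have ind: "indicator (?E A) \<omega> = (if A = G \<inter> Y \<omega> then 1 else 0 :: real)" if "A \<in> Pow G" for A
      using E[OF that] by (auto simp: indicator_def)
    have "(\<Sum>A\<in>Pow G. \<phi> A * indicator (?E A) \<omega>) = (\<Sum>A\<in>Pow G. if A = G \<inter> Y \<omega> then \<phi> A else 0)"
      by (intro sum.cong refl) (simp add: ind)
    also have "\<dots> = \<phi> (G \<inter> Y \<omega>)" using G by (simp add: sum.delta)
    finally show "\<phi> (G \<inter> Y \<omega>) = (\<Sum>A\<in>Pow G. \<phi> A * indicator (?E A) \<omega>)" by simp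
  qed
  also have "\<dots> = (\<Sum>A\<in>Pow G. (\<integral>\<omega>. \<phi> A * indicator (?E A) \<omega> \<partial>M))"
    using Es by (intro Bochner_Integration.integral_sum integrable_mult_right) (auto simp: emeasure_eq_measure)
  also have "\<dots> = (\<Sum>A\<in>Pow G. \<phi> A * measure M (?E A))"
    using Es by (intro sum.cong refl) auto
  finally show "(\<integral>\<omega>. \<phi> (G \<inter> Y \<omega>) \<partial>M) = (\<Sum>A\<in>Pow G. \<phi> A * measure M (?E A))" .
qed

text \<open>
  The infimum \<open>f m\<close> of \<open>\<Phi>\<close> over all bodies with a given trace on the first \<open>m\<close> points is a function of finitely many
  events, so its expectation converges for fixed \<open>m\<close>; it is a lower bound for \<open>\<Phi>\<close> and tends to \<open>\<Phi>\<close>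
  as \<open>m\<close> grows, by continuity of \<open>\<Phi>\<close> along bodies with the same traces.
\<close>

lemma eventually_integral_greater_of_containment:
  fixes Y :: "nat \<Rightarrow> 'w \<Rightarrow> 'a::euclidean_space set" and Z :: "'v \<Rightarrow> 'a set" and \<Phi> :: "'a set \<Rightarrow> real"
  assumes M: "prob_space M" and N: "prob_space N"
    and mY: "\<And>n x. {\<omega>\<in>space M. x \<in> Y n \<omega>} \<in> sets M" and mZ: "\<And>x. {\<omega>\<in>space N. x \<in> Z \<omega>} \<in> sets N"
    and conv: "\<And>F. finite F \<Longrightarrow> (\<lambda>n. measure M {\<omega>\<in>space M. F \<subseteq> Y n \<omega>}) \<longlonglongrightarrow> measure N {\<omega>\<in>space N. F \<subseteq> Z \<omega>}"
    and AEY: "\<And>n. AE \<omega> in M. origin_body (Y n \<omega>)" and AEZ: "AE \<omega> in N. origin_body (Z \<omega>)"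
    and \<Phi>Y: "\<And>n. (\<lambda>\<omega>. \<Phi> (Y n \<omega>)) \<in> borel_measurable M" and \<Phi>Z: "(\<lambda>\<omega>. \<Phi> (Z \<omega>)) \<in> borel_measurable N"
    and bound: "\<And>L. \<bar>\<Phi> L\<bar> \<le> C"
    and cont: "\<And>L Ls. origin_body L \<Longrightarrow> (\<And>m. origin_body (Ls m)) \<Longrightarrow>
        (\<And>m. D ` {..<m} \<inter> Ls m = D ` {..<m} \<inter> L) \<Longrightarrow> (\<lambda>m. \<Phi> (Ls m)) \<longlonglongrightarrow> \<Phi> L"
    and y: "y < (\<integral>\<omega>. \<Phi> (Z \<omega>) \<partial>N)"
  shows "\<forall>\<^sub>F n in sequentially. y < (\<integral>\<omega>. \<Phi> (Y n \<omega>) \<partial>M)"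
proof -
  interpret M: prob_space M by fact
  interpret N: prob_space N by fact
  \<comment> \<open>Inserting the upper bound \<open>C\<close> keeps the infimum meaningful for sets \<open>A\<close> that are not a trace.\<close>
  define V where "V m A = insert C (\<Phi> ` {L. origin_body L \<and> D ` {..<m} \<inter> L = A})" for m :: nat and A
  define f where "f m A = Inf (V m A)" for m A
  have C: "- C \<le> \<Phi> L" "\<Phi> L \<le> C" for L using bound[of L] by auto
  have C0: "- C \<le> C" using bound[of "{}"] by simp
  have Vx: "- C \<le> v" "v \<le> C" if "v \<in> V m A" for v m A
    using that C C0 unfolding V_def by blast+
  have Vb: "bdd_below (V m A)" "V m A \<noteq> {}" for m A
    using Vx(1)[of _ m A] by (auto simp: V_def simp del: bdd_below_insert intro!: bdd_belowI[of _ "- C"])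
  have fle: "f m (D ` {..<m} \<inter> L) \<le> \<Phi> L" if "origin_body L" for m L
    unfolding f_def using that by (intro cInf_lower Vb) (auto simp: V_def)
  have fb: "\<bar>f m A\<bar> \<le> C" for m A
  proof -
    have "- C \<le> f m A" unfolding f_def using Vb Vx by (intro cInf_greatest) auto
    moreover have "f m A \<le> C" unfolding f_def using Vb by (intro cInf_lower) (auto simp: V_def)
    ultimately show ?thesis by simp
  qed
  have flim: "(\<lambda>m. f m (D ` {..<m} \<inter> L)) \<longlonglongrightarrow> \<Phi> L" if L: "origin_body L" for L
  proof -
    have "\<exists>L'. origin_body L' \<and> D ` {..<m} \<inter> L' = D ` {..<m} \<inter> L \<and> \<Phi> L' < f m (D ` {..<m} \<inter> L) + 1 / (real m + 1)" for m
    proof -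
      have "Inf (V m (D ` {..<m} \<inter> L)) < f m (D ` {..<m} \<inter> L) + 1 / (real m + 1)" by (simp add: f_def)
      then obtain v where v: "v \<in> V m (D ` {..<m} \<inter> L)" "v < f m (D ` {..<m} \<inter> L) + 1 / (real m + 1)"
        using cInf_less_iff[OF Vb(2,1)] by blast
      show ?thesis
      proof (cases "v = C")
        case True
        then show ?thesis using v(2) L bound[of L] by (intro exI[of _ L]) auto
      next
        case False
        then show ?thesis using v by (auto simp: V_def)
      qed
    qed
    then obtain Ls where Ls: "\<And>m. origin_body (Ls m)" "\<And>m. D ` {..<m} \<inter> Ls m = D ` {..<m} \<inter> L"
        "\<And>m. \<Phi> (Ls m) < f m (D ` {..<m} \<inter> L) + 1 / (real m + 1)" by metis
    have "(\<lambda>m. \<Phi> (Ls m)) \<longlonglongrightarrow> \<Phi> L" by (rule cont[OF L Ls(1,2)])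
    moreover have "(\<lambda>m. 1 / (real m + 1)) \<longlonglongrightarrow> 0" by real_asymp
    ultimately have "(\<lambda>m. \<Phi> (Ls m) - 1 / (real m + 1)) \<longlonglongrightarrow> \<Phi> L - 0" by (rule tendsto_diff)
    then have lo: "(\<lambda>m. \<Phi> (Ls m) - 1 / (real m + 1)) \<longlonglongrightarrow> \<Phi> L" by simp
    show ?thesis
    proof (rule real_tendsto_sandwich[OF _ _ lo tendsto_const])
      show "\<forall>\<^sub>F m in sequentially. \<Phi> (Ls m) - 1 / (real m + 1) \<le> f m (D ` {..<m} \<inter> L)"
        using Ls(3) by (intro always_eventually allI) (simp add: less_imp_le diff_le_eq)
      show "\<forall>\<^sub>F m in sequentially. f m (D ` {..<m} \<inter> L) \<le> \<Phi> L" using fle[OF L] by simp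
    qed
  qed
  have fG: "finite (D ` {..<m})" for m :: nat by simp
  note tZ = integral_function_of_trace[OF N mZ fG]
  note tY = integral_function_of_trace[OF M mY fG]
  have "(\<lambda>m. \<integral>\<omega>. f m (D ` {..<m} \<inter> Z \<omega>) \<partial>N) \<longlonglongrightarrow> (\<integral>\<omega>. \<Phi> (Z \<omega>) \<partial>N)"
  proof (rule integral_dominated_convergence[where w = "\<lambda>_. C"])
    show "AE \<omega> in N. (\<lambda>m. f m (D ` {..<m} \<inter> Z \<omega>)) \<longlonglongrightarrow> \<Phi> (Z \<omega>)"
      using AEZ by eventually_elim (rule flim)
  qed (use \<Phi>Z tZ(1) fb in auto)
  then have "\<forall>\<^sub>F m in sequentially. y < (\<integral>\<omega>. f m (D ` {..<m} \<inter> Z \<omega>) \<partial>N)" using y by (rule order_tendstoD)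
  then obtain m where m: "y < (\<integral>\<omega>. f m (D ` {..<m} \<inter> Z \<omega>) \<partial>N)"
    using eventually_happens'[OF sequentially_bot] by blast
  have "(\<lambda>n. \<integral>\<omega>. f m (D ` {..<m} \<inter> Y n \<omega>) \<partial>M) \<longlonglongrightarrow> (\<integral>\<omega>. f m (D ` {..<m} \<inter> Z \<omega>) \<partial>N)"
    unfolding tZ(2) tY(2)
    by (intro tendsto_sum tendsto_mult tendsto_const tendsto_prob_trace[OF M N mY mZ conv])
      (auto intro: finite_subset)
  then have "\<forall>\<^sub>F n in sequentially. y < (\<integral>\<omega>. f m (D ` {..<m} \<inter> Y n \<omega>) \<partial>M)" using m by (rule order_tendstoD)
  then show ?thesis
  proof eventually_elim
    case (elim n)
    have "(\<integral>\<omega>. f m (D ` {..<m} \<inter> Y n \<omega>) \<partial>M) \<le> (\<integral>\<omega>. \<Phi> (Y n \<omega>) \<partial>M)"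
    proof (rule integral_mono_AE)
      show "AE \<omega> in M. f m (D ` {..<m} \<inter> Y n \<omega>) \<le> \<Phi> (Y n \<omega>)"
        using AEY[of n] by eventually_elim (rule fle)
      show "integrable M (\<lambda>\<omega>. f m (D ` {..<m} \<inter> Y n \<omega>))"
        using fb tY(1) by (intro M.integrable_const_bound[of _ C]) auto
      show "integrable M (\<lambda>\<omega>. \<Phi> (Y n \<omega>))"
        using bound \<Phi>Y by (intro M.integrable_const_bound[of _ C]) auto
    qed
    then show ?case using elim by simp
  qed
qed

lemma tendsto_integral_of_containment:
  fixes Y :: "nat \<Rightarrow> 'w \<Rightarrow> 'a::euclidean_space set" and Z :: "'v \<Rightarrow> 'a set" and \<Phi> :: "'a set \<Rightarrow> real"
  assumes M: "prob_space M" and N: "prob_space N"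
    and mY: "\<And>n x. {\<omega>\<in>space M. x \<in> Y n \<omega>} \<in> sets M" and mZ: "\<And>x. {\<omega>\<in>space N. x \<in> Z \<omega>} \<in> sets N"
    and conv: "\<And>F. finite F \<Longrightarrow> (\<lambda>n. measure M {\<omega>\<in>space M. F \<subseteq> Y n \<omega>}) \<longlonglongrightarrow> measure N {\<omega>\<in>space N. F \<subseteq> Z \<omega>}"
    and AEY: "\<And>n. AE \<omega> in M. origin_body (Y n \<omega>)" and AEZ: "AE \<omega> in N. origin_body (Z \<omega>)"
    and \<Phi>Y: "\<And>n. (\<lambda>\<omega>. \<Phi> (Y n \<omega>)) \<in> borel_measurable M" and \<Phi>Z: "(\<lambda>\<omega>. \<Phi> (Z \<omega>)) \<in> borel_measurable N"
    and bound: "\<And>L. \<bar>\<Phi> L\<bar> \<le> C"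
    and cont: "\<And>L Ls. origin_body L \<Longrightarrow> (\<And>m. origin_body (Ls m)) \<Longrightarrow>
        (\<And>m. D ` {..<m} \<inter> Ls m = D ` {..<m} \<inter> L) \<Longrightarrow> (\<lambda>m. \<Phi> (Ls m)) \<longlonglongrightarrow> \<Phi> L"
  shows "(\<lambda>n. \<integral>\<omega>. \<Phi> (Y n \<omega>) \<partial>M) \<longlonglongrightarrow> (\<integral>\<omega>. \<Phi> (Z \<omega>) \<partial>N)"
proof (rule order_tendstoI)
  fix y assume "y < (\<integral>\<omega>. \<Phi> (Z \<omega>) \<partial>N)"
  then show "\<forall>\<^sub>F n in sequentially. y < (\<integral>\<omega>. \<Phi> (Y n \<omega>) \<partial>M)"
    by (intro eventually_integral_greater_of_containment[OF M N mY mZ conv AEY AEZ, where \<Phi> = \<Phi> and C = C and D = D])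
      (assumption | rule \<Phi>Y \<Phi>Z bound cont)+
next
  fix y assume "(\<integral>\<omega>. \<Phi> (Z \<omega>) \<partial>N) < y"
  then have "- y < (\<integral>\<omega>. - \<Phi> (Z \<omega>) \<partial>N)" by simp
  moreover have "(\<lambda>\<omega>. - \<Phi> (Y n \<omega>)) \<in> borel_measurable M" for n using \<Phi>Y by simp
  moreover have "(\<lambda>\<omega>. - \<Phi> (Z \<omega>)) \<in> borel_measurable N" using \<Phi>Z by simp
  moreover have "\<bar>- \<Phi> L\<bar> \<le> C" for L using bound by simp
  ultimately have "\<forall>\<^sub>F n in sequentially. - y < (\<integral>\<omega>. - \<Phi> (Y n \<omega>) \<partial>M)"
    by (intro eventually_integral_greater_of_containment[OF M N mY mZ conv AEY AEZ, where \<Phi> = "\<lambda>L. - \<Phi> L" and C = C and D = D])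
      (assumption | rule tendsto_minus cont)+
  then show "\<forall>\<^sub>F n in sequentially. (\<integral>\<omega>. \<Phi> (Y n \<omega>) \<partial>M) < y" by simp
qed

section \<open>Polar sets of random convex sets\<close>

text \<open>
  A convex set without the origin in its interior lies in a half-space \<open>v \<bullet> x \<le> 0\<close>, and the polar set then
  contains the ray spanned by \<open>v\<close>.
\<close>

lemma unbounded_polar_set:
  fixes L :: "'a::euclidean_space set"
  assumes "convex L" "0 \<notin> interior L"
  shows "\<not> bounded (polar_set L)"
proof -
  obtain v where v: "v \<noteq> 0" "\<And>x. x \<in> L \<Longrightarrow> v \<bullet> x \<le> 0"
  proof (cases "interior L = {}")
    case True
    obtain a b where a: "a \<noteq> 0" "L \<subseteq> {x. a \<bullet> x = b}"
      using empty_interior_subset_hyperplane[OF assms(1) True] by blast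
    show ?thesis
    proof (cases "b \<le> 0")
      case True
      then show ?thesis using a by (intro that[of a]) auto
    next
      case False
      then show ?thesis using a by (intro that[of "- a"]) auto
    qed
  next
    case False
    obtain a where a: "a \<noteq> 0" "\<And>x. x \<in> interior L \<Longrightarrow> 0 \<le> a \<bullet> x"
      using separating_hyperplane_set_0[of "interior L"] assms by (auto simp: convex_interior)
    have "closed {x. 0 \<le> a \<bullet> x}" by (intro closed_Collect_le continuous_intros)
    then have "closure (interior L) \<subseteq> {x. 0 \<le> a \<bullet> x}" using a(2) by (intro closure_minimal) auto
    then have "L \<subseteq> {x. 0 \<le> a \<bullet> x}"
      using convex_closure_interior[OF assms(1) False] closure_subset by blast
    then show ?thesis using a(1) by (intro that[of "- a"]) auto
  qed
  show ?thesis
  proof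
    assume "bounded (polar_set L)"
    then obtain R where R: "\<And>u. u \<in> polar_set L \<Longrightarrow> norm u \<le> R" by (auto simp: bounded_iff)
    define s where "s = (\<bar>R\<bar> + 1) / norm v"
    have "0 \<le> s" by (simp add: s_def)
    then have "s *\<^sub>R v \<in> polar_set L"
      using v(2) mult_nonneg_nonpos[of s] by (force simp: polar_set_def)
    from R[OF this] show False using v(1) by (simp add: s_def)
  qed
qed

text \<open>
  A violated constraint at \<open>x\<close> is violated at interior points close to \<open>x\<close> on the segment from the origin, hence
  on an open set.
\<close>

lemma polar_set_eq_dense:
  fixes L :: "'a::euclidean_space set"
  assumes D: "\<And>U. open U \<Longrightarrow> U \<noteq> {} \<Longrightarrow> \<exists>i. D i \<in> U" and L: "convex L" "0 \<in> interior L"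
  shows "polar_set L = {u. \<forall>i. D i \<in> L \<longrightarrow> u \<bullet> D i \<le> 1}"
proof (intro equalityI subsetI)
  fix u assume u: "u \<in> {u. \<forall>i. D i \<in> L \<longrightarrow> u \<bullet> D i \<le> 1}"
  have "u \<bullet> x \<le> 1" if x: "x \<in> L" for x
  proof (rule ccontr)
    assume n: "\<not> u \<bullet> x \<le> 1"
    define s where "s = (1 + 1 / (u \<bullet> x)) / 2"
    have s: "0 \<le> s" "s < 1" "1 < s * (u \<bullet> x)" using n by (auto simp: s_def field_simps)
    have "s *\<^sub>R x \<in> interior L" using shrink_subset_interior[OF L s(1,2)] x by blast
    then have "interior L \<inter> {y. 1 < u \<bullet> y} \<noteq> {}" using s(3) by auto
    moreover have "open (interior L \<inter> {y. 1 < u \<bullet> y})"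
      by (intro open_Int open_interior open_Collect_less continuous_intros)
    ultimately obtain i where "D i \<in> interior L" "1 < u \<bullet> D i" using D by blast
    then show False using u interior_subset by fastforce
  qed
  then show "u \<in> polar_set L" by (simp add: polar_set_def)
qed (auto simp: polar_set_def)

text \<open>
  This makes the event that a random convex set contains the origin in its interior measurable: it is
  expressed by countably many membership events.
\<close>

lemma zero_in_interior_iff_scaled_vertices:
  obtains S :: "'a::euclidean_space set" where "finite S"
    "\<And>L. convex L \<Longrightarrow> 0 \<in> interior L \<longleftrightarrow> (\<exists>k::nat. \<forall>x\<in>S. (1 / (real k + 1)) *\<^sub>R x \<in> L)"
proof -
  obtain S :: "'a set" where S: "finite S" "cbox (0 - (\<Sum>i\<in>Basis. 1 *\<^sub>R i)) (0 + (\<Sum>i\<in>Basis. 1 *\<^sub>R i)) = convex hull S"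
    using cube_convex_hull[of 1 "0::'a"] by (auto simp: zero_less_one)
  have "0 \<in> interior L \<longleftrightarrow> (\<exists>k::nat. \<forall>x\<in>S. (1 / (real k + 1)) *\<^sub>R x \<in> L)" if L: "convex L" for L
  proof
    assume "0 \<in> interior L"
    then obtain r where r: "0 < r" "ball 0 r \<subseteq> L" by (auto simp: mem_interior)
    obtain B where B: "\<And>x. x \<in> S \<Longrightarrow> norm x \<le> B" using finite_imp_bounded[OF S(1)] by (auto simp: bounded_iff)
    obtain k :: nat where k: "B / r < real k" using reals_Archimedean2 by blast
    have "(1 / (real k + 1)) *\<^sub>R x \<in> L" if "x \<in> S" for x
    proof -
      have "norm x \<le> B" by (rule B[OF that])
      also have "B < real k * r" using k r by (simp add: pos_divide_less_eq)
      also have "\<dots> \<le> (real k + 1) * r" using r by simp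
      finally have "norm ((1 / (real k + 1)) *\<^sub>R x) < r" by (simp add: pos_divide_less_eq mult.commute)
      then show ?thesis using r by auto
    qed
    then show "\<exists>k::nat. \<forall>x\<in>S. (1 / (real k + 1)) *\<^sub>R x \<in> L" by blast
  next
    assume "\<exists>k::nat. \<forall>x\<in>S. (1 / (real k + 1)) *\<^sub>R x \<in> L"
    then obtain k :: nat where k: "\<And>x. x \<in> S \<Longrightarrow> (1 / (real k + 1)) *\<^sub>R x \<in> L" by blast
    define c where "c = 1 / (real k + 1)"
    have c: "0 < c" by (simp add: c_def)
    have "(\<lambda>x. c *\<^sub>R x) ` (convex hull S) = convex hull ((\<lambda>x. c *\<^sub>R x) ` S)"
      by (rule convex_hull_scaling[symmetric])
    also have "\<dots> \<subseteq> L" using k L by (intro hull_minimal) (auto simp: c_def)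
    finally have sub: "(\<lambda>x. c *\<^sub>R x) ` (convex hull S) \<subseteq> L" .
    have "ball 0 c \<subseteq> L"
    proof
      fix x :: 'a assume x: "x \<in> ball 0 c"
      have "\<bar>(x /\<^sub>R c) \<bullet> i\<bar> \<le> 1" if "i \<in> Basis" for i
      proof -
        have "\<bar>x \<bullet> i\<bar> \<le> norm x" by (rule Basis_le_norm[OF that])
        then show ?thesis using x c by (simp add: abs_mult divide_inverse[symmetric] mult.commute)
            (simp add: field_simps)
      qed
      then have "x /\<^sub>R c \<in> convex hull S"
        unfolding S(2)[symmetric] by (auto simp: mem_box inner_sum_left inner_Basis if_distrib abs_le_iff cong: if_cong)
      then have "c *\<^sub>R (x /\<^sub>R c) \<in> L" using sub by blast
      then show "x \<in> L" using c by simp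
    qed
    then show "0 \<in> interior L" using c by (auto simp: mem_interior)
  qed
  then show ?thesis using S(1) that by blast
qed

lemma is_convex_body_polar_imp: "convex L \<Longrightarrow> is_convex_body (polar_set L) \<Longrightarrow> 0 \<in> interior (L :: 'a::euclidean_space set)"
  using unbounded_polar_set[of L] compact_imp_bounded[of "polar_set L"] unfolding is_convex_body_def by blast

text \<open>
  On the event \<open>E\<close> that the origin is an interior point the polar set is described by countably many
  measurable constraints; off \<open>E\<close> it is unbounded, and \<open>to_body\<close> returns the same default value as for the
  whole space, which has no constraints.
\<close>

lemma measurable_to_body_polar:
  fixes X :: "'w \<Rightarrow> 'a::euclidean_space set"
  assumes X: "\<And>\<omega>. \<omega> \<in> space M \<Longrightarrow> convex (X \<omega>)" and mX: "\<And>x. {\<omega>\<in>space M. x \<in> X \<omega>} \<in> sets M"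
  shows "(\<lambda>\<omega>. to_body (polar_set (X \<omega>))) \<in> M \<rightarrow>\<^sub>M borel"
proof -
  obtain D :: "nat \<Rightarrow> 'a" where D: "\<And>U. open U \<Longrightarrow> U \<noteq> {} \<Longrightarrow> \<exists>i. D i \<in> U"
    using dense_sequence_exists by blast
  obtain S :: "'a set" where S: "finite S"
    "\<And>L. convex L \<Longrightarrow> 0 \<in> interior L \<longleftrightarrow> (\<exists>k::nat. \<forall>x\<in>S. (1 / (real k + 1)) *\<^sub>R x \<in> L)"
    using zero_in_interior_iff_scaled_vertices by blast
  define E where "E = {\<omega>\<in>space M. 0 \<in> interior (X \<omega>)}"
  have "E = {\<omega>\<in>space M. \<exists>k::nat. \<forall>x\<in>S. (1 / (real k + 1)) *\<^sub>R x \<in> X \<omega>}"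
    using S(2) X by (auto simp: E_def)
  also have "\<dots> \<in> sets M"
    by (intro sets.sets_Collect_countable_Ex sets.sets_Collect_finite_All S(1) mX)
  finally have E: "E \<in> sets M" .
  define g where "g i \<omega> u = indicator E \<omega> * (indicator {\<omega>\<in>space M. D i \<in> X \<omega>} \<omega> * (u \<bullet> D i - 1))" for i \<omega> u
  define Y where "Y \<omega> = {u. \<forall>i. g i \<omega> u \<le> 0}" for \<omega>
  have Y: "Y \<omega> = (if 0 \<in> interior (X \<omega>) then polar_set (X \<omega>) else UNIV)" if "\<omega> \<in> space M" for \<omega>
    using polar_set_eq_dense[OF D X[OF that]] that
    by (auto simp: Y_def g_def E_def split: split_indicator)
  have UNIV_body: "\<not> is_convex_body (UNIV :: 'a set)"
    by (auto simp: is_convex_body_def dest: compact_imp_bounded)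
  have eq: "to_body (polar_set (X \<omega>)) = to_body (Y \<omega>)" if w: "\<omega> \<in> space M" for \<omega>
  proof (cases "0 \<in> interior (X \<omega>)")
    case False
    then have "\<not> is_convex_body (polar_set (X \<omega>))" using is_convex_body_polar_imp[OF X[OF w]] by auto
    then show ?thesis using UNIV_body False by (simp add: Y[OF w] to_body_def)
  qed (simp add: Y[OF w])
  have "(\<lambda>\<omega>. to_body (Y \<omega>)) \<in> M \<rightarrow>\<^sub>M borel"
  proof (rule measurable_to_body)
    fix C :: "'a set" assume C: "compact C"
    have "{\<omega>\<in>space M. \<exists>u\<in>C. \<forall>i. g i \<omega> u \<le> 0} \<in> sets M"
    proof (rule sets_hits_compact[OF _ _ C])
      show "continuous_on UNIV (g i \<omega>)" for i \<omega> unfolding g_def by (intro continuous_intros)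
      show "(\<lambda>\<omega>. g i \<omega> u) \<in> borel_measurable M" for i u
        unfolding g_def using E mX by (intro borel_measurable_times borel_measurable_indicator) auto
    qed
    moreover have "{\<omega>\<in>space M. Y \<omega> \<inter> C \<noteq> {}} = {\<omega>\<in>space M. \<exists>u\<in>C. \<forall>i. g i \<omega> u \<le> 0}"
      by (auto simp: Y_def)
    ultimately show "{\<omega>\<in>space M. Y \<omega> \<inter> C \<noteq> {}} \<in> sets M" by simp
  qed (simp_all add: Y closed_polar_set convex_polar_set)
  then show ?thesis using eq by (simp cong: measurable_cong)
qed

section \<open>The zero cell is almost surely a convex body\<close>

text \<open>
  Starting in a ball inside \<open>K\<close> and walking in direction \<open>w\<close> with steps of length \<open>\<eta>\<close>, one leaves \<open>K\<close>
  after at most \<open>m \<approx> 2 R / \<eta>\<close> steps, through the layer.  So \<open>m\<close> translates of the layer cover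
  the ball.
\<close>

lemma content_exit_region_singleton_ge:
  fixes K :: "'a::euclidean_space set"
  assumes K: "compact K" "0 \<in> interior K" and w: "norm w = 1"
  shows "\<exists>c>0. \<forall>\<eta>. 0 < \<eta> \<longrightarrow> \<eta> \<le> 1 \<longrightarrow> c \<le> measure lborel (exit_region K \<eta> {0, w}) / \<eta>"
proof -
  obtain \<rho> where \<rho>: "0 < \<rho>" "ball 0 \<rho> \<subseteq> K" using K(2) by (auto simp: mem_interior)
  obtain R where R: "0 < R" "\<And>x. x \<in> K \<Longrightarrow> norm x \<le> R" using compact_imp_bounded[OF K(1)] by (auto simp: bounded_pos)
  define c where "c = measure lborel (ball (0::'a) \<rho>) / (2 * R + 2)"
  have c: "0 < c" using \<rho> R content_ball_pos[of \<rho> "0::'a"] by (simp add: c_def)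
  have "c \<le> measure lborel (exit_region K \<eta> {0, w}) / \<eta>" if \<eta>: "0 < \<eta>" "\<eta> \<le> 1" for \<eta>
  proof -
    define E where "E = exit_region K \<eta> {0, w}"
    define m where "m = nat \<lceil>2 * R / \<eta>\<rceil> + 1"
    have ceil: "2 * R / \<eta> \<le> of_int \<lceil>2 * R / \<eta>\<rceil>" "of_int \<lceil>2 * R / \<eta>\<rceil> < 2 * R / \<eta> + 1" by linarith+
    have "0 \<le> 2 * R / \<eta>" using R \<eta> by simp
    then have "0 \<le> \<lceil>2 * R / \<eta>\<rceil>" using ceil(1) by linarith
    then have mr: "real m = of_int \<lceil>2 * R / \<eta>\<rceil> + 1" by (simp add: m_def)
    have "2 * R \<le> of_int \<lceil>2 * R / \<eta>\<rceil> * \<eta>" using ceil(1) \<eta>(1) by (simp only: pos_divide_le_eq)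
    then have m1: "2 * R < real m * \<eta>" using \<eta>(1) unfolding mr by (simp add: distrib_right)
    have "real m * \<eta> < (2 * R / \<eta> + 2) * \<eta>" using ceil \<eta> unfolding mr by (intro mult_strict_right_mono) auto
    also have "\<dots> = 2 * R + 2 * \<eta>" using \<eta> by (simp add: distrib_right)
    finally have m2: "real m * \<eta> \<le> 2 * R + 2" using \<eta> by simp
    have Eb: "E \<in> sets borel" using K(1) by (simp add: E_def sets_exit_region compact_imp_closed)
    let ?T = "\<lambda>k. (\<lambda>x. x + (- (real k * \<eta>)) *\<^sub>R w) ` E"
    have cover: "ball 0 \<rho> \<subseteq> (\<Union>k\<in>{..<m}. ?T k)"
    proof
      fix y :: 'a assume y: "y \<in> ball 0 \<rho>"
      have "y + (real m * \<eta>) *\<^sub>R w \<notin> K"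
      proof
        assume "y + (real m * \<eta>) *\<^sub>R w \<in> K"
        then have "norm (y + (real m * \<eta>) *\<^sub>R w) \<le> R" by (rule R)
        moreover have "norm y \<le> R" using y \<rho> R by auto
        ultimately have "norm ((real m * \<eta>) *\<^sub>R w) \<le> 2 * R"
          using norm_triangle_ineq4[of "y + (real m * \<eta>) *\<^sub>R w" y] by simp
        then show False using w m1 \<eta> by simp
      qed
      moreover have "y + (real 0 * \<eta>) *\<^sub>R w \<in> K" using y \<rho> by auto
      ultimately obtain k where k: "k < m" "\<forall>i\<le>k. y + (real i * \<eta>) *\<^sub>R w \<in> K" "y + (real (Suc k) * \<eta>) *\<^sub>R w \<notin> K"
        using ex_least_nat_less[of "\<lambda>n. y + (real n * \<eta>) *\<^sub>R w \<notin> K" m] by auto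
      have "y + (real k * \<eta>) *\<^sub>R w \<in> E"
        using k(2,3) by (auto simp: E_def exit_region_def algebra_simps)
      then have "y \<in> ?T k" by (intro image_eqI[of _ _ "y + (real k * \<eta>) *\<^sub>R w"]) auto
      then show "y \<in> (\<Union>k\<in>{..<m}. ?T k)" using k(1) by blast
    qed
    have "bounded E" using compact_imp_bounded[OF K(1)] by (rule bounded_subset) (auto simp: E_def exit_region_def)
    then have Tb: "bounded (?T k)" for k
      using bounded_translation[of E "(- (real k * \<eta>)) *\<^sub>R w"] by (simp only: add.commute)
    have Tm: "?T k \<in> fmeasurable lborel" for k
      using content_translation(2)[OF Eb, of "(- (real k * \<eta>)) *\<^sub>R w"] emeasure_bounded_finite[OF Tb]
      by (intro fmeasurableI) auto
    have "measure lborel (ball (0::'a) \<rho>) \<le> measure lborel (\<Union>k\<in>{..<m}. ?T k)"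
      using cover Tm by (intro measure_mono_fmeasurable fmeasurable.finite_UN) auto
    also have "\<dots> \<le> (\<Sum>k\<in>{..<m}. measure lborel (?T k))"
      using fmeasurableD[OF Tm] by (intro measure_UNION_le) auto
    also have "\<dots> = real m * measure lborel E" by (simp only: content_translation(1)[OF Eb]) simp
    finally have "\<eta> * measure lborel (ball (0::'a) \<rho>) \<le> (real m * \<eta>) * measure lborel E"
      using \<eta> by (simp add: mult.commute mult.left_commute)
    also have "\<dots> \<le> (2 * R + 2) * measure lborel E" using m2 by (intro mult_right_mono) auto
    finally show ?thesis unfolding E_def[symmetric] c_def using \<eta> R by (simp add: field_simps)
  qed
  then show ?thesis using c by blast
qed

text \<open>
  If all the caps were null, the integral of the positive part of \<open>u \<bullet> w\<close> would vanish, while the layer in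
  direction \<open>w\<close> has volume at least \<open>c \<eta>\<close> with \<open>c > 0\<close>.
\<close>

lemma surface_area_measure_open_hemisphere:
  fixes K :: "'a::euclidean_space set"
  assumes K: "compact K" "convex K" "0 \<in> interior K" and w: "norm w = 1"
  shows "\<exists>t>0. emeasure (surface_area_measure K) {u \<in> sphere 0 1. t < u \<bullet> w} > 0"
proof (rule ccontr)
  assume n: "\<not> ?thesis"
  define \<eta> where "\<eta> n = 1 / (real n + 1)" for n
  have \<eta>: "0 < \<eta> n" "\<eta> n \<le> 1" for n by (auto simp: \<eta>_def)
  have \<eta>0: "\<eta> \<longlonglongrightarrow> 0" unfolding \<eta>_def by real_asymp
  obtain c where c: "0 < c" "\<And>\<eta>. 0 < \<eta> \<Longrightarrow> \<eta> \<le> 1 \<Longrightarrow> c \<le> measure lborel (exit_region K \<eta> {0, w}) / \<eta>"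
    using content_exit_region_singleton_ge[OF K(1,3) w] by blast
  have F: "finite {0, w}" "0 \<in> {0, w}" by auto
  have "(\<lambda>n. measure lborel (exit_region K (\<eta> n) {0, w}) / \<eta> n) \<longlonglongrightarrow> enn2real (support_integral K {0, w})"
    by (rule tendsto_content_exit_region[OF K F \<eta>(1) \<eta>0])
  then have "c \<le> enn2real (support_integral K {0, w})"
    by (rule LIMSEQ_le_const) (use c(2) \<eta> in auto)
  moreover have "support_integral K {0, w} = 0"
  proof -
    have z: "emeasure (surface_area_measure K) {u \<in> sphere 0 1. t < support {0, w} u} = 0" if "0 < t" for t
    proof -
      have "{u \<in> sphere 0 1. t < support {0, w} u} = {u \<in> sphere 0 1. t < u \<bullet> w}"
        using less_support_iff[OF F] that by auto
      moreover have "\<not> 0 < emeasure (surface_area_measure K) {u \<in> sphere 0 1. t < u \<bullet> w}" using n that by blast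
      ultimately show ?thesis by (simp only: not_gr_zero)
    qed
    have "support_integral K {0, w} = (\<integral>\<^sup>+t. 0 \<partial>(lborel :: real measure))"
      unfolding support_integral_def using z by (intro nn_integral_cong) (auto split: split_indicator)
    then show ?thesis by simp
  qed
  ultimately show False using c(1) by simp
qed

lemma content_pos_of_interior:
  fixes K :: "'a::euclidean_space set"
  assumes K: "compact K" "0 \<in> interior K"
  shows "0 < measure lborel K" "emeasure lborel K = ennreal (measure lborel K)"
proof -
  show eq: "emeasure lborel K = ennreal (measure lborel K)"
    using emeasure_bounded_finite[OF compact_imp_bounded[OF K(1)]] by (intro emeasure_eq_ennreal_measure) auto
  obtain r where r: "0 < r" "ball 0 r \<subseteq> K" using K(2) by (auto simp: mem_interior)
  have "0 < measure lborel (ball (0::'a) r)" using r by (simp add: content_ball_pos)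
  also have "\<dots> \<le> measure lborel K"
    using r K(1) emeasure_bounded_finite[OF compact_imp_bounded[OF K(1)]]
    by (intro measure_mono_fmeasurable fmeasurableI) (auto simp: compact_imp_closed)
  finally show "0 < measure lborel K" .
qed

context
  fixes K :: "'a::euclidean_space set" and N :: "'v measure" and p :: "nat \<Rightarrow> 'v \<Rightarrow> real \<times> 'a"
  assumes K: "compact K" "convex K" "0 \<in> interior K"
    and p: "poisson_process N (hyperplane_intensity K) p"
begin

lemma body_nonempty: "K \<noteq> {}" using K(3) interior_subset by auto

lemmas content_pos = content_pos_of_interior[OF K(1,3)]

lemma space_hyperplane_intensity: "space (hyperplane_intensity K) = {0<..} \<times> sphere 0 1"
  by (simp add: hyperplane_intensity_def space_pair_measure space_surface_area_measure space_restrict_space space_scale_measure)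

lemma point_in_space: "\<omega> \<in> space N \<Longrightarrow> p i \<omega> \<in> {0<..} \<times> sphere 0 1"
  using p measurable_space[of "p i" N "hyperplane_intensity K"] by (auto simp: poisson_process_def space_hyperplane_intensity)

lemma sets_hyperplane_intensity:
  "sets (hyperplane_intensity K) = sets (restrict_space lborel {0<..} \<Otimes>\<^sub>M restrict_space borel (sphere 0 1))"
  unfolding hyperplane_intensity_def
  by (intro sets_pair_measure_cong) (simp_all add: sets_surface_area_measure sets_scale_measure)

lemma borel_measurable_point [measurable]:
  "(\<lambda>\<omega>. fst (p i \<omega>)) \<in> borel_measurable N" "(\<lambda>\<omega>. snd (p i \<omega>)) \<in> borel_measurable N"
proof -
  have m: "p i \<in> N \<rightarrow>\<^sub>M restrict_space lborel {0<..} \<Otimes>\<^sub>M restrict_space borel (sphere 0 1)"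
    using p by (simp add: poisson_process_def measurable_cong_sets[OF refl sets_hyperplane_intensity])
  have "(\<lambda>x::real. x) \<in> restrict_space lborel {0<..} \<rightarrow>\<^sub>M borel" "(\<lambda>x::'a. x) \<in> restrict_space borel (sphere 0 1) \<rightarrow>\<^sub>M borel"
    by (auto intro!: measurable_restrict_space1)
  from measurable_compose[OF measurable_compose[OF m measurable_fst] this(1)]
    measurable_compose[OF measurable_compose[OF m measurable_snd] this(2)]
  show "(\<lambda>\<omega>. fst (p i \<omega>)) \<in> borel_measurable N" "(\<lambda>\<omega>. snd (p i \<omega>)) \<in> borel_measurable N" by auto
qed

lemma sets_hyperplane_intensityI:
  assumes "A \<in> sets (borel \<Otimes>\<^sub>M borel)"
  shows "A \<inter> ({0<..} \<times> sphere 0 1) \<in> sets (hyperplane_intensity K)"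
proof -
  have "(\<lambda>x. x) \<in> restrict_space lborel {0<..} \<Otimes>\<^sub>M restrict_space borel (sphere 0 1) \<rightarrow>\<^sub>M (borel \<Otimes>\<^sub>M borel :: (real \<times> 'a) measure)"
    by (intro measurable_Pair1' measurable_pair) (auto intro!: measurable_compose[OF measurable_fst] measurable_compose[OF measurable_snd] measurable_restrict_space1 simp: comp_def)
  from measurable_sets[OF this assms] show ?thesis
    unfolding sets_hyperplane_intensity by (simp add: space_pair_measure space_restrict_space)
qed

lemma emeasure_hyperplane_intensity:
  assumes A: "A \<in> sets (hyperplane_intensity K)"
  shows "emeasure (hyperplane_intensity K) A
    = ennreal (1 / measure lborel K) * (\<integral>\<^sup>+t. emeasure (surface_area_measure K) (Pair t -` A) * indicator {0<..} t \<partial>lborel)"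
proof -
  interpret S: finite_measure "surface_area_measure K"
    using emeasure_surface_area_measure_finite[OF K(1,2) body_nonempty]
    by (intro finite_measureI) (simp add: space_surface_area_measure)
  let ?R = "restrict_space lborel {0<..} :: real measure"
  have A': "A \<in> sets (?R \<Otimes>\<^sub>M surface_area_measure K)"
    using A sets_pair_measure_cong[of "scale_measure (1 / emeasure lborel K) ?R" ?R "surface_area_measure K" "surface_area_measure K"]
    by (simp add: hyperplane_intensity_def sets_scale_measure)
  have "emeasure (hyperplane_intensity K) A
      = (\<integral>\<^sup>+t. emeasure (surface_area_measure K) (Pair t -` A) \<partial>scale_measure (1 / emeasure lborel K) ?R)"
    using A unfolding hyperplane_intensity_def by (rule S.emeasure_pair_measure_alt)
  also have "\<dots> = 1 / emeasure lborel K * (\<integral>\<^sup>+t. emeasure (surface_area_measure K) (Pair t -` A) \<partial>?R)"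
    by (intro nn_integral_scale_measure S.measurable_emeasure_Pair A')
  also have "1 / emeasure lborel K = ennreal (1 / measure lborel K)"
    using content_pos by (simp add: divide_ennreal[symmetric])
  finally show ?thesis by (simp add: nn_integral_restrict_space)
qed

interpretation N: prob_space N using p by (simp add: poisson_process_def)

lemma prob_no_point:
  assumes A: "A \<in> sets (hyperplane_intensity K)" and fin: "emeasure (hyperplane_intensity K) A = ennreal a" "0 \<le> a"
  shows "measure N {\<omega>\<in>space N. \<forall>i. p i \<omega> \<notin> A} = exp (- a)"
proof -
  have "emeasure (hyperplane_intensity K) A < \<infinity>" using fin by simp
  then have "measure N {\<omega>\<in>space N. point_count p A \<omega> = of_nat 0} =
      exp (- measure (hyperplane_intensity K) A) * measure (hyperplane_intensity K) A ^ 0 / fact 0"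
    using p A unfolding poisson_process_def by blast
  moreover have "point_count p A \<omega> = of_nat 0 \<longleftrightarrow> (\<forall>i. p i \<omega> \<notin> A)" for \<omega>
    by (simp add: point_count_def emeasure_count_space_eq_0)
  moreover have "measure (hyperplane_intensity K) A = a" using fin by (simp add: measure_def)
  ultimately show ?thesis by simp
qed

text \<open>
  The void probability of the set of hyperplanes that separate some point of \<open>F\<close> from the origin.
\<close>

lemma prob_subset_zero_cell:
  assumes F: "finite F" "0 \<in> F"
  shows "measure N {\<omega>\<in>space N. F \<subseteq> zero_cell p \<omega>} = exp (- (enn2real (support_integral K F) / measure lborel K))"
proof -
  note [measurable] = borel_measurable_support[OF F(1)]
  define A where "A = {q. fst q < support F (snd q)} \<inter> ({0<..} \<times> sphere 0 1)"
  have "Measurable.pred (borel \<Otimes>\<^sub>M borel) (\<lambda>q. fst q < support F (snd q))" by measurable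
  then have A: "A \<in> sets (hyperplane_intensity K)" unfolding A_def
    by (intro sets_hyperplane_intensityI) (simp add: pred_def space_pair_measure)
  have "Pair t -` A = {u \<in> sphere 0 1. t < support F u}" if "0 < t" for t using that by (auto simp: A_def)
  then have "emeasure (surface_area_measure K) (Pair t -` A) * indicator {0<..} t
      = emeasure (surface_area_measure K) {u \<in> sphere 0 1. t < support F u} * indicator {0<..} t" for t
    by (cases "0 < t") simp_all
  then have "emeasure (hyperplane_intensity K) A = ennreal (1 / measure lborel K) * support_integral K F"
    unfolding emeasure_hyperplane_intensity[OF A] support_integral_def by (simp only:)
  also have "\<dots> = ennreal (enn2real (support_integral K F) / measure lborel K)"
  proof -
    have "(\<lambda>n. 1 / (real n + 2)) \<longlonglongrightarrow> 0" by real_asymp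
    then have "support_integral K F < \<infinity>"
      by (intro tendsto_support_integral(2)[OF K(1,2) body_nonempty F, of "\<lambda>n. 1 / (real n + 2)"]) (auto simp: field_simps)
    then show ?thesis using content_pos(1)
      by (cases "support_integral K F") (auto simp: ennreal_mult[symmetric])
  qed
  finally have em: "emeasure (hyperplane_intensity K) A = ennreal (enn2real (support_integral K F) / measure lborel K)" .
  have "{\<omega>\<in>space N. F \<subseteq> zero_cell p \<omega>} = {\<omega>\<in>space N. \<forall>i. p i \<omega> \<notin> A}"
  proof (rule Collect_cong, rule conj_cong[OF refl])
    fix \<omega> assume w: "\<omega> \<in> space N"
    have "F \<subseteq> neg_halfspace (p i \<omega>) \<longleftrightarrow> p i \<omega> \<notin> A" for i
      using less_support_iff[OF F, of "fst (p i \<omega>)" "snd (p i \<omega>)"] point_in_space[OF w, of i]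
      by (auto simp: A_def neg_halfspace_def inner_commute not_less split: prod.splits)
    then show "F \<subseteq> zero_cell p \<omega> \<longleftrightarrow> (\<forall>i. p i \<omega> \<notin> A)" unfolding zero_cell_def by blast
  qed
  then show ?thesis using prob_no_point[OF A em] content_pos(1) by simp
qed

lemma zero_cell_eq: "zero_cell p \<omega> = {x. \<forall>i. x \<bullet> snd (p i \<omega>) - fst (p i \<omega>) \<le> 0}"
  by (auto simp: zero_cell_def neg_halfspace_def split: prod.splits) (metis fst_conv snd_conv surj_pair)+

lemma closed_zero_cell: "closed (zero_cell p \<omega>)"
proof -
  have "zero_cell p \<omega> = (\<Inter>i. {x. x \<bullet> snd (p i \<omega>) - fst (p i \<omega>) \<le> 0})" unfolding zero_cell_eq by auto
  then show ?thesis by (auto intro!: closed_INT closed_Collect_le continuous_intros)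
qed

lemma convex_zero_cell: "convex (zero_cell p \<omega>)"
proof -
  have "zero_cell p \<omega> = (\<Inter>i. {x. snd (p i \<omega>) \<bullet> x \<le> fst (p i \<omega>)})" unfolding zero_cell_eq by (auto simp: inner_commute)
  then show ?thesis by (auto intro!: convex_INT convex_halfspace_le)
qed

lemma zero_in_zero_cell: "\<omega> \<in> space N \<Longrightarrow> 0 \<in> zero_cell p \<omega>"
  using point_in_space unfolding zero_cell_eq by (auto simp: mem_Times_iff less_imp_le)

lemma sets_mem_zero_cell: "{\<omega>\<in>space N. x \<in> zero_cell p \<omega>} \<in> sets N"
  unfolding zero_cell_eq mem_Collect_eq by measurable

lemma measurable_to_body_zero_cell: "(\<lambda>\<omega>. to_body (zero_cell p \<omega>)) \<in> N \<rightarrow>\<^sub>M borel"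
proof (rule measurable_to_body[OF closed_zero_cell convex_zero_cell])
  fix C :: "'a set" assume C: "compact C"
  have "{\<omega>\<in>space N. \<exists>x\<in>C. \<forall>i. x \<bullet> snd (p i \<omega>) - fst (p i \<omega>) \<le> 0} \<in> sets N"
    by (rule sets_hits_compact[OF _ _ C]) (auto intro!: continuous_intros)
  moreover have "{\<omega>\<in>space N. zero_cell p \<omega> \<inter> C \<noteq> {}} = {\<omega>\<in>space N. \<exists>x\<in>C. \<forall>i. x \<bullet> snd (p i \<omega>) - fst (p i \<omega>) \<le> 0}"
    unfolding zero_cell_eq by auto
  ultimately show "{\<omega>\<in>space N. zero_cell p \<omega> \<inter> C \<noteq> {}} \<in> sets N" by simp
qed

text \<open>
  If no hyperplane has distance less than \<open>r\<close> from the origin, the cell contains the ball of radius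
  \<open>r\<close>.  The number of such hyperplanes has mean \<open>r S / V(K)\<close>, which tends to \<open>0\<close> with \<open>r\<close>.
\<close>

lemma AE_zero_in_interior_zero_cell: "AE \<omega> in N. 0 \<in> interior (zero_cell p \<omega>)"
proof -
  obtain S where S: "emeasure (surface_area_measure K) (sphere 0 1) = ennreal S" "0 \<le> S"
    using emeasure_surface_area_measure_finite[OF K(1,2) body_nonempty]
    by (cases "emeasure (surface_area_measure K) (sphere 0 1)") auto
  define r where "r k = 1 / (real k + 1)" for k
  have r: "0 < r k" for k by (simp add: r_def)
  define A where "A k = ({..<r k} \<times> UNIV) \<inter> ({0<..} \<times> sphere (0::'a) 1)" for k
  have A: "A k \<in> sets (hyperplane_intensity K)" for k
    unfolding A_def by (intro sets_hyperplane_intensityI) auto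
  have em: "emeasure (hyperplane_intensity K) (A k) = ennreal (r k * S / measure lborel K)" for k
  proof -
    have "emeasure (surface_area_measure K) (Pair t -` A k) * indicator {0<..} t = ennreal S * indicator {0<..<r k} t" for t
    proof (cases "0 < t \<and> t < r k")
      case True
      then have "Pair t -` A k = sphere 0 1" by (auto simp: A_def)
      then show ?thesis using True S(1) by (simp only:) simp
    next
      case False
      then have "0 < t \<Longrightarrow> Pair t -` A k = {}" by (auto simp: A_def)
      then show ?thesis using False by (auto split: split_indicator)
    qed
    then have "emeasure (hyperplane_intensity K) (A k) = ennreal (1 / measure lborel K) * (ennreal S * ennreal (r k))"
      using r[of k] by (simp add: emeasure_hyperplane_intensity[OF A] nn_integral_cmult)
    also have "\<dots> = ennreal (r k * S / measure lborel K)"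
      using S r[of k] content_pos(1) by (simp add: ennreal_mult[symmetric] mult.commute)
    finally show ?thesis .
  qed
  define G where "G k = {\<omega>\<in>space N. \<forall>i. p i \<omega> \<notin> A k}" for k
  have prob: "measure N (G k) = exp (- (r k * S / measure lborel K))" for k
    unfolding G_def using S r[of k] content_pos(1) by (intro prob_no_point[OF A em]) auto
  have Gs: "G k \<in> sets N" for k
  proof -
    have "p i -` A k \<inter> space N \<in> sets N" for i
      using p A by (auto simp: poisson_process_def intro: measurable_sets)
    then have "{\<omega>\<in>space N. p i \<omega> \<notin> A k} \<in> sets N" for i
      using sets.sets_Collect_neg[of N "\<lambda>\<omega>. p i \<omega> \<in> A k"] by (simp add: vimage_def Int_def conj_commute)
    then show ?thesis unfolding G_def by (intro sets.sets_Collect_countable_All)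
  qed
  have "measure N (\<Union>k. G k) = 1"
  proof (rule antisym)
    have "(\<lambda>k. exp (- (r k * S / measure lborel K))) \<longlonglongrightarrow> exp (- (0 * S / measure lborel K))"
    proof (intro tendsto_intros)
      show "r \<longlonglongrightarrow> 0" unfolding r_def by real_asymp
    qed (use content_pos(1) in auto)
    then have lim: "(\<lambda>k. exp (- (r k * S / measure lborel K))) \<longlonglongrightarrow> 1" by simp
    have "exp (- (r k * S / measure lborel K)) \<le> measure N (\<Union>k. G k)" for k
      unfolding prob[symmetric] using Gs by (intro N.finite_measure_mono) auto
    then show "1 \<le> measure N (\<Union>k. G k)"
      by (intro LIMSEQ_le_const2[OF lim]) blast
  qed (rule N.prob_le_1)
  then have "AE \<omega> in N. \<omega> \<in> (\<Union>k. G k)" using Gs by (intro N.AE_prob_1) auto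
  then show ?thesis
  proof (rule AE_mp, intro AE_I2 impI)
    fix \<omega> assume w: "\<omega> \<in> space N" and "\<omega> \<in> (\<Union>k. G k)"
    then obtain k where k: "\<And>i. p i \<omega> \<notin> A k" by (auto simp: G_def)
    have "cball 0 (r k) \<subseteq> zero_cell p \<omega>"
    proof
      fix x :: 'a assume x: "x \<in> cball 0 (r k)"
      have "x \<bullet> snd (p i \<omega>) \<le> fst (p i \<omega>)" for i
      proof -
        have "r k \<le> fst (p i \<omega>)" "norm (snd (p i \<omega>)) = 1"
          using k[of i] point_in_space[OF w, of i] by (auto simp: A_def mem_Times_iff not_less)
        then show ?thesis using norm_cauchy_schwarz[of x "snd (p i \<omega>)"] x by simp
      qed
      then show "x \<in> zero_cell p \<omega>" by (simp add: zero_cell_eq)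
    qed
    then show "0 \<in> interior (zero_cell p \<omega>)" using r[of k] unfolding mem_interior_cball by blast
  qed
qed

text \<open>
  Every direction \<open>v\<close> is close to one of finitely many directions \<open>w\<close> whose caps \<open>u \<bullet> w > 2 t(w)\<close> have
  positive surface area measure.  The hyperplanes with normal in such a cap have infinite intensity, so
  almost surely at least one occurs; it bounds the cell in all directions within \<open>t(w)\<close> of \<open>w\<close>.
\<close>

lemma AE_bounded_zero_cell: "AE \<omega> in N. bounded (zero_cell p \<omega>)"
proof -
  have "\<exists>t. 0 < t \<and> emeasure (surface_area_measure K) {u \<in> sphere 0 1. 2 * t < u \<bullet> w} > 0" if w: "w \<in> sphere 0 1" for w
  proof -
    have "norm w = 1" using w by simp
    from surface_area_measure_open_hemisphere[OF K this] obtain t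
      where "0 < t" "emeasure (surface_area_measure K) {u \<in> sphere 0 1. t < u \<bullet> w} > 0" by blast
    then show ?thesis by (intro exI[of _ "t / 2"]) simp
  qed
  then obtain t where t: "\<And>w. w \<in> sphere 0 1 \<Longrightarrow> 0 < t w"
      "\<And>w. w \<in> sphere 0 1 \<Longrightarrow> emeasure (surface_area_measure K) {u \<in> sphere 0 1. 2 * t w < u \<bullet> w} > 0" by metis
  have "sphere (0::'a) 1 \<subseteq> (\<Union>w\<in>sphere 0 1. ball w (t w))" using t(1) by auto
  then obtain W where W: "W \<subseteq> sphere (0::'a) 1" "finite W" "sphere 0 1 \<subseteq> (\<Union>w\<in>W. ball w (t w))"
    using compactE_image[OF compact_sphere[of "0::'a" 1], of "sphere 0 1" "\<lambda>w. ball w (t w)"] by (metis open_ball)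
  have hit: "AE \<omega> in N. \<exists>i. 2 * t w < snd (p i \<omega>) \<bullet> w" if w: "w \<in> W" for w
  proof -
    define A where "A = {q :: real \<times> 'a. 2 * t w < snd q \<bullet> w} \<inter> ({0<..} \<times> sphere 0 1)"
    have "Measurable.pred (borel \<Otimes>\<^sub>M borel) (\<lambda>q :: real \<times> 'a. 2 * t w < snd q \<bullet> w)" by measurable
    then have A: "A \<in> sets (hyperplane_intensity K)" unfolding A_def
      by (intro sets_hyperplane_intensityI) (simp add: pred_def space_pair_measure)
    define s where "s = emeasure (surface_area_measure K) {u \<in> sphere 0 1. 2 * t w < u \<bullet> w}"
    have s: "0 < s" using t(2) w W(1) by (auto simp: s_def)
    have "emeasure (surface_area_measure K) (Pair x -` A) * indicator {0<..} x = s * indicator {0<..} x" for x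
    proof (cases "0 < x")
      case True
      then have "Pair x -` A = {u \<in> sphere 0 1. 2 * t w < u \<bullet> w}" by (auto simp: A_def)
      then show ?thesis by (simp add: s_def)
    qed simp
    then have "emeasure (hyperplane_intensity K) A = ennreal (1 / measure lborel K) * (s * emeasure lborel {0::real<..})"
      by (simp add: emeasure_hyperplane_intensity[OF A] nn_integral_cmult)
    also have "emeasure lborel {0::real<..} = \<infinity>"
    proof (rule ccontr)
      assume "emeasure lborel {0::real<..} \<noteq> \<infinity>"
      then obtain c where c: "emeasure lborel {0::real<..} = ennreal c" "0 \<le> c"
        by (cases "emeasure lborel {0::real<..}") auto
      have "emeasure lborel {0<..<c + 1} \<le> emeasure lborel {0::real<..}" by (intro emeasure_mono) auto
      then show False using c by (simp add: ennreal_le_iff)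
    qed
    finally have "emeasure (hyperplane_intensity K) A = \<infinity>"
      using s content_pos(1) by (simp add: ennreal_mult_top ennreal_mult_eq_top_iff)
    then have "AE \<omega> in N. point_count p A \<omega> = \<infinity>" using p A by (simp add: poisson_process_def)
    then show ?thesis
    proof eventually_elim
      case (elim \<omega>)
      have "{i. p i \<omega> \<in> A} \<noteq> {}"
      proof
        assume "{i. p i \<omega> \<in> A} = {}"
        with elim show False unfolding point_count_def by (simp only: emeasure_empty) simp
      qed
      then show ?case by (auto simp: A_def)
    qed
  qed
  then have "AE \<omega> in N. \<forall>w\<in>W. \<exists>i. 2 * t w < snd (p i \<omega>) \<bullet> w"
    using W(2) by (intro AE_finite_allI)
  then show ?thesis
  proof (rule AE_mp, intro AE_I2 impI)
    fix \<omega> assume w: "\<omega> \<in> space N" and "\<forall>w\<in>W. \<exists>i. 2 * t w < snd (p i \<omega>) \<bullet> w"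
    then obtain j where j: "\<And>w. w \<in> W \<Longrightarrow> 2 * t w < snd (p (j w) \<omega>) \<bullet> w" by metis
    define R where "R = Max (insert 0 ((\<lambda>w. fst (p (j w) \<omega>) / t w) ` W))"
    have "norm z \<le> R" if z: "z \<in> zero_cell p \<omega>" for z
    proof (cases "z = 0")
      case True
      then show ?thesis using W(2) by (simp add: R_def)
    next
      case False
      define v where "v = z /\<^sub>R norm z"
      have "v \<in> sphere 0 1" using False by (simp add: v_def)
      then obtain x where x: "x \<in> W" "dist x v < t x" using W(3) by auto
      define u where "u = snd (p (j x) \<omega>)"
      have u: "norm u = 1" using point_in_space[OF w, of "j x"] by (auto simp: u_def mem_Times_iff)
      have "u \<bullet> x - u \<bullet> v \<le> norm (x - v)"
        using norm_cauchy_schwarz[of u "x - v"] u by (simp add: inner_diff_right)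
      then have "t x < u \<bullet> v" using j[OF x(1)] x(2) by (simp add: u_def dist_norm)
      then have "norm z * t x \<le> norm z * (u \<bullet> v)" by (intro mult_left_mono) auto
      also have "\<dots> = z \<bullet> u" using False by (simp add: v_def inner_commute)
      also have "\<dots> \<le> fst (p (j x) \<omega>)" using z by (auto simp: zero_cell_eq u_def)
      finally have "norm z \<le> fst (p (j x) \<omega>) / t x"
        using t(1)[of x] x(1) W(1) by (simp add: pos_le_divide_eq subset_iff)
      also have "\<dots> \<le> R" using W(2) x(1) by (simp add: R_def)
      finally show ?thesis .
    qed
    then show "bounded (zero_cell p \<omega>)" by (auto simp: bounded_iff)
  qed
qed

lemma AE_origin_body_zero_cell: "AE \<omega> in N. origin_body (zero_cell p \<omega>)"
  using AE_zero_in_interior_zero_cell AE_bounded_zero_cell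
proof eventually_elim
  case (elim \<omega>)
  then show ?case
    using closed_zero_cell convex_zero_cell interior_subset
    by (auto simp: origin_body_def is_convex_body_def compact_eq_bounded_closed)
qed

end

section \<open>The rescaled intersections\<close>

lemma tendsto_one_minus_power_exp:
  fixes a :: "nat \<Rightarrow> real"
  assumes lim: "(\<lambda>n. real (Suc n) * a n) \<longlonglongrightarrow> c" and a: "\<And>n. 0 \<le> a n"
  shows "(\<lambda>n. (1 - a n) ^ Suc n) \<longlonglongrightarrow> exp (- c)"
proof -
  have "(\<lambda>n. (real (Suc n) * a n) * (1 / real (Suc n))) \<longlonglongrightarrow> c * 0"
    by (intro tendsto_mult lim) real_asymp
  then have a0: "a \<longlonglongrightarrow> 0" by simp
  have small: "\<forall>\<^sub>F n in sequentially. a n < 1" using order_tendstoD(2)[OF a0, of 1] by simp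
  have "(\<lambda>n. real (Suc n) * ln (1 - a n)) \<longlonglongrightarrow> - c"
  proof (rule real_tendsto_sandwich)
    show "\<forall>\<^sub>F n in sequentially. - ((real (Suc n) * a n) / (1 - a n)) \<le> real (Suc n) * ln (1 - a n)"
      using small
    proof eventually_elim
      case (elim n)
      have "ln (1 / (1 - a n)) \<le> 1 / (1 - a n) - 1" using elim by (intro ln_le_minus_one) simp
      moreover have "1 / (1 - a n) - 1 = a n / (1 - a n)" using elim by (simp add: field_simps)
      ultimately have "- (a n / (1 - a n)) \<le> ln (1 - a n)" using elim by (simp add: ln_div)
      then have "real (Suc n) * (- (a n / (1 - a n))) \<le> real (Suc n) * ln (1 - a n)" by (intro mult_left_mono) auto
      then show ?case by simp
    qed
    show "\<forall>\<^sub>F n in sequentially. real (Suc n) * ln (1 - a n) \<le> - (real (Suc n) * a n)"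
      using small
    proof eventually_elim
      case (elim n)
      have "ln (1 - a n) \<le> - a n" using ln_le_minus_one[of "1 - a n"] elim by simp
      then have "real (Suc n) * ln (1 - a n) \<le> real (Suc n) * (- a n)" by (intro mult_left_mono) auto
      then show ?case by simp
    qed
    have "(\<lambda>n. - ((real (Suc n) * a n) / (1 - a n))) \<longlonglongrightarrow> - (c / (1 - 0))"
      by (intro tendsto_intros lim a0) auto
    then show "(\<lambda>n. - ((real (Suc n) * a n) / (1 - a n))) \<longlonglongrightarrow> - c" by simp
    show "(\<lambda>n. - (real (Suc n) * a n)) \<longlonglongrightarrow> - c" by (intro tendsto_minus lim)
  qed
  then have "(\<lambda>n. exp (real (Suc n) * ln (1 - a n))) \<longlonglongrightarrow> exp (- c)" by (rule tendsto_exp)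
  moreover have "\<forall>\<^sub>F n in sequentially. exp (real (Suc n) * ln (1 - a n)) = (1 - a n) ^ Suc n"
    using small by eventually_elim (simp only: exp_of_nat_mult exp_ln diff_gt_0_iff_gt)
  ultimately show ?thesis by (rule Lim_transform_eventually)
qed

context
  fixes K :: "'a::euclidean_space set" and M :: "'w measure" and \<xi> :: "nat \<Rightarrow> 'w \<Rightarrow> 'a" and X :: "nat \<Rightarrow> 'w \<Rightarrow> 'a set"
  assumes K: "compact K" "convex K" "0 \<in> interior K" and M: "prob_space M"
    and indep: "prob_space.indep_vars M (\<lambda>_. borel) \<xi> {1..}"
    and distr: "\<And>i. i \<ge> 1 \<Longrightarrow> distr M borel (\<xi> i) = uniform_measure lborel K"
    and X: "\<And>n \<omega>. X n \<omega> = minkowski_diff K ((\<lambda>i. \<xi> i \<omega>) ` {1..n})"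
begin

interpretation M: prob_space M by (rule M)

lemma measurable_sample: "1 \<le> i \<Longrightarrow> \<xi> i \<in> M \<rightarrow>\<^sub>M borel"
  using indep unfolding M.indep_vars_def by auto

lemma prob_sample:
  assumes "1 \<le> i" "A \<in> sets borel"
  shows "measure M (\<xi> i -` A \<inter> space M) = measure lborel (K \<inter> A) / measure lborel K"
proof -
  have V: "emeasure lborel K = ennreal (measure lborel K)" "0 < measure lborel K"
    using content_pos_of_interior[OF K(1,3)] by auto
  have "measure M (\<xi> i -` A \<inter> space M) = measure (distr M borel (\<xi> i)) A"
    using assms measurable_sample by (intro measure_distr[symmetric]) auto
  also have "\<dots> = measure lborel (K \<inter> A) / measure lborel K"
    unfolding distr[OF assms(1)] using V assms by (intro measure_uniform_measure) auto
  finally show ?thesis .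
qed

lemma mem_intersection_iff: "x \<in> X n \<omega> \<longleftrightarrow> (\<forall>i\<in>{1..n}. \<xi> i \<omega> + x \<in> K)"
  by (auto simp: X minkowski_diff_def)

lemma mem_scaled_intersection_iff:
  assumes "0 < n"
  shows "x \<in> (\<lambda>x. real n *\<^sub>R x) ` X n \<omega> \<longleftrightarrow> (\<forall>i\<in>{1..n}. \<xi> i \<omega> + (1 / real n) *\<^sub>R x \<in> K)"
  using assms mem_scaleR_image_iff[of "real n" x "X n \<omega>"] by (simp add: mem_intersection_iff divide_inverse)

lemma scaled_intersection_eq:
  assumes "0 < n"
  shows "(\<lambda>x. real n *\<^sub>R x) ` X n \<omega> = {x. \<forall>i. (if i \<in> {1..n} then infdist (\<xi> i \<omega> + (1 / real n) *\<^sub>R x) K else 0) \<le> 0}"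
proof -
  have c: "closed K" "K \<noteq> {}" using K interior_subset by (auto simp: compact_imp_closed)
  have "infdist y K \<le> 0 \<longleftrightarrow> y \<in> K" for y
    using in_closed_iff_infdist_zero[OF c, of y] infdist_nonneg[of y K] by auto
  then show ?thesis by (intro set_eqI) (auto simp: mem_scaled_intersection_iff[OF assms])
qed

lemma closed_convex_scaled_intersection:
  assumes "0 < n"
  shows "closed ((\<lambda>x. real n *\<^sub>R x) ` X n \<omega>)" "convex ((\<lambda>x. real n *\<^sub>R x) ` X n \<omega>)"
proof -
  have eq: "X n \<omega> = (\<Inter>i\<in>{1..n}. (\<lambda>x. \<xi> i \<omega> + x) -` K)" by (auto simp: mem_intersection_iff)
  have "closed (X n \<omega>)" unfolding eq using K
    by (intro closed_INT ballI closed_vimage) (auto intro!: continuous_intros simp: compact_imp_closed)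
  then show "closed ((\<lambda>x. real n *\<^sub>R x) ` X n \<omega>)" by (rule closed_scaling)
  have "convex (X n \<omega>)" unfolding eq
  proof (intro convex_INT)
    fix i
    have "(\<lambda>x. \<xi> i \<omega> + x) -` K = (\<lambda>x. - \<xi> i \<omega> + x) ` K" by (auto intro: image_eqI[of _ _ "\<xi> i \<omega> + _"])
    then show "convex ((\<lambda>x. \<xi> i \<omega> + x) -` K)" using K by (simp add: convex_translation)
  qed
  then show "convex ((\<lambda>x. real n *\<^sub>R x) ` X n \<omega>)" by (rule convex_scaling)
qed

lemma sets_mem_scaled_intersection:
  assumes "0 < n"
  shows "{\<omega>\<in>space M. x \<in> (\<lambda>x. real n *\<^sub>R x) ` X n \<omega>} \<in> sets M"
proof -
  have Kb [measurable]: "K \<in> sets borel" using K by (simp add: compact_imp_closed)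
  have "{\<omega>\<in>space M. \<xi> i \<omega> + (1 / real n) *\<^sub>R x \<in> K} \<in> sets M" if "i \<in> {1..n}" for i
  proof -
    have [measurable]: "\<xi> i \<in> M \<rightarrow>\<^sub>M borel" using that by (intro measurable_sample) auto
    show ?thesis by measurable
  qed
  then show ?thesis unfolding mem_scaled_intersection_iff[OF assms] by (intro sets.sets_Collect_finite_All) auto
qed

lemma measurable_to_body_scaled_intersection:
  assumes n: "0 < n"
  shows "(\<lambda>\<omega>. to_body ((\<lambda>x. real n *\<^sub>R x) ` X n \<omega>)) \<in> M \<rightarrow>\<^sub>M borel"
proof (rule measurable_to_body[OF closed_convex_scaled_intersection[OF n]])
  fix C :: "'a set" assume C: "compact C"
  let ?g = "\<lambda>i \<omega> x. if i \<in> {1..n} then infdist (\<xi> i \<omega> + (1 / real n) *\<^sub>R x) K else 0"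
  have "{\<omega>\<in>space M. \<exists>x\<in>C. \<forall>i. ?g i \<omega> x \<le> 0} \<in> sets M"
  proof (rule sets_hits_compact[OF _ _ C])
    show "continuous_on UNIV (?g i \<omega>)" for i \<omega>
      by (cases "i \<in> {1..n}") (auto intro!: continuous_intros)
    show "(\<lambda>\<omega>. ?g i \<omega> x) \<in> borel_measurable M" for i x
    proof (cases "i \<in> {1..n}")
      case True
      then have [measurable]: "\<xi> i \<in> M \<rightarrow>\<^sub>M borel" by (intro measurable_sample) auto
      have "(\<lambda>\<omega>. infdist (\<xi> i \<omega> + (1 / real n) *\<^sub>R x) K) \<in> borel_measurable M"
        by (rule measurable_compose[OF _ borel_measurable_infdist]) measurable
      then show ?thesis using True by simp
    qed (simp only: if_False, simp)
  qed
  then show "{\<omega>\<in>space M. (\<lambda>x. real n *\<^sub>R x) ` X n \<omega> \<inter> C \<noteq> {}} \<in> sets M"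
    unfolding scaled_intersection_eq[OF n] by (simp add: Int_def conj_commute Bex_def)
qed

text \<open>
  The frontier of \<open>K\<close> is null, so almost surely all the points are interior; then sufficiently small
  translations keep all of them in \<open>K\<close>.
\<close>

lemma AE_origin_body_scaled_intersection:
  assumes n: "0 < n"
  shows "AE \<omega> in M. origin_body ((\<lambda>x. real n *\<^sub>R x) ` X n \<omega>)"
proof -
  have V: "0 < measure lborel K" using content_pos_of_interior[OF K(1,3)] by auto
  have "AE \<omega> in M. \<xi> i \<omega> \<in> interior K" if i: "i \<in> {1..n}" for i
  proof -
    have neg: "negligible (frontier K)" using K by (intro negligible_convex_frontier)
    have "measure lebesgue (interior K) = measure lebesgue K"
      by (rule measure_interior[OF compact_imp_bounded[OF K(1)] neg])
    then have "measure lborel (interior K) = measure lborel K" using K by (simp add: compact_imp_closed)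
    moreover have "K \<inter> interior K = interior K" using interior_subset by auto
    ultimately have "measure M (\<xi> i -` interior K \<inter> space M) = 1"
      using prob_sample[of i "interior K"] i V by simp
    moreover have "\<xi> i -` interior K \<inter> space M \<in> sets M"
      using measurable_sample[of i] i by (intro measurable_sets) auto
    ultimately have "AE \<omega> in M. \<omega> \<in> \<xi> i -` interior K \<inter> space M" by (intro M.AE_prob_1)
    then show ?thesis by eventually_elim auto
  qed
  then have "AE \<omega> in M. \<forall>i\<in>{1..n}. \<xi> i \<omega> \<in> interior K" by (intro AE_finite_allI) auto
  then show ?thesis
  proof eventually_elim
    case (elim \<omega>)
    let ?Y = "(\<lambda>x. real n *\<^sub>R x) ` X n \<omega>"
    define U where "U = (\<Inter>i\<in>{1..n}. (\<lambda>x. \<xi> i \<omega> + (1 / real n) *\<^sub>R x) -` interior K)"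
    have "open U" unfolding U_def
      by (intro open_INT ballI open_vimage open_interior) (auto intro!: continuous_intros)
    moreover have "0 \<in> U" using elim by (auto simp: U_def)
    moreover have "U \<subseteq> ?Y" using subsetD[OF interior_subset[of K]] unfolding U_def by (auto simp: mem_scaled_intersection_iff[OF n])
    ultimately have int: "0 \<in> interior ?Y" by (rule interiorI)
    have "X n \<omega> \<subseteq> (\<lambda>x. - \<xi> 1 \<omega> + x) ` K"
      using n by (auto simp: mem_intersection_iff intro!: image_eqI[of _ _ "\<xi> 1 \<omega> + _"])
    moreover have "bounded ((\<lambda>x. - \<xi> 1 \<omega> + x) ` K)" using K by (intro bounded_translation compact_imp_bounded)
    ultimately have "bounded ?Y" using bounded_subset bounded_scaling by blast
    then show ?case using int closed_convex_scaled_intersection[OF n] interior_subset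
      by (auto simp: origin_body_def is_convex_body_def compact_eq_bounded_closed)
  qed
qed

text \<open>
  The event says that all \<open>n + 1\<close> points lie in the erosion of \<open>K\<close> by \<open>F / (n + 1)\<close>.  Adding the origin to
  \<open>F\<close> changes it only by the null event that some point is not in \<open>K\<close>.
\<close>

lemma prob_subset_scaled_intersection:
  "measure M {\<omega>\<in>space M. F \<subseteq> (\<lambda>x. real (Suc n) *\<^sub>R x) ` X (Suc n) \<omega>}
    = (1 - measure lborel (exit_region K (1 / real (Suc n)) (insert 0 F)) / measure lborel K) ^ Suc n"
proof -
  have V: "0 < measure lborel K" using content_pos_of_interior[OF K(1,3)] by auto
  define E where "E = erosion K (1 / real (Suc n)) F"
  have E: "E \<in> sets borel"
    unfolding E_def by (rule borel_closed[OF closed_erosion[OF compact_imp_closed[OF K(1)]]])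
  have "{\<omega>\<in>space M. F \<subseteq> (\<lambda>x. real (Suc n) *\<^sub>R x) ` X (Suc n) \<omega>} = (\<Inter>i\<in>{1..Suc n}. \<xi> i -` E \<inter> space M)"
  proof (intro set_eqI iffI)
    fix \<omega> assume "\<omega> \<in> {\<omega>\<in>space M. F \<subseteq> (\<lambda>x. real (Suc n) *\<^sub>R x) ` X (Suc n) \<omega>}"
    then have "\<omega> \<in> space M" "\<And>x. x \<in> F \<Longrightarrow> x \<in> (\<lambda>x. real (Suc n) *\<^sub>R x) ` X (Suc n) \<omega>" by auto
    then show "\<omega> \<in> (\<Inter>i\<in>{1..Suc n}. \<xi> i -` E \<inter> space M)"
      using mem_scaled_intersection_iff[of "Suc n"] by (auto simp only: E_def erosion_def INT_iff vimage_eq Int_iff mem_Collect_eq zero_less_Suc)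
  next
    fix \<omega> assume w: "\<omega> \<in> (\<Inter>i\<in>{1..Suc n}. \<xi> i -` E \<inter> space M)"
    then have "\<omega> \<in> space M" "\<And>i. i \<in> {1..Suc n} \<Longrightarrow> \<xi> i \<omega> \<in> E" by auto
    moreover have "x \<in> (\<lambda>x. real (Suc n) *\<^sub>R x) ` X (Suc n) \<omega>" if "x \<in> F" for x
      using calculation(2) that by (subst mem_scaled_intersection_iff) (auto simp only: E_def erosion_def mem_Collect_eq zero_less_Suc)
    ultimately show "\<omega> \<in> {\<omega>\<in>space M. F \<subseteq> (\<lambda>x. real (Suc n) *\<^sub>R x) ` X (Suc n) \<omega>}" by blast
  qed
  then have "measure M {\<omega>\<in>space M. F \<subseteq> (\<lambda>x. real (Suc n) *\<^sub>R x) ` X (Suc n) \<omega>}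
      = (\<Prod>i\<in>{1..Suc n}. measure M (\<xi> i -` E \<inter> space M))"
    using M.indep_varsD[OF indep, of "{1..Suc n}" "\<lambda>_. E"] E by auto
  also have "\<dots> = (\<Prod>i\<in>{1..Suc n}. measure lborel (K \<inter> E) / measure lborel K)"
    using E by (intro prod.cong prob_sample) auto
  also have "\<dots> = (measure lborel (K \<inter> E) / measure lborel K) ^ Suc n" by (simp only: prod_constant card_atLeastAtMost) simp
  also have "K \<inter> E = erosion K (1 / real (Suc n)) (insert 0 F)" by (auto simp: E_def erosion_def)
  also have "measure lborel (erosion K (1 / real (Suc n)) (insert 0 F))
      = measure lborel K - measure lborel (exit_region K (1 / real (Suc n)) (insert 0 F))"
    using content_exit_region[OF K(1), of "insert 0 F" "1 / real (Suc n)"] by simp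
  finally show ?thesis using V by (simp add: diff_divide_distrib)
qed

lemma tendsto_prob_subset_scaled_intersection:
  assumes F: "finite F"
  shows "(\<lambda>n. measure M {\<omega>\<in>space M. F \<subseteq> (\<lambda>x. real (Suc n) *\<^sub>R x) ` X (Suc n) \<omega>})
    \<longlonglongrightarrow> exp (- (enn2real (support_integral K (insert 0 F)) / measure lborel K))"
  unfolding prob_subset_scaled_intersection
proof (rule tendsto_one_minus_power_exp)
  have V: "0 < measure lborel K" using content_pos_of_interior[OF K(1,3)] by auto
  have "(\<lambda>n. measure lborel (exit_region K (1 / real (Suc n)) (insert 0 F)) / (1 / real (Suc n)))
      \<longlonglongrightarrow> enn2real (support_integral K (insert 0 F))"
    using F by (intro tendsto_content_exit_region K) (auto simp del: of_nat_Suc intro: LIMSEQ_inverse_real_of_nat[unfolded inverse_eq_divide])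
  then have "(\<lambda>n. measure lborel (exit_region K (1 / real (Suc n)) (insert 0 F)) / (1 / real (Suc n)) / measure lborel K)
      \<longlonglongrightarrow> enn2real (support_integral K (insert 0 F)) / measure lborel K"
    using V by (intro tendsto_divide tendsto_const) auto
  then show "(\<lambda>n. real (Suc n) * (measure lborel (exit_region K (1 / real (Suc n)) (insert 0 F)) / measure lborel K))
      \<longlonglongrightarrow> enn2real (support_integral K (insert 0 F)) / measure lborel K"
    by (simp add: mult.commute del: of_nat_Suc)
qed simp

lemma polar_scaled_intersection:
  assumes "0 < n"
  shows "(\<lambda>u. (1 / real n) *\<^sub>R u) ` polar_set (X n \<omega>) = polar_set ((\<lambda>x. real n *\<^sub>R x) ` X n \<omega>)"
  using assms mem_scaleR_image_iff[of "1 / real n" _ "polar_set (X n \<omega>)"]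
  by (intro set_eqI) (auto simp: polar_set_def)

text \<open>
  The empty intersection is the whole space; its rescaling by the factor \<open>0\<close>, and that of its polar
  set \<open>{0}\<close>, collapse to the origin.
\<close>

lemma scaled_intersection_0: "(\<lambda>x. real 0 *\<^sub>R x) ` X 0 \<omega> = {0}" "(\<lambda>u. (1 / real 0) *\<^sub>R u) ` polar_set (X 0 \<omega>) = {0}"
proof -
  have "X 0 \<omega> = UNIV" by (auto simp: mem_intersection_iff)
  then show "(\<lambda>x. real 0 *\<^sub>R x) ` X 0 \<omega> = {0}" by auto
  have "0 \<in> polar_set (X 0 \<omega>)" by (simp add: polar_set_def)
  then show "(\<lambda>u. (1 / real 0) *\<^sub>R u) ` polar_set (X 0 \<omega>) = {0}" by auto
qed

end

section \<open>Convergence to the zero cell and to its polar set\<close>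

lemma random_convex_bodyI:
  assumes "AE \<omega> in M. origin_body (X \<omega>)" "(\<lambda>\<omega>. to_body (X \<omega>)) \<in> M \<rightarrow>\<^sub>M borel"
  shows "random_convex_body M X"
  using assms unfolding random_convex_body_def origin_body_def by auto

lemma random_convex_body_const: "is_convex_body L \<Longrightarrow> random_convex_body M (\<lambda>_. L)"
  by (simp add: random_convex_body_def)

lemma AE_origin_body_polar: "AE \<omega> in M. origin_body (X \<omega>) \<Longrightarrow> AE \<omega> in M. origin_body (polar_set (X \<omega>))"
  by (elim AE_mp) (simp add: origin_body_polar)

text \<open>
  The map \<open>T\<close> is the identity for the first claim of the theorem and \<open>polar_set\<close> for the second one.
\<close>

lemma weakly_converges_body_distr:
  fixes Y :: "nat \<Rightarrow> 'w \<Rightarrow> 'a::euclidean_space set" and Z :: "'v \<Rightarrow> 'a set" and T :: "'a set \<Rightarrow> 'a set"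
  assumes M: "prob_space M" and N: "prob_space N"
    and mY: "\<And>n x. {\<omega>\<in>space M. x \<in> Y n \<omega>} \<in> sets M" and mZ: "\<And>x. {\<omega>\<in>space N. x \<in> Z \<omega>} \<in> sets N"
    and conv: "\<And>F. finite F \<Longrightarrow> (\<lambda>n. measure M {\<omega>\<in>space M. F \<subseteq> Y n \<omega>}) \<longlonglongrightarrow> measure N {\<omega>\<in>space N. F \<subseteq> Z \<omega>}"
    and AEY: "\<And>n. AE \<omega> in M. origin_body (Y n \<omega>)" and AEZ: "AE \<omega> in N. origin_body (Z \<omega>)"
    and TY: "\<And>n. (\<lambda>\<omega>. to_body (T (Y n \<omega>))) \<in> M \<rightarrow>\<^sub>M borel" and TZ: "(\<lambda>\<omega>. to_body (T (Z \<omega>))) \<in> N \<rightarrow>\<^sub>M borel"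
    and cont: "\<And>L Ls. origin_body L \<Longrightarrow> (\<And>m. origin_body (Ls m)) \<Longrightarrow>
        (\<And>m. D ` {..<m} \<inter> Ls m = D ` {..<m} \<inter> L) \<Longrightarrow> (\<lambda>m. to_body (T (Ls m))) \<longlonglongrightarrow> to_body (T L)"
  shows "weakly_converges (\<lambda>n. body_distr M (\<lambda>\<omega>. T (Y n \<omega>))) (body_distr N (\<lambda>\<omega>. T (Z \<omega>)))"
  unfolding weakly_converges_def
proof (intro allI impI)
  fix f :: "'a convex_body \<Rightarrow> real" assume f: "continuous_on UNIV f" and "bounded (range f)"
  then obtain C where C: "\<And>L. \<bar>f L\<bar> \<le> C" by (auto simp: bounded_iff)
  have fm: "f \<in> borel_measurable borel" using f by (rule borel_measurable_continuous_onI)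
  have "(\<lambda>n. \<integral>\<omega>. f (to_body (T (Y n \<omega>))) \<partial>M) \<longlonglongrightarrow> (\<integral>\<omega>. f (to_body (T (Z \<omega>))) \<partial>N)"
  proof (rule tendsto_integral_of_containment[OF M N mY mZ conv AEY AEZ, where \<Phi> = "\<lambda>L. f (to_body (T L))" and C = C and D = D])
    fix L and Ls :: "nat \<Rightarrow> 'a set"
    assume "origin_body L" "\<And>m. origin_body (Ls m)" "\<And>m. D ` {..<m} \<inter> Ls m = D ` {..<m} \<inter> L"
    from cont[OF this] show "(\<lambda>m. f (to_body (T (Ls m)))) \<longlonglongrightarrow> f (to_body (T L))"
      by (rule continuous_on_tendsto_compose[OF f]) auto
  qed (auto intro: measurable_compose[OF TY fm] measurable_compose[OF TZ fm] C)
  then show "(\<lambda>n. \<integral>x. f x \<partial>body_distr M (\<lambda>\<omega>. T (Y n \<omega>))) \<longlonglongrightarrow> (\<integral>x. f x \<partial>body_distr N (\<lambda>\<omega>. T (Z \<omega>)))"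
    unfolding body_distr_def by (simp add: integral_distr[OF TY fm] integral_distr[OF TZ fm])
qed

lemma weakly_converges_SucD: "weakly_converges (\<lambda>n. \<mu> (Suc n)) \<nu> \<Longrightarrow> weakly_converges \<mu> \<nu>"
  unfolding weakly_converges_def by (auto intro: LIMSEQ_imp_Suc)

theorem theorem5p1:
  fixes K :: "'a::euclidean_space set"
    and M :: "'w measure" and \<xi> :: "nat \<Rightarrow> 'w \<Rightarrow> 'a"
    and N :: "'v measure" and p :: "nat \<Rightarrow> 'v \<Rightarrow> real \<times> 'a"
    and X :: "nat \<Rightarrow> 'w \<Rightarrow> 'a set"
  assumes "compact K" and "convex K" and "0 \<in> interior K"
    and "prob_space M"
    and "prob_space.indep_vars M (\<lambda>_. borel) \<xi> {1..}"
    and "\<And>i. i \<ge> 1 \<Longrightarrow> distr M borel (\<xi> i) = uniform_measure lborel K"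
    and X_def: "\<And>n \<omega>. X n \<omega> = minkowski_diff K ((\<lambda>i. \<xi> i \<omega>) ` {1..n})"
    and "poisson_process N (hyperplane_intensity K) p"
  shows "converges_in_distr M (\<lambda>n \<omega>. (\<lambda>x. real n *\<^sub>R x) ` X n \<omega>) N (zero_cell p) \<and>
         converges_in_distr M (\<lambda>n \<omega>. (\<lambda>u. (1 / real n) *\<^sub>R u) ` polar_set (X n \<omega>))
           N (\<lambda>\<omega>. polar_set (zero_cell p \<omega>))"
proof -
  note sample = assms(1-7) and poisson = assms(1-3,8)
  have N: "prob_space N" using assms(8) by (simp add: poisson_process_def)
  obtain D :: "nat \<Rightarrow> 'a" where D: "\<And>U. open U \<Longrightarrow> U \<noteq> {} \<Longrightarrow> \<exists>i. D i \<in> U"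
    using dense_sequence_exists by blast
  \<comment> \<open>The index is shifted because the body with index \<open>0\<close> degenerates to the origin.\<close>
  define Y where "Y n \<omega> = (\<lambda>x. real (Suc n) *\<^sub>R x) ` X (Suc n) \<omega>" for n \<omega>
  have mY: "{\<omega>\<in>space M. x \<in> Y n \<omega>} \<in> sets M" for n x
    unfolding Y_def by (rule sets_mem_scaled_intersection[OF sample zero_less_Suc])
  note mZ = sets_mem_zero_cell[OF poisson]
  have conv: "(\<lambda>n. measure M {\<omega>\<in>space M. F \<subseteq> Y n \<omega>}) \<longlonglongrightarrow> measure N {\<omega>\<in>space N. F \<subseteq> zero_cell p \<omega>}"
    if F: "finite F" for F
  proof -
    have "{\<omega>\<in>space N. F \<subseteq> zero_cell p \<omega>} = {\<omega>\<in>space N. insert 0 F \<subseteq> zero_cell p \<omega>}"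
      using zero_in_zero_cell[OF poisson] by auto
    then have "measure N {\<omega>\<in>space N. F \<subseteq> zero_cell p \<omega>} = exp (- (enn2real (support_integral K (insert 0 F)) / measure lborel K))"
      using prob_subset_zero_cell[OF poisson, of "insert 0 F"] F by simp
    then show ?thesis using tendsto_prob_subset_scaled_intersection[OF sample F] by (simp add: Y_def)
  qed
  have AEY: "AE \<omega> in M. origin_body (Y n \<omega>)" for n
    unfolding Y_def by (rule AE_origin_body_scaled_intersection[OF sample zero_less_Suc])
  note AEZ = AE_origin_body_zero_cell[OF poisson]
  have bY: "(\<lambda>\<omega>. to_body (Y n \<omega>)) \<in> M \<rightarrow>\<^sub>M borel" for n
    unfolding Y_def by (rule measurable_to_body_scaled_intersection[OF sample zero_less_Suc])
  note bZ = measurable_to_body_zero_cell[OF poisson]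
  have cY: "convex (Y n \<omega>)" for n \<omega>
    unfolding Y_def by (rule closed_convex_scaled_intersection(2)[OF sample zero_less_Suc])
  have pY: "(\<lambda>\<omega>. to_body (polar_set (Y n \<omega>))) \<in> M \<rightarrow>\<^sub>M borel" for n
    by (rule measurable_to_body_polar[OF cY mY])
  have pZ: "(\<lambda>\<omega>. to_body (polar_set (zero_cell p \<omega>))) \<in> N \<rightarrow>\<^sub>M borel"
    by (rule measurable_to_body_polar[OF convex_zero_cell[OF poisson] mZ])
  have Y_polar: "(\<lambda>u. (1 / real (Suc n)) *\<^sub>R u) ` polar_set (X (Suc n) \<omega>) = polar_set (Y n \<omega>)" for n \<omega>
    unfolding Y_def by (rule polar_scaled_intersection[OF sample zero_less_Suc])
  have zero: "is_convex_body {0::'a}" by (simp add: is_convex_body_def)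
  have "random_convex_body M (\<lambda>\<omega>. (\<lambda>x. real n *\<^sub>R x) ` X n \<omega>)" for n
    by (cases n) (simp_all only: scaled_intersection_0[OF sample] Y_def[symmetric] random_convex_body_const[OF zero] random_convex_bodyI[OF AEY bY])
  moreover have "random_convex_body M (\<lambda>\<omega>. (\<lambda>u. (1 / real n) *\<^sub>R u) ` polar_set (X n \<omega>))" for n
    by (cases n) (simp_all only: scaled_intersection_0[OF sample] Y_polar random_convex_body_const[OF zero]
        random_convex_bodyI[OF AE_origin_body_polar[OF AEY] pY])
  moreover have "random_convex_body N (zero_cell p)" "random_convex_body N (\<lambda>\<omega>. polar_set (zero_cell p \<omega>))"
    by (rule random_convex_bodyI[OF AEZ bZ], rule random_convex_bodyI[OF AE_origin_body_polar[OF AEZ] pZ])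
  moreover have "weakly_converges (\<lambda>n. body_distr M (\<lambda>\<omega>. (\<lambda>x. real n *\<^sub>R x) ` X n \<omega>)) (body_distr N (zero_cell p))"
  proof (rule weakly_converges_SucD)
    have "weakly_converges (\<lambda>n. body_distr M (\<lambda>\<omega>. Y n \<omega>)) (body_distr N (\<lambda>\<omega>. zero_cell p \<omega>))"
      by (rule weakly_converges_body_distr[OF assms(4) N mY mZ conv AEY AEZ, where T = "\<lambda>L. L" and D = D])
        (assumption | rule bY bZ tendsto_to_body_of_trace(1)[OF D])+
    then show "weakly_converges (\<lambda>n. body_distr M (\<lambda>\<omega>. (\<lambda>x. real (Suc n) *\<^sub>R x) ` X (Suc n) \<omega>)) (body_distr N (zero_cell p))"
      by (simp only: Y_def)
  qed
  moreover have "weakly_converges (\<lambda>n. body_distr M (\<lambda>\<omega>. (\<lambda>u. (1 / real n) *\<^sub>R u) ` polar_set (X n \<omega>)))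
      (body_distr N (\<lambda>\<omega>. polar_set (zero_cell p \<omega>)))"
  proof (rule weakly_converges_SucD)
    show "weakly_converges (\<lambda>n. body_distr M (\<lambda>\<omega>. (\<lambda>u. (1 / real (Suc n)) *\<^sub>R u) ` polar_set (X (Suc n) \<omega>)))
      (body_distr N (\<lambda>\<omega>. polar_set (zero_cell p \<omega>)))"
      unfolding Y_polar
      by (rule weakly_converges_body_distr[OF assms(4) N mY mZ conv AEY AEZ, where T = polar_set and D = D])
        (assumption | rule pY pZ tendsto_to_body_of_trace(2)[OF D])+
  qed
  ultimately show ?thesis unfolding converges_in_distr_def by blast
qed

end
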